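(* Let $y\in W$ and $\gamma\in\Gamma_y$. Then $C^\gamma_y=\widehat\Sigma_y\cap C^\gamma$ is determined as a subvariety of $C^\gamma$ by $\ell(y)$ equations $X_\alpha=0$, $\alpha\in R^+\cap y(R^-)$, where $$X_\alpha=\Bigl(\sum_{i:\ \beta_i=\alpha}\pm x_i\Bigr)+\widetilde X_\alpha$$ for a polynomial $\widetilde X_\alpha$ all of whose terms have degree at least $2$ in the variables $\{x_j\mid \mathrm{ht}(\beta_j)<\mathrm{ht}(\alpha)\}$ (the signs being determined by the pinning of $G$). In particular, $C^\gamma_y$ is the graph of a polynomial function in $\#J(\gamma)-\ell(y)$ variables and hence a cell of dimension $\#D(\gamma)$.
   Context: Let $G$ be a connected semisimple complex algebraic group of adjoint type with a fixed pinning: $T$ is the maximal torus, $R$ the set of roots, $R^+$ and $R^-=-R^+$ the positive and negative roots, $\mathrm{ht}$ the height of a root, $B\supset T$ the Borel subgroup belonging to $R^+$, $W$ the Weyl group with Bruhat order $\le$ and length function $\ell$, $s_\alpha\in W$ the reflection attached to $\alpha\in R$, $p_\alpha\colon\mathbb C\to U_\alpha$ the one-parameter root subgroups of the pinning. For a simple root $\alpha$, $P_\alpha$ is the parabolic subgroup generated by $B$ and $s_\alpha$. Elements of $W$ are also viewed as elements of $G$ via representatives given by the pinning. Fix a sequence $\mathbf s=(s_1,\dots,s_r)$ of simple reflections (not necessarily a reduced word), $s_i=s_{\alpha_i}$ with $\alpha_i$ simple. The Bott--Samelson variety $\widehat\Sigma=P_{\alpha_1}\times_B\cdots\times_B P_{\alpha_r}/B$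 is the quotient of $P_{\alpha_1}\times\cdots\times P_{\alpha_r}$ by the right action $(p_1,\dots,p_r)\cdot(b_1,\dots,b_r)=(p_1b_1,b_1^{-1}p_2b_2,\dots,b_{r-1}^{-1}p_rb_r)$ of $B^r$; classes are written $[p_1,\dots,p_r]$; $\pi\colon\widehat\Sigma\to G/B$, $[p_1,\dots,p_r]\mapsto p_1\cdots p_rB/B$; $\widehat\Sigma_y=\pi^{-1}(yB/B)$ for $y\in W$. Galleries: $\Gamma=\{[\gamma_1,\dots,\gamma_r]\mid\gamma_i\in\{s_i,\mathrm{id}\}\}$ (the $T$-fixed points of $\widehat\Sigma$). For $\gamma\in\Gamma$ put $\gamma^i=\gamma_1\cdots\gamma_i$, $\Gamma_y=\{\gamma\in\Gamma\mid\gamma^r=y\}$, $\beta_i=\gamma^i(-\alpha_i)$, $\widetilde\alpha_i=\gamma_i(-\alpha_i)$, $\widetilde\beta_i=\gamma^{i-1}(-\alpha_i)$, $J(\gamma)=\{i\mid\beta_i\in R^+\}$, $D(\gamma)=\{i\mid\widetilde\beta_i\in R^+\}$. Cells: $C^\gamma=\{[p_{\widetilde\alpha_1}(x_1)\gamma_1,\dots,p_{\widetilde\alpha_r}(x_r)\gamma_r]\mid x_i\in\mathbb C,\ x_i=0\text{ if }\beta_i<0\}$, an affine space with coordinates $x_i$, $i\in J(\gamma)$ (a Bialynicki--Birula cell of $\widehat\Sigma$). *)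

theory Defs
  imports
    "HOL-Analysis.Analysis"
    "HOL-Computational_Algebra.Polynomial"
    "HOL-Library.Poly_Mapping"
    "HOL-Algebra.Group_Action"
    "HOL-Algebra.Solvable_Groups"
begin

section \<open>Polynomials in several variables\<close>

type_synonym 'v cpoly = "('v \<Rightarrow>\<^sub>0 nat) \<Rightarrow>\<^sub>0 complex"

definition peval :: "'v cpoly \<Rightarrow> ('v \<Rightarrow> complex) \<Rightarrow> complex" where
  "peval f v = (\<Sum>m\<in>Poly_Mapping.keys f. Poly_Mapping.lookup f m *
                  (\<Prod>i\<in>Poly_Mapping.keys m. v i ^ Poly_Mapping.lookup m i))"

definition pvars :: "'v cpoly \<Rightarrow> 'v set" where
  "pvars f = (\<Union>m\<in>Poly_Mapping.keys f. Poly_Mapping.keys m)"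

definition mono_degree :: "('v \<Rightarrow>\<^sub>0 nat) \<Rightarrow> nat" where
  "mono_degree m = (\<Sum>i\<in>Poly_Mapping.keys m. Poly_Mapping.lookup m i)"

definition pvar :: "'v \<Rightarrow> 'v cpoly" where
  "pvar i = Poly_Mapping.single (Poly_Mapping.single i 1) 1"

definition pconst :: "complex \<Rightarrow> 'v cpoly" where
  "pconst c = Poly_Mapping.single 0 c"

text \<open>The affine space with coordinates indexed by \<open>J\<close>; coordinates outside \<open>J\<close> are \<open>0\<close>.\<close>

definition coord_space :: "nat set \<Rightarrow> (nat \<Rightarrow> complex) set" where
  "coord_space J = {x. \<forall>i. i \<notin> J \<longrightarrow> x i = 0}"

definition poly_map :: "nat set \<Rightarrow> (nat \<Rightarrow> nat cpoly) \<Rightarrow> (nat \<Rightarrow> complex) \<Rightarrow> nat \<Rightarrow> complex" where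
  "poly_map J f x = (\<lambda>i. if i \<in> J then peval (f i) x else 0)"

text \<open>The subset \<open>Z\<close> of the affine space with coordinates in \<open>J\<close> is isomorphic, by mutually
  inverse polynomial maps, to affine \<open>d\<close>-space.\<close>

definition affine_cell :: "nat set \<Rightarrow> (nat \<Rightarrow> complex) set \<Rightarrow> nat \<Rightarrow> bool" where
  "affine_cell J Z d \<longleftrightarrow> Z \<subseteq> coord_space J \<and>
     (\<exists>f g. (\<forall>t\<in>coord_space {1..d}. poly_map J f t \<in> Z \<and> poly_map {1..d} g (poly_map J f t) = t) \<and>
            (\<forall>z\<in>Z. poly_map J f (poly_map {1..d} g z) = z))"

section \<open>Linear algebraic groups\<close>

type_synonym 'n cmat = "complex ^ 'n ^ 'n"

definition mat_eval :: "('n \<times> 'n) cpoly \<Rightarrow> ('n::finite) cmat \<Rightarrow> complex" where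
  "mat_eval f A = peval f (\<lambda>(i, j). A $ i $ j)"

definition zariski :: "('n::finite) cmat topology" where
  "zariski = topology_generated_by (range (\<lambda>f. {A. mat_eval f A \<noteq> 0}))"

definition GLn :: "('n::finite) cmat monoid" where
  "GLn = \<lparr>carrier = {A. invertible A}, mult = (**), one = mat 1\<rparr>"

abbreviation as_group :: "('n::finite) cmat set \<Rightarrow> 'n cmat monoid" where
  "as_group H \<equiv> GLn\<lparr>carrier := H\<rparr>"

definition linear_algebraic_group :: "('n::finite) cmat set \<Rightarrow> bool" where
  "linear_algebraic_group H \<longleftrightarrow>
     subgroup H GLn \<and> closedin (subtopology zariski (carrier GLn)) H"

definition semisimple_group :: "('n::finite) cmat set \<Rightarrow> bool" where
  "semisimple_group G \<longleftrightarrow>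
     linear_algebraic_group G \<and> connectedin zariski G \<and>
     (\<forall>H. H \<lhd> as_group G \<and> linear_algebraic_group H \<and> connectedin zariski H \<and>
           solvable (as_group H) \<longrightarrow> H = {mat 1})"

definition torus :: "('n::finite) cmat set \<Rightarrow> bool" where
  "torus S \<longleftrightarrow>
     linear_algebraic_group S \<and> connectedin zariski S \<and>
     (\<exists>P :: 'n cmat. invertible P \<and> (\<forall>t\<in>S. \<forall>i j. i \<noteq> j \<longrightarrow> (matrix_inv P ** t ** P) $ i $ j = 0))"

definition maximal_torus :: "('n::finite) cmat set \<Rightarrow> 'n cmat set \<Rightarrow> bool" where
  "maximal_torus G S \<longleftrightarrow>
     torus S \<and> S \<subseteq> G \<and> (\<forall>S'. torus S' \<and> S \<subseteq> S' \<and> S' \<subseteq> G \<longrightarrow> S' = S)"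

text \<open>Tangent space at the identity; polynomials on the matrix space suffice, since \<open>G\<close> is
  closed in the open subset of invertible matrices.\<close>

definition lie_algebra :: "('n::finite) cmat set \<Rightarrow> 'n cmat set" where
  "lie_algebra G = {X. \<forall>f. (\<forall>g\<in>G. mat_eval f g = 0) \<longrightarrow>
     ((\<lambda>z. mat_eval f (mat 1 + mat z ** X)) has_field_derivative 0) (at 0)}"

section \<open>Characters, roots and bases\<close>

text \<open>A character of \<open>S\<close> is a function on \<open>S\<close>, extended by \<open>undefined\<close>. The character group is
  written multiplicatively in the code, so that the root \<open>-\<alpha>\<close> is the pointwise inverse of \<open>\<alpha>\<close>.\<close>

type_synonym 'n character = "'n cmat \<Rightarrow> complex"

definition characters :: "('n::finite) cmat set \<Rightarrow> 'n character set" where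
  "characters S = {c \<in> extensional S.
     (\<forall>t\<in>S. c t \<noteq> 0) \<and> (\<forall>t\<in>S. \<forall>u\<in>S. c (t ** u) = c t * c u) \<and>
     (\<exists>f k. \<forall>t\<in>S. c t = mat_eval f t / det t ^ k)}"

definition char_neg :: "('n::finite) cmat set \<Rightarrow> 'n character \<Rightarrow> 'n character" where
  "char_neg S c = (\<lambda>t\<in>S. inverse (c t))"

definition char_comb ::
  "('n::finite) cmat set \<Rightarrow> 'n character set \<Rightarrow> ('n character \<Rightarrow> int) \<Rightarrow> 'n character" where
  "char_comb S A m = (\<lambda>t\<in>S. \<Prod>c\<in>A. c t powi m c)"

definition root_space :: "('n::finite) cmat set \<Rightarrow> 'n cmat set \<Rightarrow> 'n character \<Rightarrow> 'n cmat set" where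
  "root_space G S c = {X \<in> lie_algebra G. \<forall>t\<in>S. t ** X ** matrix_inv t = mat (c t) ** X}"

definition root_set :: "('n::finite) cmat set \<Rightarrow> 'n cmat set \<Rightarrow> 'n character set" where
  "root_set G S = {c \<in> characters S. c \<noteq> (\<lambda>t\<in>S. 1) \<and> root_space G S c \<noteq> {0}}"

definition root_base ::
  "('n::finite) cmat set \<Rightarrow> 'n cmat set \<Rightarrow> 'n character set \<Rightarrow> bool" where
  "root_base G S A \<longleftrightarrow> A \<subseteq> root_set G S \<and>
     (\<forall>m. char_comb S A m = (\<lambda>t\<in>S. 1) \<longrightarrow> (\<forall>c\<in>A. m c = 0)) \<and>
     (\<forall>c\<in>root_set G S. \<exists>m. c = char_comb S A m \<and> ((\<forall>d\<in>A. 0 \<le> m d) \<or> (\<forall>d\<in>A. m d \<le> 0)))"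

text \<open>The group is of adjoint type if the roots span the character lattice of the torus.\<close>

definition adjoint_type :: "('n::finite) cmat set \<Rightarrow> 'n cmat set \<Rightarrow> bool" where
  "adjoint_type G S \<longleftrightarrow> (\<forall>c\<in>characters S. \<exists>m. c = char_comb S (root_set G S) m)"

text \<open>A root homomorphism: a homomorphism of algebraic groups from the additive group to \<open>G\<close>,
  equivariant for the torus, whose differential is an isomorphism onto the root space.\<close>

definition root_hom ::
  "('n::finite) cmat set \<Rightarrow> 'n cmat set \<Rightarrow> 'n character \<Rightarrow> (complex \<Rightarrow> 'n cmat) \<Rightarrow> bool" where
  "root_hom G S c u \<longleftrightarrow>
     (\<forall>i j. \<exists>q. \<forall>x. u x $ i $ j = poly q x) \<and>
     (\<forall>x. u x \<in> G) \<and> (\<forall>x y. u (x + y) = u x ** u y) \<and>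
     (\<forall>t\<in>S. \<forall>x. t ** u x ** matrix_inv t = u (c t * x)) \<and>
     (let E = (\<chi> i j. deriv (\<lambda>x. u x $ i $ j) 0)
      in E \<noteq> 0 \<and> root_space G S c = range (\<lambda>z. mat z ** E))"

definition cocharacter :: "('n::finite) cmat set \<Rightarrow> (complex \<Rightarrow> 'n cmat) \<Rightarrow> bool" where
  "cocharacter S h \<longleftrightarrow>
     (\<forall>z. z \<noteq> 0 \<longrightarrow> h z \<in> S) \<and> (\<forall>z w. z \<noteq> 0 \<and> w \<noteq> 0 \<longrightarrow> h (z * w) = h z ** h w) \<and>
     (\<forall>i j. \<exists>q k. \<forall>z. z \<noteq> 0 \<longrightarrow> h z $ i $ j = poly q z / z ^ k)"

text \<open>Conjugation by \<open>n\<close> acts on the torus as the reflection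
  \<open>t \<mapsto> t h(\<alpha>(t))\<^sup>-\<^sup>1\<close> for a cocharacter \<open>h\<close> with \<open>\<langle>\<alpha>,h\<rangle> = 2\<close>; equivalently, it acts on
  characters by \<open>\<chi> \<mapsto> \<chi> - \<langle>\<chi>,h\<rangle>\<alpha>\<close>.\<close>

definition represents_reflection ::
  "('n::finite) cmat set \<Rightarrow> 'n cmat set \<Rightarrow> 'n character \<Rightarrow> 'n cmat \<Rightarrow> bool" where
  "represents_reflection G S c n \<longleftrightarrow> n \<in> normalizer (as_group G) S \<and>
     (\<exists>h. cocharacter S h \<and> (\<forall>z. z \<noteq> 0 \<longrightarrow> c (h z) = z\<^sup>2) \<and>
          (\<forall>t\<in>S. n ** t ** matrix_inv n = t ** h (inverse (c t))))"

section \<open>Pinned groups\<close>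

text \<open>A group with a maximal torus, the simple roots, and a family of root homomorphisms
  (one for each root).\<close>

record ('n::finite) pinned_group =
  Grp :: "'n cmat set"
  Tor :: "'n cmat set"
  Simp :: "'n character set"
  rhom :: "'n character \<Rightarrow> complex \<Rightarrow> 'n cmat"

abbreviation GG :: "('n::finite) pinned_group \<Rightarrow> 'n cmat monoid" where
  "GG Q \<equiv> as_group (Grp Q)"

definition Roots :: "('n::finite) pinned_group \<Rightarrow> 'n character set" where
  "Roots Q = root_set (Grp Q) (Tor Q)"

abbreviation rneg :: "('n::finite) pinned_group \<Rightarrow> 'n character \<Rightarrow> 'n character" where
  "rneg Q \<equiv> char_neg (Tor Q)"

definition PosRoots :: "('n::finite) pinned_group \<Rightarrow> 'n character set" where
  "PosRoots Q = {c \<in> Roots Q. \<exists>m. c = char_comb (Tor Q) (Simp Q) m \<and> (\<forall>d\<in>Simp Q. 0 \<le> m d)}"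

definition NegRoots :: "('n::finite) pinned_group \<Rightarrow> 'n character set" where
  "NegRoots Q = rneg Q ` PosRoots Q"

definition ht :: "('n::finite) pinned_group \<Rightarrow> 'n character \<Rightarrow> int" where
  "ht Q c = (THE k. \<exists>m. c = char_comb (Tor Q) (Simp Q) m \<and> k = (\<Sum>d\<in>Simp Q. m d))"

text \<open>The representative in \<open>G\<close> of a simple reflection given by the pinning.\<close>

definition nrep :: "('n::finite) pinned_group \<Rightarrow> 'n character \<Rightarrow> 'n cmat" where
  "nrep Q c = rhom Q c 1 ** rhom Q (rneg Q c) (- 1) ** rhom Q c 1"

text \<open>The Weyl group is \<open>N(T)/T\<close>; its elements are cosets of \<open>T\<close>.\<close>

definition Weyl :: "('n::finite) pinned_group \<Rightarrow> 'n cmat set monoid" where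
  "Weyl Q = (GG Q)\<lparr>carrier := normalizer (GG Q) (Tor Q)\<rparr> Mod Tor Q"

definition sref :: "('n::finite) pinned_group \<Rightarrow> 'n character \<Rightarrow> 'n cmat set" where
  "sref Q c = Tor Q #>\<^bsub>GG Q\<^esub> nrep Q c"

text \<open>Action of the Weyl group on characters, independent of the chosen representative because
  the torus is commutative.\<close>

definition wact :: "('n::finite) pinned_group \<Rightarrow> 'n cmat set \<Rightarrow> 'n character \<Rightarrow> 'n character" where
  "wact Q w c = (let n = (SOME n. n \<in> w) in (\<lambda>t\<in>Tor Q. c (matrix_inv n ** t ** n)))"

text \<open>The family of root homomorphisms attached to a pinning is a Chevalley system extending the
  choices made for the simple roots: it is stable, up to signs, under the representatives of the
  simple reflections.\<close>

definition pinned_semisimple_adjoint_group :: "('n::finite) pinned_group \<Rightarrow> bool" where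
  "pinned_semisimple_adjoint_group Q \<longleftrightarrow>
     semisimple_group (Grp Q) \<and>
     maximal_torus (Grp Q) (Tor Q) \<and>
     adjoint_type (Grp Q) (Tor Q) \<and>
     root_base (Grp Q) (Tor Q) (Simp Q) \<and>
     (\<forall>c\<in>Roots Q. root_hom (Grp Q) (Tor Q) c (rhom Q c)) \<and>
     (\<forall>c\<in>Simp Q. represents_reflection (Grp Q) (Tor Q) c (nrep Q c)) \<and>
     (\<forall>c\<in>Simp Q. \<forall>d\<in>Roots Q. \<exists>e\<in>{1, -1}. \<forall>x.
        nrep Q c ** rhom Q d x ** matrix_inv (nrep Q c) = rhom Q (wact Q (sref Q c) d) (e * x))"

definition Borel :: "('n::finite) pinned_group \<Rightarrow> 'n cmat set" where
  "Borel Q = generate (GG Q) (Tor Q \<union> (\<Union>c\<in>PosRoots Q. range (rhom Q c)))"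

definition Parabolic :: "('n::finite) pinned_group \<Rightarrow> 'n character \<Rightarrow> 'n cmat set" where
  "Parabolic Q c = generate (GG Q) (Borel Q \<union> sref Q c)"

primrec seq_prod :: "('a, 'b) monoid_scheme \<Rightarrow> (nat \<Rightarrow> 'a) \<Rightarrow> nat \<Rightarrow> 'a" where
  "seq_prod M g 0 = \<one>\<^bsub>M\<^esub>"
| "seq_prod M g (Suc i) = seq_prod M g i \<otimes>\<^bsub>M\<^esub> g (Suc i)"

definition wlength :: "('n::finite) pinned_group \<Rightarrow> 'n cmat set \<Rightarrow> nat" where
  "wlength Q w = (LEAST k. \<exists>a. (\<forall>i\<in>{1..k}. a i \<in> Simp Q) \<and> w = seq_prod (Weyl Q) (\<lambda>i. sref Q (a i)) k)"

section \<open>Bott--Samelson varieties\<close>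

text \<open>Throughout, \<open>a 1, \<dots>, a r\<close> is the sequence of simple roots; tuples are functions on \<open>{1..r}\<close>.\<close>

definition bs_class ::
  "('n::finite) pinned_group \<Rightarrow> nat \<Rightarrow> (nat \<Rightarrow> 'n cmat) \<Rightarrow> (nat \<Rightarrow> 'n cmat) set" where
  "bs_class Q r g = {(\<lambda>i\<in>{1..r}. matrix_inv (b (i - 1)) ** g i ** b i) | b.
                       b 0 = mat 1 \<and> (\<forall>i\<in>{1..r}. b i \<in> Borel Q)}"

definition bott_samelson ::
  "('n::finite) pinned_group \<Rightarrow> nat \<Rightarrow> (nat \<Rightarrow> 'n character) \<Rightarrow> (nat \<Rightarrow> 'n cmat) set set" where
  "bott_samelson Q r a = bs_class Q r ` (\<Pi>\<^sub>E i\<in>{1..r}. Parabolic Q (a i))"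

text \<open>The map to \<open>G/B\<close>, the set of left cosets; its value is independent of the representative.\<close>

definition bs_proj :: "('n::finite) pinned_group \<Rightarrow> nat \<Rightarrow> (nat \<Rightarrow> 'n cmat) set \<Rightarrow> 'n cmat set" where
  "bs_proj Q r C = the_elem ((\<lambda>g. seq_prod (GG Q) g r <#\<^bsub>GG Q\<^esub> Borel Q) ` C)"

text \<open>For \<open>y = nT\<close> in the Weyl group, \<open>y <#> B\<close> is the point \<open>nB\<close> of \<open>G/B\<close>.\<close>

definition bs_fibre ::
  "('n::finite) pinned_group \<Rightarrow> nat \<Rightarrow> (nat \<Rightarrow> 'n character) \<Rightarrow> 'n cmat set \<Rightarrow> (nat \<Rightarrow> 'n cmat) set set" where
  "bs_fibre Q r a y = {C \<in> bott_samelson Q r a. bs_proj Q r C = y <#>\<^bsub>GG Q\<^esub> Borel Q}"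

section \<open>Galleries and cells\<close>

text \<open>A gallery is given by the sequence of Weyl group elements \<open>\<gamma>\<^sub>i \<in> {s\<^sub>i, id}\<close>.\<close>

definition galleries ::
  "('n::finite) pinned_group \<Rightarrow> nat \<Rightarrow> (nat \<Rightarrow> 'n character) \<Rightarrow> (nat \<Rightarrow> 'n cmat set) set" where
  "galleries Q r a = (\<Pi>\<^sub>E i\<in>{1..r}. {sref Q (a i), \<one>\<^bsub>Weyl Q\<^esub>})"

definition gpre :: "('n::finite) pinned_group \<Rightarrow> (nat \<Rightarrow> 'n cmat set) \<Rightarrow> nat \<Rightarrow> 'n cmat set" where
  "gpre Q \<gamma> i = seq_prod (Weyl Q) \<gamma> i"

definition galleries_to ::
  "('n::finite) pinned_group \<Rightarrow> nat \<Rightarrow> (nat \<Rightarrow> 'n character) \<Rightarrow> 'n cmat set \<Rightarrow> (nat \<Rightarrow> 'n cmat set) set" where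
  "galleries_to Q r a y = {\<gamma> \<in> galleries Q r a. gpre Q \<gamma> r = y}"

definition groot ::
  "('n::finite) pinned_group \<Rightarrow> (nat \<Rightarrow> 'n character) \<Rightarrow> (nat \<Rightarrow> 'n cmat set) \<Rightarrow> nat \<Rightarrow> 'n character" where
  "groot Q a \<gamma> i = wact Q (gpre Q \<gamma> i) (rneg Q (a i))"

definition galpha ::
  "('n::finite) pinned_group \<Rightarrow> (nat \<Rightarrow> 'n character) \<Rightarrow> (nat \<Rightarrow> 'n cmat set) \<Rightarrow> nat \<Rightarrow> 'n character" where
  "galpha Q a \<gamma> i = wact Q (\<gamma> i) (rneg Q (a i))"

definition groot_pre ::
  "('n::finite) pinned_group \<Rightarrow> (nat \<Rightarrow> 'n character) \<Rightarrow> (nat \<Rightarrow> 'n cmat set) \<Rightarrow> nat \<Rightarrow> 'n character" where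
  "groot_pre Q a \<gamma> i = wact Q (gpre Q \<gamma> (i - 1)) (rneg Q (a i))"

definition Jset ::
  "('n::finite) pinned_group \<Rightarrow> nat \<Rightarrow> (nat \<Rightarrow> 'n character) \<Rightarrow> (nat \<Rightarrow> 'n cmat set) \<Rightarrow> nat set" where
  "Jset Q r a \<gamma> = {i \<in> {1..r}. groot Q a \<gamma> i \<in> PosRoots Q}"

definition Dset ::
  "('n::finite) pinned_group \<Rightarrow> nat \<Rightarrow> (nat \<Rightarrow> 'n character) \<Rightarrow> (nat \<Rightarrow> 'n cmat set) \<Rightarrow> nat set" where
  "Dset Q r a \<gamma> = {i \<in> {1..r}. groot_pre Q a \<gamma> i \<in> PosRoots Q}"

text \<open>The representative in \<open>G\<close> of the entry \<open>\<gamma>\<^sub>i \<in> {s\<^sub>i, id}\<close>.\<close>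

definition grep ::
  "('n::finite) pinned_group \<Rightarrow> (nat \<Rightarrow> 'n character) \<Rightarrow> (nat \<Rightarrow> 'n cmat set) \<Rightarrow> nat \<Rightarrow> 'n cmat" where
  "grep Q a \<gamma> i = (if \<gamma> i = \<one>\<^bsub>Weyl Q\<^esub> then mat 1 else nrep Q (a i))"

definition cell_point ::
  "('n::finite) pinned_group \<Rightarrow> nat \<Rightarrow> (nat \<Rightarrow> 'n character) \<Rightarrow> (nat \<Rightarrow> 'n cmat set) \<Rightarrow>
   (nat \<Rightarrow> complex) \<Rightarrow> (nat \<Rightarrow> 'n cmat) set" where
  "cell_point Q r a \<gamma> x = bs_class Q r (\<lambda>i\<in>{1..r}. rhom Q (galpha Q a \<gamma> i) (x i) ** grep Q a \<gamma> i)"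

definition cell ::
  "('n::finite) pinned_group \<Rightarrow> nat \<Rightarrow> (nat \<Rightarrow> 'n character) \<Rightarrow> (nat \<Rightarrow> 'n cmat set) \<Rightarrow>
   (nat \<Rightarrow> 'n cmat) set set" where
  "cell Q r a \<gamma> = cell_point Q r a \<gamma> ` coord_space (Jset Q r a \<gamma>)"

text \<open>The sign \<open>e\<close> is the one determined by the pinning at position \<open>i\<close> of the gallery:
  conjugating \<open>p(x)\<close>, for the root \<open>\<gamma>\<^sub>i(-\<alpha>\<^sub>i)\<close>, by the representative of \<open>\<gamma>\<^sub>1\<cdots>\<gamma>\<^sub>i\<^sub>-\<^sub>1\<close> gives
  \<open>p(e x)\<close> for the root \<open>\<beta>\<^sub>i\<close>.\<close>

definition pinning_sign ::
  "('n::finite) pinned_group \<Rightarrow> (nat \<Rightarrow> 'n character) \<Rightarrow> (nat \<Rightarrow> 'n cmat set) \<Rightarrow> nat \<Rightarrow> complex \<Rightarrow> bool" where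
  "pinning_sign Q a \<gamma> i e \<longleftrightarrow> e \<in> {1, -1} \<and>
     (let g = seq_prod (GG Q) (grep Q a \<gamma>) (i - 1)
      in \<forall>x. g ** rhom Q (galpha Q a \<gamma> i) x ** matrix_inv g = rhom Q (groot Q a \<gamma> i) (e * x))"

end

theory Submission
  imports
    Defs
    "HOL-Algebra.Zassenhaus"
    "HOL-Computational_Algebra.Fundamental_Theorem_Algebra"
begin

text \<open>
  Moving the representatives of the gallery to the right writes the product of the entries of a
  point of the cell as \<open>V n\<close>, where \<open>V\<close> is the ordered product of the elements
  \<open>p\<^sub>\<beta>\<^sub>i(\<plusminus>x\<^sub>i)\<close> with \<open>\<beta>\<^sub>i > 0\<close> and \<open>n\<close> represents \<open>y\<close>; the point lies in the
  fibre if and only if \<open>V \<in> n B n\<^sup>-\<^sup>1\<close>. Conjugation by the torus grades the matrix algebra by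
  the root lattice. The component of \<open>V\<close> of degree \<open>\<alpha>\<close> is \<open>\<Sum> \<plusminus>x\<^sub>i E\<^sub>\<alpha>\<close>, over the
  \<open>i\<close> with \<open>\<beta>\<^sub>i = \<alpha>\<close>, plus terms of degree at least two in variables of smaller height, and
  \<open>X\<^sub>\<alpha>\<close> is obtained from it by a linear form that is \<open>1\<close> on \<open>E\<^sub>\<alpha>\<close>. If
  \<open>V \<in> n B n\<^sup>-\<^sup>1\<close>, then the components of degree \<open>\<alpha> \<in> y(R\<^sup>-)\<close> vanish for reasons of degree.
  For the converse, the terms of lowest height of a unipotent element of \<open>G\<close> lie in the Lie algebra,
  hence are combinations of root vectors; so \<open>V\<close> can be corrected, height by height, by
  elements of \<open>n B n\<^sup>-\<^sup>1\<close> until it becomes trivial. The equations are triangular with respect to the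
  height because a gallery from \<open>1\<close> to \<open>y\<close> crosses every wall in \<open>R\<^sup>+ \<inter> y(R\<^sup>-)\<close>.

  The symmetry and reducedness of the roots and the exchange condition in the Weyl group are
  derived from the pinning: \<open>n\<^sub>c = p\<^sub>c(1) p\<^sub>-\<^sub>c(-1) p\<^sub>c(1)\<close> normalises the torus, and
  comparing components in \<open>Ad(p\<^sub>-\<^sub>c(-1)) X = Ad(p\<^sub>c(-1)) Ad(n\<^sub>c) X\<close> replaces the structure theory of
  semisimple groups.
\<close>

section \<open>Polynomial functions\<close>

text \<open>The definitions presuppose no structure theory: roots are characters with a nonzero
  weight space, \<open>B\<close> and the parabolics are generated subgroups, and the pinning gives
  only root homomorphisms, reflections and conjugation up to sign. Membership in \<open>B\<close> is
  therefore proved only by exhibiting products of generators, and excluded only by degrees. Adjoint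
  type makes the degrees usable: the weights of the coordinate representation of \<open>G\<close>
  lie in the root lattice, so every matrix entry has a height, and large heights do not occur. The
  passage from a unipotent \<open>g\<close> to the Lie algebra uses a curve interpolating the powers
  of \<open>g\<close>; one knows only that polynomials vanishing on \<open>G\<close> vanish along
  it, which is enough for its tangent vector. The number of free variables comes from counting along
  the gallery: #J - #D is the number of inversions of y, and the exchange condition identifies this
  number with the length, which is defined by words.\<close>

definition mon_eval :: "('v \<Rightarrow>\<^sub>0 nat) \<Rightarrow> ('v \<Rightarrow> complex) \<Rightarrow> complex" where
  "mon_eval m v = (\<Prod>i\<in>Poly_Mapping.keys m. v i ^ Poly_Mapping.lookup m i)"

lemma mon_eval_superset:
  assumes "finite I" "Poly_Mapping.keys m \<subseteq> I"
  shows "mon_eval m v = (\<Prod>i\<in>I. v i ^ Poly_Mapping.lookup m i)"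
  unfolding mon_eval_def
  by (rule prod.mono_neutral_left) (use assms in \<open>auto simp: not_in_keys_iff_lookup_eq_zero\<close>)

lemma mon_eval_0 [simp]: "mon_eval 0 v = 1"
  by (simp add: mon_eval_def)

lemma mon_eval_add: "mon_eval (m + n) v = mon_eval m v * mon_eval n v"
proof -
  let ?I = "Poly_Mapping.keys m \<union> Poly_Mapping.keys n"
  have "mon_eval (m + n) v = (\<Prod>i\<in>?I. v i ^ Poly_Mapping.lookup (m + n) i)"
    by (rule mon_eval_superset) (auto simp: in_keys_iff lookup_add)
  also have "\<dots> = (\<Prod>i\<in>?I. v i ^ Poly_Mapping.lookup m i) * (\<Prod>i\<in>?I. v i ^ Poly_Mapping.lookup n i)"
    by (simp add: lookup_add power_add prod.distrib)
  also have "\<dots> = mon_eval m v * mon_eval n v"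
    by (simp add: mon_eval_superset[of ?I])
  finally show ?thesis .
qed

lemma peval_superset:
  assumes "finite M" "Poly_Mapping.keys f \<subseteq> M"
  shows "peval f v = (\<Sum>m\<in>M. Poly_Mapping.lookup f m * mon_eval m v)"
  unfolding peval_def mon_eval_def[symmetric]
  by (rule sum.mono_neutral_left) (use assms in \<open>auto simp: not_in_keys_iff_lookup_eq_zero\<close>)

lemma peval_0 [simp]: "peval 0 v = 0"
  by (simp add: peval_def)

lemma peval_single [simp]: "peval (Poly_Mapping.single m c) v = c * mon_eval m v"
  by (subst peval_superset[of "{m}"]) auto

lemma peval_add [simp]: "peval (f + g) v = peval f v + peval g v"
proof -
  let ?M = "Poly_Mapping.keys f \<union> Poly_Mapping.keys g"
  have "peval (f + g) v = (\<Sum>m\<in>?M. Poly_Mapping.lookup (f + g) m * mon_eval m v)"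
    by (rule peval_superset) (auto simp: in_keys_iff lookup_add)
  also have "\<dots> = peval f v + peval g v"
    by (simp add: lookup_add distrib_right sum.distrib peval_superset[of ?M])
  finally show ?thesis .
qed

lemma peval_sum [simp]: "peval (sum f A) v = (\<Sum>i\<in>A. peval (f i) v)"
  by (induction A rule: infinite_finite_induct) auto

lemma poly_mapping_eq_sum_single:
  "f = (\<Sum>m\<in>Poly_Mapping.keys f. Poly_Mapping.single m (Poly_Mapping.lookup f m))"
  by (rule poly_mapping_eqI) (simp add: lookup_sum lookup_single when_def sum.delta' in_keys_iff)

lemma peval_mult [simp]: "peval (f * g) v = peval f v * peval g v"
proof -
  have single: "peval (Poly_Mapping.single m c * g) v = c * mon_eval m v * peval g v" for m c
    by (subst (1 2) poly_mapping_eq_sum_single[of g], unfold sum_distrib_left)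
      (simp add: mult_single mon_eval_add sum_distrib_left mult_ac)
  have "peval (f * g) v = (\<Sum>m\<in>Poly_Mapping.keys f. peval (Poly_Mapping.single m (Poly_Mapping.lookup f m) * g) v)"
    by (subst poly_mapping_eq_sum_single[of f], unfold sum_distrib_right) simp
  also have "\<dots> = (\<Sum>m\<in>Poly_Mapping.keys f. Poly_Mapping.lookup f m * mon_eval m v) * peval g v"
    by (simp only: single sum_distrib_right)
  also have "\<dots> = peval f v * peval g v"
    by (subst peval_superset[of "Poly_Mapping.keys f" f]) auto
  finally show ?thesis .
qed

lemma peval_pconst [simp]: "peval (pconst c) v = c"
  by (simp add: pconst_def)

lemma peval_1 [simp]: "peval 1 v = 1"
  using peval_pconst[of 1 v] by (simp add: pconst_def)

lemma peval_pvar [simp]: "peval (pvar i) v = v i"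
  by (simp add: pvar_def mon_eval_def)

lemma peval_power [simp]: "peval (f ^ k) v = peval f v ^ k"
  by (induction k) auto

lemma peval_prod [simp]: "peval (prod f A) v = (\<Prod>i\<in>A. peval (f i) v)"
  by (induction A rule: infinite_finite_induct) auto

lemma peval_cong:
  assumes "\<And>i. i \<in> pvars f \<Longrightarrow> v i = v' i"
  shows "peval f v = peval f v'"
  unfolding peval_def
proof (rule sum.cong[OF refl], rule arg_cong[where f = "\<lambda>z. _ * z"], rule prod.cong[OF refl])
  fix m i assume "m \<in> Poly_Mapping.keys f" "i \<in> Poly_Mapping.keys m"
  then have "i \<in> pvars f" by (auto simp: pvars_def)
  then show "v i ^ Poly_Mapping.lookup m i = v' i ^ Poly_Mapping.lookup m i"
    using assms by simp
qed

lemma pvars_0 [simp]: "pvars 0 = {}"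
  by (simp add: pvars_def)

lemma pvars_pconst [simp]: "pvars (pconst c) = {}"
  by (auto simp: pvars_def pconst_def)

lemma pvars_1 [simp]: "pvars 1 = {}"
  by (auto simp: pvars_def)

lemma pvars_pvar [simp]: "pvars (pvar i) = {i}"
  by (auto simp: pvars_def pvar_def)

lemma pvars_add: "pvars (f + g) \<subseteq> pvars f \<union> pvars g"
  using keys_add[of f g] by (auto simp: pvars_def)

lemma pvars_sum: "pvars (sum f A) \<subseteq> (\<Union>i\<in>A. pvars (f i))"
proof (induction A rule: infinite_finite_induct)
  case (insert x A)
  then show ?case
    using pvars_add[of "f x" "sum f A"] by auto
qed auto

lemma pvars_mult: "pvars (f * g) \<subseteq> pvars f \<union> pvars g"
proof
  fix i assume "i \<in> pvars (f * g)"
  then obtain m where m: "m \<in> Poly_Mapping.keys (f * g)" "i \<in> Poly_Mapping.keys m"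
    by (auto simp: pvars_def)
  then obtain m1 m2 where "m = m1 + m2" "m1 \<in> Poly_Mapping.keys f" "m2 \<in> Poly_Mapping.keys g"
    using keys_mult[of f g] by auto
  then show "i \<in> pvars f \<union> pvars g"
    using m keys_add[of m1 m2] by (auto simp: pvars_def)
qed

lemma pvars_power: "pvars (f ^ k) \<subseteq> pvars f"
proof (induction k)
  case (Suc k)
  then show ?case
    using pvars_mult[of f "f ^ k"] by auto
qed auto

lemma pvars_prod: "pvars (prod f A) \<subseteq> (\<Union>i\<in>A. pvars (f i))"
proof (induction A rule: infinite_finite_induct)
  case (insert x A)
  then show ?case
    using pvars_mult[of "f x" "prod f A"] by auto
qed auto

definition psubst :: "'v cpoly \<Rightarrow> ('v \<Rightarrow> 'u cpoly) \<Rightarrow> 'u cpoly" where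
  "psubst f F = (\<Sum>m\<in>Poly_Mapping.keys f. pconst (Poly_Mapping.lookup f m) *
                  (\<Prod>i\<in>Poly_Mapping.keys m. F i ^ Poly_Mapping.lookup m i))"

lemma peval_psubst: "peval (psubst f F) v = peval f (\<lambda>i. peval (F i) v)"
  unfolding psubst_def by (simp add: peval_superset[OF finite_keys subset_refl, of f] mon_eval_def)

lemma pvars_psubst: "pvars (psubst f F) \<subseteq> (\<Union>i\<in>pvars f. pvars (F i))"
proof -
  have "pvars (pconst (Poly_Mapping.lookup f m) * (\<Prod>i\<in>Poly_Mapping.keys m. F i ^ Poly_Mapping.lookup m i))
      \<subseteq> (\<Union>i\<in>pvars f. pvars (F i))" (is "pvars (_ * ?p) \<subseteq> _") if "m \<in> Poly_Mapping.keys f" for m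
  proof -
    have "pvars ?p \<subseteq> (\<Union>i\<in>Poly_Mapping.keys m. pvars (F i ^ Poly_Mapping.lookup m i))"
      by (rule pvars_prod)
    also have "\<dots> \<subseteq> (\<Union>i\<in>pvars f. pvars (F i))"
    proof (rule UN_mono[OF _ pvars_power])
      show "Poly_Mapping.keys m \<subseteq> pvars f"
        using that by (auto simp: pvars_def)
    qed
    finally show ?thesis
      using pvars_mult[of "pconst (Poly_Mapping.lookup f m)" ?p] by simp
  qed
  then have "(\<Union>m\<in>Poly_Mapping.keys f. pvars (pconst (Poly_Mapping.lookup f m) *
      (\<Prod>i\<in>Poly_Mapping.keys m. F i ^ Poly_Mapping.lookup m i))) \<subseteq> (\<Union>i\<in>pvars f. pvars (F i))"
    by (rule UN_least)
  then show ?thesis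
    unfolding psubst_def by (rule subset_trans[OF pvars_sum])
qed

text \<open>\<open>D\<close> is chosen before the curve \<open>p\<close>: the derivative at a point
  depends only on the velocity \<open>b\<close>, and linearly. This uniformity lets tangent spaces
  be described by linear equations.\<close>

lemma peval_directional_derivative:
  fixes f :: "('v::finite) cpoly"
  obtains D where
    "\<And>p b. (\<And>i. ((\<lambda>z. p z i) has_field_derivative b i) (at 0)) \<Longrightarrow> p 0 = a \<Longrightarrow>
        ((\<lambda>z. peval f (p z)) has_field_derivative (\<Sum>i\<in>UNIV. D i * b i)) (at 0)"
proof -
  define D where "D i = (\<Sum>m\<in>Poly_Mapping.keys f. Poly_Mapping.lookup f m *
      (of_nat (Poly_Mapping.lookup m i) * a i ^ (Poly_Mapping.lookup m i - 1) *
       (\<Prod>j\<in>UNIV - {i}. a j ^ Poly_Mapping.lookup m j)))" for i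
  show thesis
  proof (rule that[of D])
    fix p :: "complex \<Rightarrow> 'v \<Rightarrow> complex" and b :: "'v \<Rightarrow> complex"
    assume d: "\<And>i. ((\<lambda>z. p z i) has_field_derivative b i) (at 0)" and p0: "p 0 = a"
    have pe: "(\<lambda>z. peval f (p z)) = (\<lambda>z. \<Sum>m\<in>Poly_Mapping.keys f. Poly_Mapping.lookup f m * (\<Prod>i\<in>UNIV. p z i ^ Poly_Mapping.lookup m i))"
      by (simp add: peval_superset[OF finite_keys subset_refl] mon_eval_superset[of UNIV])
    have "((\<lambda>z. peval f (p z)) has_field_derivative
        (\<Sum>m\<in>Poly_Mapping.keys f. Poly_Mapping.lookup f m *
          (\<Sum>i\<in>UNIV. (of_nat (Poly_Mapping.lookup m i) * p 0 i ^ (Poly_Mapping.lookup m i - 1) * b i) *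
             (\<Prod>j\<in>UNIV - {i}. p 0 j ^ Poly_Mapping.lookup m j)))) (at 0)"
      unfolding pe
      by (intro DERIV_sum DERIV_cmult has_field_derivative_prod)
         (auto intro!: derivative_eq_intros d)
    also have "(\<Sum>m\<in>Poly_Mapping.keys f. Poly_Mapping.lookup f m *
          (\<Sum>i\<in>UNIV. (of_nat (Poly_Mapping.lookup m i) * p 0 i ^ (Poly_Mapping.lookup m i - 1) * b i) *
             (\<Prod>j\<in>UNIV - {i}. p 0 j ^ Poly_Mapping.lookup m j))) = (\<Sum>i\<in>UNIV. D i * b i)"
      unfolding D_def sum_distrib_right sum_distrib_left p0
      by (subst sum.swap) (simp add: mult_ac)
    finally show "((\<lambda>z. peval f (p z)) has_field_derivative (\<Sum>i\<in>UNIV. D i * b i)) (at 0)" .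
  qed
qed

subsection \<open>Triangular systems of polynomial equations\<close>

text \<open>Induction on a bound for the level \<open>h\<close>: the equation of
  \<open>\<alpha>\<close> is solved for its pivot \<open>x (idx \<alpha>)\<close>, and in its
  remainder the pivots of lower level are replaced by the polynomials in \<open>K\<close> already
  found.\<close>

lemma triangular_system_solvable:
  fixes h :: "'a \<Rightarrow> nat" and idx :: "'a \<Rightarrow> nat" and X R :: "'a \<Rightarrow> nat cpoly" and e :: "'a \<Rightarrow> complex"
  assumes X: "\<And>\<alpha>. \<alpha> \<in> A \<Longrightarrow> X \<alpha> = pconst (e \<alpha>) * pvar (idx \<alpha>) + R \<alpha>"
    and e: "\<And>\<alpha>. \<alpha> \<in> A \<Longrightarrow> e \<alpha> \<noteq> 0"
    and R: "\<And>\<alpha>. \<alpha> \<in> A \<Longrightarrow> pvars (R \<alpha>) \<subseteq> K \<union> idx ` {\<alpha>' \<in> A. h \<alpha>' < h \<alpha>}"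
    and inj: "inj_on idx A"
  shows "\<exists>F. (\<forall>\<alpha>\<in>A. h \<alpha> < n \<longrightarrow> pvars (F \<alpha> :: nat cpoly) \<subseteq> K) \<and>
      (\<forall>x. (\<forall>\<alpha>\<in>A. h \<alpha> < n \<longrightarrow> peval (X \<alpha>) x = 0) \<longleftrightarrow>
           (\<forall>\<alpha>\<in>A. h \<alpha> < n \<longrightarrow> x (idx \<alpha>) = peval (F \<alpha>) x))"
proof (induction n)
  case (Suc n)
  then obtain F :: "'a \<Rightarrow> nat cpoly" where F: "\<And>\<alpha>. \<alpha> \<in> A \<Longrightarrow> h \<alpha> < n \<Longrightarrow> pvars (F \<alpha>) \<subseteq> K"
    "\<And>x. (\<forall>\<alpha>\<in>A. h \<alpha> < n \<longrightarrow> peval (X \<alpha>) x = 0) \<longleftrightarrow> (\<forall>\<alpha>\<in>A. h \<alpha> < n \<longrightarrow> x (idx \<alpha>) = peval (F \<alpha>) x)"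
    by blast
  \<comment> \<open>Pivots of level below \<open>n\<close> are replaced by their solutions; all
    other variables stay. Injectivity of \<open>idx\<close> on \<open>A\<close> makes the inverse
    meaningful.\<close>
  define L where "L j = (if j \<in> idx ` {\<alpha> \<in> A. h \<alpha> < n} then F (the_inv_into A idx j) else pvar j)" for j
  define F' where "F' \<alpha> = (if h \<alpha> < n then F \<alpha> else psubst (pconst (- 1 / e \<alpha>) * R \<alpha>) L)" for \<alpha>
  have L: "L (idx \<alpha>) = F \<alpha>" if "\<alpha> \<in> A" "h \<alpha> < n" for \<alpha>
    using that by (auto simp: L_def the_inv_into_f_f inj)
  have "pvars (F' \<alpha>) \<subseteq> K" if a: "\<alpha> \<in> A" "h \<alpha> < Suc n" for \<alpha>
  proof (cases "h \<alpha> < n")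
    case True
    then show ?thesis using F a by (simp add: F'_def)
  next
    case False
    have "pvars (L j) \<subseteq> K" if "j \<in> pvars (pconst (- 1 / e \<alpha>) * R \<alpha>)" for j
    proof -
      have "j \<in> K \<union> idx ` {\<alpha>' \<in> A. h \<alpha>' < h \<alpha>}"
        using that R[OF a(1)] pvars_mult[of "pconst (- 1 / e \<alpha>)" "R \<alpha>"] by auto
      then show ?thesis
      proof (cases "j \<in> idx ` {\<alpha> \<in> A. h \<alpha> < n}")
        case True
        then obtain \<alpha>' where "\<alpha>' \<in> A" "h \<alpha>' < n" "j = idx \<alpha>'" by blast
        then show ?thesis using L[of \<alpha>'] F(1)[of \<alpha>'] by simp
      next
        case False
        then have "j \<in> K" using \<open>j \<in> K \<union> _\<close> a by auto
        then show ?thesis using False by (simp add: L_def)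
      qed
    qed
    then have "(\<Union>j\<in>pvars (pconst (- 1 / e \<alpha>) * R \<alpha>). pvars (L j)) \<subseteq> K" by (rule UN_least)
    then have "pvars (psubst (pconst (- 1 / e \<alpha>) * R \<alpha>) L) \<subseteq> K"
      by (rule subset_trans[OF pvars_psubst])
    then show ?thesis using False by (simp only: F'_def if_False)
  qed
  moreover have "(\<forall>\<alpha>\<in>A. h \<alpha> < Suc n \<longrightarrow> peval (X \<alpha>) x = 0) \<longleftrightarrow>
      (\<forall>\<alpha>\<in>A. h \<alpha> < Suc n \<longrightarrow> x (idx \<alpha>) = peval (F' \<alpha>) x)" for x
  proof -
    have step: "peval (X \<alpha>) x = 0 \<longleftrightarrow> x (idx \<alpha>) = peval (F' \<alpha>) x"
      if low: "\<forall>\<alpha>\<in>A. h \<alpha> < n \<longrightarrow> x (idx \<alpha>) = peval (F \<alpha>) x" and a: "\<alpha> \<in> A" "h \<alpha> = n" for \<alpha>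
    proof -
      have "peval (R \<alpha>) (\<lambda>j. peval (L j) x) = peval (R \<alpha>) x"
      proof (rule peval_cong)
        fix j assume "j \<in> pvars (R \<alpha>)"
        show "peval (L j) x = x j"
        proof (cases "j \<in> idx ` {\<alpha> \<in> A. h \<alpha> < n}")
          case True
          then show ?thesis using L low by force
        next
          case False
          then show ?thesis by (simp add: L_def)
        qed
      qed
      then have "peval (F' \<alpha>) x = - (peval (R \<alpha>) x / e \<alpha>)"
        using a by (simp add: F'_def peval_psubst)
      moreover have "peval (X \<alpha>) x = 0 \<longleftrightarrow> x (idx \<alpha>) = - (peval (R \<alpha>) x / e \<alpha>)"
      proof -
        have "peval (X \<alpha>) x = e \<alpha> * (x (idx \<alpha>) + peval (R \<alpha>) x / e \<alpha>)"
          using e[OF a(1)] by (simp add: X[OF a(1)] distrib_left)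
        then show ?thesis using e[OF a(1)] by (simp add: eq_neg_iff_add_eq_0)
      qed
      ultimately show ?thesis by simp
    qed
    have split: "(\<forall>\<alpha>\<in>A. h \<alpha> < Suc n \<longrightarrow> P \<alpha>) \<longleftrightarrow> (\<forall>\<alpha>\<in>A. h \<alpha> < n \<longrightarrow> P \<alpha>) \<and> (\<forall>\<alpha>\<in>A. h \<alpha> = n \<longrightarrow> P \<alpha>)" for P
      by (auto simp: less_Suc_eq)
    have low: "(\<forall>\<alpha>\<in>A. h \<alpha> < n \<longrightarrow> x (idx \<alpha>) = peval (F' \<alpha>) x) \<longleftrightarrow> (\<forall>\<alpha>\<in>A. h \<alpha> < n \<longrightarrow> x (idx \<alpha>) = peval (F \<alpha>) x)"
      by (simp add: F'_def)
    show ?thesis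
      unfolding split low F(2)[of x] using step by blast
  qed
  ultimately show ?case by blast
qed auto

text \<open>The coordinates in \<open>K\<close>, renumbered by a bijection with
  \<open>{1..card K}\<close>, parametrise the graph; the inverse map forgets the remaining
  coordinates, which \<open>F\<close> restores.\<close>

lemma affine_cell_graph:
  fixes F :: "nat \<Rightarrow> nat cpoly"
  assumes J: "finite J" and K: "K \<subseteq> J" and F: "\<And>i. i \<in> J - K \<Longrightarrow> pvars (F i) \<subseteq> K"
  shows "affine_cell J {x \<in> coord_space J. \<forall>i\<in>J - K. x i = peval (F i) x} (card K)"
proof -
  let ?d = "card K"
  let ?Z = "{x \<in> coord_space J. \<forall>i\<in>J - K. x i = peval (F i) x}"
  obtain b where b: "bij_betw b {1..?d} K"
    using J K finite_same_card_bij[of "{1..?d}" K] by (auto intro: finite_subset)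
  define b' where "b' = the_inv_into {1..?d} b"
  have b'b: "b' (b i) = i" if "i \<in> {1..?d}" for i
    using that b by (auto simp: b'_def bij_betw_def the_inv_into_f_f)
  have bb': "b (b' k) = k" "b' k \<in> {1..?d}" if "k \<in> K" for k
    using that b f_the_inv_into_f_bij_betw[OF b] the_inv_into_into[of b "{1..?d}" k "{1..?d}"]
    by (auto simp: b'_def bij_betw_def)
  define f where "f j = (if j \<in> K then pvar (b' j) else psubst (F j) (\<lambda>k. pvar (b' k)))" for j
  define g where "g i = (pvar (b i) :: nat cpoly)" for i
  have f1: "poly_map J f t k = t (b' k)" if "k \<in> K" for t k
    using that K by (auto simp: poly_map_def f_def)
  have f2: "poly_map J f t i = peval (F i) (\<lambda>k. t (b' k))" if "i \<in> J - K" for t i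
    using that by (auto simp: poly_map_def f_def peval_psubst)
  have "poly_map J f t \<in> ?Z" for t
  proof -
    have "peval (F i) (poly_map J f t) = peval (F i) (\<lambda>k. t (b' k))" if "i \<in> J - K" for i
      using F[OF that] f1 by (intro peval_cong) auto
    then show ?thesis by (auto simp: coord_space_def f2) (simp add: poly_map_def)
  qed
  moreover have "poly_map {1..?d} g (poly_map J f t) = t" if t: "t \<in> coord_space {1..?d}" for t
  proof
    fix i
    show "poly_map {1..?d} g (poly_map J f t) i = t i"
    proof (cases "i \<in> {1..?d}")
      case True
      then have "b i \<in> K" using b by (auto simp: bij_betw_def)
      then have "poly_map J f t (b i) = t i" using f1 b'b[OF True] by simp
      then show ?thesis unfolding poly_map_def[of "{1..?d}"] g_def using True by simp
    next
      case False
      then show ?thesis unfolding poly_map_def[of "{1..?d}"] using t by (auto simp: coord_space_def)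
    qed
  qed
  moreover have "poly_map J f (poly_map {1..?d} g z) = z" if z: "z \<in> ?Z" for z
  proof
    fix i
    have gz: "poly_map {1..?d} g z (b' k) = z k" if "k \<in> K" for k
      using bb'[OF that] by (simp add: poly_map_def g_def)
    consider "i \<in> K" | "i \<in> J - K" | "i \<notin> J" using K by blast
    then show "poly_map J f (poly_map {1..?d} g z) i = z i"
    proof cases
      case 1
      then show ?thesis by (simp only: f1 gz)
    next
      case 2
      have "peval (F i) (\<lambda>k. poly_map {1..?d} g z (b' k)) = peval (F i) z"
        using F[OF 2] gz by (intro peval_cong) auto
      then show ?thesis unfolding f2[OF 2] using 2 z by simp
    next
      case 3
      then show ?thesis using z by (simp add: poly_map_def coord_space_def)
    qed
  qed
  ultimately show ?thesis
    unfolding affine_cell_def by blast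
qed

section \<open>Matrices\<close>

lemma mat_mult_nth [simp]: "(mat z ** X) $ i $ j = z * (X $ i $ j :: 'a::comm_semiring_1)"
proof -
  have "(mat z ** X) $ i $ j = (\<Sum>k\<in>UNIV. (if i = k then z * X $ k $ j else 0))"
    unfolding matrix_matrix_mult_def mat_def by (simp add: if_distrib[of "\<lambda>x. x * _"] cong: if_cong)
  then show ?thesis by simp
qed

lemma mult_mat_nth [simp]: "(X ** mat z) $ i $ j = z * (X $ i $ j :: 'a::comm_semiring_1)"
proof -
  have "(X ** mat z) $ i $ j = (\<Sum>k\<in>UNIV. (if k = j then X $ i $ k * z else 0))"
    unfolding matrix_matrix_mult_def mat_def by (simp add: if_distrib[of "\<lambda>x. _ * x"] cong: if_cong)
  then show ?thesis by (simp add: mult.commute)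
qed

lemma mat_mult_commute: "X ** mat z = mat z ** (X :: 'a::comm_semiring_1 ^ 'n ^ 'n)"
  by (simp add: vec_eq_iff)

lemma mult_mat_left: "(X :: 'a::comm_semiring_1 ^ 'n ^ 'n) ** (mat z ** Y) = mat z ** (X ** (Y :: 'a ^ 'n ^ 'n))"
  by (simp add: matrix_mul_assoc mat_mult_commute)

lemma mat_mult_mat: "mat a ** (mat b ** X) = mat (a * b) ** (X :: 'a::comm_semiring_1 ^ 'n ^ 'n)"
  by (simp add: vec_eq_iff mult.assoc)

lemma mat_add_mult: "mat (a + b) ** X = mat a ** X + mat b ** (X :: 'a::comm_semiring_1 ^ 'n ^ 'n)"
  by (simp add: vec_eq_iff distrib_right)

lemma matrix_mult_zero [simp]: "X ** 0 = (0 :: 'a::semiring_1 ^ 'n ^ 'm)" "0 ** Y = (0 :: 'a::semiring_1 ^ 'n ^ 'm)"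
  by (simp_all add: vec_eq_iff matrix_matrix_mult_def)

lemma matrix_mult_add_right: "(A + B) ** C = A ** C + B ** (C :: 'a::semiring_1 ^ 'n ^ 'm)"
  by (simp add: vec_eq_iff matrix_matrix_mult_def distrib_right sum.distrib)

lemma matrix_mult_diff: "X ** (A - B) = X ** A - X ** (B :: 'a::ring_1 ^ 'n ^ 'm)"
    "(A' - B') ** Y = A' ** Y - B' ** (Y :: 'a::ring_1 ^ 'n ^ 'm)"
  by (simp_all add: vec_eq_iff matrix_matrix_mult_def right_diff_distrib left_diff_distrib sum_subtractf)

lemma matrix_mult_sum_right: "X ** (\<Sum>i\<in>I. f i) = (\<Sum>i\<in>I. X ** (f i :: 'a::semiring_1 ^ 'n ^ 'm))"
  by (induction I rule: infinite_finite_induct) (simp_all add: matrix_add_ldistrib)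

lemma matrix_mult_sum_left: "(\<Sum>i\<in>I. f i) ** X = (\<Sum>i\<in>I. f i ** (X :: 'a::semiring_1 ^ 'n ^ 'm))"
  by (induction I rule: infinite_finite_induct) (simp_all add: matrix_mult_add_right)

lemma matrix_inv_right: "invertible A \<Longrightarrow> A ** matrix_inv A = mat 1"
  and matrix_inv_left: "invertible A \<Longrightarrow> matrix_inv A ** A = mat 1"
  unfolding invertible_def matrix_inv_def by (metis (mono_tags, lifting) someI_ex)+

lemma matrix_inv_unique:
  fixes A :: "'a::field ^ 'n ^ 'n"
  assumes "A ** B = mat 1"
  shows "matrix_inv A = B"
proof -
  have "B ** A = mat 1" using assms matrix_left_right_inverse by blast
  then have "invertible A" using assms by (auto simp: invertible_def)
  then have "A ** matrix_inv A = mat 1" by (rule matrix_inv_right)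
  then show ?thesis
    by (metis \<open>B ** A = mat 1\<close> matrix_mul_assoc matrix_mul_lid matrix_mul_rid)
qed

lemma matrix_inv_one [simp]: "matrix_inv (mat 1) = (mat 1 :: 'a::field ^ 'n ^ 'n)"
  by (rule matrix_inv_unique) simp

lemma invertible_matrix_inv: "invertible A \<Longrightarrow> invertible (matrix_inv A)"
  using matrix_inv_left matrix_inv_right invertible_def by blast

lemma matrix_inv_matrix_inv: "invertible A \<Longrightarrow> matrix_inv (matrix_inv A) = (A :: 'a::field ^ 'n ^ 'n)"
  by (intro matrix_inv_unique matrix_inv_left)

lemma matrix_inv_cancel:
  assumes "invertible A"
  shows "A ** (matrix_inv A ** X) = X" "matrix_inv A ** (A ** X) = X"
    "Y ** A ** matrix_inv A = Y" "Y ** matrix_inv A ** A = Y"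
  using assms by (simp_all add: matrix_mul_assoc matrix_inv_left matrix_inv_right
      flip: matrix_mul_assoc[of Y])

lemma matrix_inv_mult:
  fixes A B :: "'a::field ^ 'n ^ 'n"
  assumes "invertible A" "invertible B"
  shows "matrix_inv (A ** B) = matrix_inv B ** matrix_inv A"
proof (rule matrix_inv_unique)
  have "A ** B ** (matrix_inv B ** matrix_inv A) = A ** (B ** (matrix_inv B ** matrix_inv A))"
    by (simp add: matrix_mul_assoc)
  then show "A ** B ** (matrix_inv B ** matrix_inv A) = mat 1"
    by (simp add: assms matrix_inv_cancel matrix_inv_right)
qed

section \<open>Conjugation of matrices\<close>

definition conj_by :: "'a::field ^ 'n ^ 'n \<Rightarrow> 'a ^ 'n ^ 'n \<Rightarrow> 'a ^ 'n ^ 'n" where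
  "conj_by g X = g ** X ** matrix_inv g"

lemma conj_by_one [simp]: "conj_by (mat 1) X = X"
  by (simp add: conj_by_def)

lemma conj_by_mat1 [simp]: "invertible g \<Longrightarrow> conj_by g (mat 1) = mat 1"
  by (simp add: conj_by_def matrix_inv_right)

lemma conj_by_mult:
  assumes "invertible g"
  shows "conj_by g (X ** Y) = conj_by g X ** conj_by g Y"
  using assms by (simp add: conj_by_def matrix_mul_assoc matrix_inv_cancel)

lemma conj_by_conj_by:
  assumes "invertible g" "invertible h"
  shows "conj_by g (conj_by h X) = conj_by (g ** h) X"
  using assms by (simp add: conj_by_def matrix_mul_assoc matrix_inv_mult)

lemma conj_by_inverse:
  assumes "invertible g"
  shows "conj_by g (conj_by (matrix_inv g) X) = X" "conj_by (matrix_inv g) (conj_by g X) = X"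
  using assms by (simp_all add: conj_by_conj_by invertible_matrix_inv matrix_inv_left matrix_inv_right)

lemma conj_by_add: "conj_by g (X + Y) = conj_by g X + conj_by g Y"
  by (simp add: conj_by_def matrix_add_ldistrib matrix_mult_add_right)

lemma conj_by_diff: "conj_by g (X - Y) = conj_by g X - conj_by g Y"
  by (simp add: conj_by_def matrix_mult_diff)

lemma conj_by_scale: "conj_by g (mat z ** X) = mat z ** conj_by g X"
  by (simp add: conj_by_def mult_mat_left matrix_mul_assoc[symmetric])

lemma conj_by_zero [simp]: "conj_by g 0 = 0"
  by (simp add: conj_by_def)

lemma conj_by_sum: "conj_by g (\<Sum>i\<in>I. f i) = (\<Sum>i\<in>I. conj_by g (f i))"
  by (simp add: conj_by_def matrix_mult_sum_left matrix_mult_sum_right)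

lemma conj_by_matrix_inv:
  assumes "invertible g" "invertible X"
  shows "conj_by g (matrix_inv X) = matrix_inv (conj_by g X)"
  by (rule sym, rule matrix_inv_unique)
    (use assms in \<open>simp add: conj_by_mult[symmetric] matrix_inv_right\<close>)

section \<open>Gradings of matrix algebras\<close>

text \<open>The entry \<open>(i, j)\<close> of a matrix, written in the basis given by the columns of \<open>P\<close>, has
  degree \<open>w i - w j\<close>.\<close>

locale graded_matrices =
  fixes P :: "('n::finite) cmat" and w :: "'n \<Rightarrow> 'w::ab_group_add"
  assumes invertible_P: "invertible P"
begin

definition ent :: "'n cmat \<Rightarrow> 'n \<Rightarrow> 'n \<Rightarrow> complex" where
  "ent M i j = (matrix_inv P ** M ** P) $ i $ j"

definition deg_in :: "'w set \<Rightarrow> 'n cmat \<Rightarrow> bool" where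
  "deg_in S M \<longleftrightarrow> (\<forall>i j. ent M i j \<noteq> 0 \<longrightarrow> w i - w j \<in> S)"

definition component :: "'w \<Rightarrow> 'n cmat \<Rightarrow> 'n cmat" where
  "component c M = P ** (\<chi> i j. if w i - w j = c then ent M i j else 0) ** matrix_inv P"

definition degrees :: "'w set" where
  "degrees = (\<lambda>(i, j). w i - w j) ` UNIV"

lemma finite_degrees: "finite degrees"
  by (simp add: degrees_def)

lemma ent_mat [simp]: "ent (P ** M ** matrix_inv P) i j = M $ i $ j"
  by (simp add: ent_def matrix_mul_assoc matrix_inv_cancel matrix_inv_left invertible_P)

lemma ent_eqI:
  assumes "\<And>i j. ent M i j = ent N i j"
  shows "M = N"
proof -
  have "matrix_inv P ** M ** P = matrix_inv P ** N ** P"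
    using assms by (simp add: vec_eq_iff ent_def)
  then have "P ** (matrix_inv P ** M ** P) ** matrix_inv P = P ** (matrix_inv P ** N ** P) ** matrix_inv P"
    by simp
  then show ?thesis
    by (simp add: matrix_mul_assoc matrix_inv_cancel matrix_inv_right invertible_P)
qed

lemma ent_zero [simp]: "ent 0 i j = 0"
  by (simp add: ent_def)

lemma ent_add [simp]: "ent (M + N) i j = ent M i j + ent N i j"
  by (simp add: ent_def matrix_add_ldistrib matrix_mult_add_right)

lemma ent_diff [simp]: "ent (M - N) i j = ent M i j - ent N i j"
  by (simp add: ent_def matrix_mult_diff)

lemma ent_scale [simp]: "ent (mat z ** M) i j = z * ent M i j"
proof -
  have "matrix_inv P ** (mat z ** M) ** P = mat z ** (matrix_inv P ** M ** P)"
    by (simp add: mult_mat_left matrix_mul_assoc[symmetric])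
  then show ?thesis by (simp add: ent_def)
qed

lemma ent_sum [simp]: "ent (\<Sum>k\<in>K. f k) i j = (\<Sum>k\<in>K. ent (f k) i j)"
  by (induction K rule: infinite_finite_induct) auto

lemma ent_mult: "ent (M ** N) i j = (\<Sum>k\<in>UNIV. ent M i k * ent N k j)"
proof -
  have "matrix_inv P ** (M ** N) ** P = (matrix_inv P ** M ** P) ** (matrix_inv P ** N ** P)"
    by (simp add: matrix_mul_assoc matrix_inv_cancel invertible_P)
  then show ?thesis
    unfolding ent_def by (simp add: matrix_matrix_mult_def)
qed

lemma ent_one: "ent (mat 1) i j = (if i = j then 1 else 0)"
proof -
  have "matrix_inv P ** mat 1 ** P = mat 1"
    by (simp add: matrix_inv_left invertible_P)
  then show ?thesis
    by (simp add: ent_def mat_def)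
qed

lemma ent_component: "ent (component c M) i j = (if w i - w j = c then ent M i j else 0)"
  by (simp add: component_def)

lemma deg_in_mono: "deg_in S M \<Longrightarrow> S \<subseteq> S' \<Longrightarrow> deg_in S' M"
  by (auto simp: deg_in_def)

lemma deg_in_zero [simp]: "deg_in S 0"
  by (simp add: deg_in_def)

lemma deg_in_one: "0 \<in> S \<Longrightarrow> deg_in S (mat 1)"
  by (simp add: deg_in_def ent_one)

lemma deg_in_add: "deg_in S M \<Longrightarrow> deg_in S N \<Longrightarrow> deg_in S (M + N)"
  unfolding deg_in_def by (metis add_0 ent_add)

lemma deg_in_scale: "deg_in S M \<Longrightarrow> deg_in S (mat z ** M)"
  by (auto simp: deg_in_def)

lemma deg_in_sum: "(\<And>i. i \<in> I \<Longrightarrow> deg_in S (f i)) \<Longrightarrow> deg_in S (\<Sum>i\<in>I. f i)"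
  by (induction I rule: infinite_finite_induct) (auto intro: deg_in_add)

text \<open>A nonzero entry \<open>(i, j)\<close> of the product needs some \<open>k\<close> at
  which both factors are nonzero, and \<open>w i - w k\<close> and \<open>w k - w j\<close> add up
  to \<open>w i - w j\<close>.\<close>

lemma deg_in_mult:
  assumes "deg_in S M" "deg_in S' N" "\<And>s s'. s \<in> S \<Longrightarrow> s' \<in> S' \<Longrightarrow> s + s' \<in> S''"
  shows "deg_in S'' (M ** N)"
  unfolding deg_in_def
proof (intro allI impI)
  fix i j assume "ent (M ** N) i j \<noteq> 0"
  then obtain k where "ent M i k \<noteq> 0" "ent N k j \<noteq> 0"
    unfolding ent_mult by (metis (no_types, lifting) mult_eq_0_iff sum.neutral)
  then have "w i - w k \<in> S" "w k - w j \<in> S'"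
    using assms by (auto simp: deg_in_def)
  then have "(w i - w k) + (w k - w j) \<in> S''"
    by (rule assms(3))
  then show "w i - w j \<in> S''" by simp
qed

lemma deg_in_component: "deg_in {c} (component c M)"
  by (auto simp: deg_in_def ent_component)

lemma component_deg_in:
  assumes "deg_in S M" "c \<notin> S"
  shows "component c M = 0"
  by (rule ent_eqI) (use assms in \<open>auto simp: deg_in_def ent_component\<close>)

lemma component_self: "deg_in {c} M \<Longrightarrow> component c M = M"
  by (rule ent_eqI) (auto simp: deg_in_def ent_component)

lemma component_other: "deg_in {c} M \<Longrightarrow> d \<noteq> c \<Longrightarrow> component d M = 0"
  by (rule component_deg_in) auto

lemma component_zero [simp]: "component c 0 = 0"
  by (rule ent_eqI) (simp add: ent_component)

lemma component_add: "component c (M + N) = component c M + component c N"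
  by (rule ent_eqI) (simp add: ent_component)

lemma component_diff: "component c (M - N) = component c M - component c N"
  by (rule ent_eqI) (simp add: ent_component)

lemma component_scale: "component c (mat z ** M) = mat z ** component c M"
  by (rule ent_eqI) (simp add: ent_component)

lemma component_sum: "component c (\<Sum>i\<in>I. f i) = (\<Sum>i\<in>I. component c (f i))"
  by (induction I rule: infinite_finite_induct) (simp_all add: component_add)

lemma component_one: "component c (mat 1) = (if c = 0 then mat 1 else 0)"
  by (rule ent_eqI) (simp add: ent_component ent_one)

lemma sum_components: "(\<Sum>c\<in>degrees. component c M) = M"
proof (rule ent_eqI)
  fix i j
  have "w i - w j \<in> degrees" by (auto simp: degrees_def)
  then show "ent (\<Sum>c\<in>degrees. component c M) i j = ent M i j"
    by (simp add: ent_component finite_degrees)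
qed

lemma component_eq_0_outside: "c \<notin> degrees \<Longrightarrow> component c M = 0"
  by (rule ent_eqI) (auto simp: ent_component degrees_def)

lemma deg_in_iff: "deg_in S M \<longleftrightarrow> (\<forall>c. c \<notin> S \<longrightarrow> component c M = 0)"
proof
  assume *: "\<forall>c. c \<notin> S \<longrightarrow> component c M = 0"
  show "deg_in S M"
    unfolding deg_in_def by (metis * ent_component ent_zero)
qed (auto intro: component_deg_in)

end

section \<open>Root combinatorics\<close>

text \<open>Despite the name this is not dominance of weights: it is membership in the cone of
  nonnegative combinations of simple roots, which for a root means positivity.\<close>

definition dominant :: "('s \<Rightarrow>\<^sub>0 int) \<Rightarrow> bool" where
  "dominant a \<longleftrightarrow> (\<forall>c. 0 \<le> Poly_Mapping.lookup a c)"

lemma dominant_frag_of [simp]: "dominant (frag_of c)"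
  by (simp add: dominant_def lookup_single when_def)

lemma dominant_zero [simp]: "dominant 0"
  by (simp add: dominant_def)

lemma dominant_add: "dominant a \<Longrightarrow> dominant b \<Longrightarrow> dominant (a + b)"
  by (simp add: dominant_def lookup_add)

lemma dominant_cmul: "0 \<le> k \<Longrightarrow> dominant a \<Longrightarrow> dominant (frag_cmul k a)"
  by (simp add: dominant_def)

lemma dominant_sum: "(\<And>i. i \<in> I \<Longrightarrow> dominant (f i)) \<Longrightarrow> dominant (\<Sum>i\<in>I. f i)"
  by (induction I rule: infinite_finite_induct) (auto intro: dominant_add)

lemma dominant_antisym: "dominant a \<Longrightarrow> dominant (- a) \<Longrightarrow> a = 0"
  by (rule poly_mapping_eqI) (simp add: dominant_def order_antisym)

section \<open>Additive maps on free abelian groups\<close>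

lemma additive_zero:
  fixes f :: "'x::ab_group_add \<Rightarrow> 'y::ab_group_add"
  assumes "\<And>a b. f (a + b) = f a + f b"
  shows "f 0 = 0"
  using assms[of 0 0] by simp

lemma additive_uminus:
  fixes f :: "'x::ab_group_add \<Rightarrow> 'y::ab_group_add"
  assumes "\<And>a b. f (a + b) = f a + f b"
  shows "f (- a) = - f a"
  using assms[of a "- a"] additive_zero[of f, OF assms] by (simp add: eq_neg_iff_add_eq_0 add.commute)

lemma additive_cmul:
  assumes add: "\<And>a b. f (a + b) = f a + f b"
  shows "f (frag_cmul k a) = frag_cmul k (f a)"
proof (cases k rule: int_cases2)
  case (nonneg n)
  have "f (frag_cmul (int n) a) = frag_cmul (int n) (f a)"
    by (induction n) (simp_all add: add additive_zero[of f, OF add] frag_cmul_distrib)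
  then show ?thesis using nonneg by simp
next
  case (nonpos n)
  have "f (frag_cmul (int n) a) = frag_cmul (int n) (f a)"
    by (induction n) (simp_all add: add additive_zero[of f, OF add] frag_cmul_distrib)
  then show ?thesis
    using nonpos additive_uminus[of f, OF add, of "frag_cmul (int n) a"] by simp
qed

lemma additive_sum:
  fixes f :: "'x::ab_group_add \<Rightarrow> 'y::ab_group_add"
  assumes "\<And>a b. f (a + b) = f a + f b"
  shows "f (\<Sum>i\<in>I. g i) = (\<Sum>i\<in>I. f (g i))"
  by (induction I rule: infinite_finite_induct) (simp_all add: assms additive_zero[of f, OF assms])

lemma frag_eq_sum: "a = (\<Sum>c\<in>Poly_Mapping.keys a. frag_cmul (Poly_Mapping.lookup a c) (frag_of c))"
  by (rule poly_mapping_eqI)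
    (simp add: lookup_sum lookup_single when_def if_distrib[of "\<lambda>x. _ * x"] in_keys_iff cong: if_cong)

lemma frag_cmul_uminus [simp]: "frag_cmul k (- a) = frag_cmul (- k) a"
  by (rule poly_mapping_eqI) simp

lemma additive_expand:
  fixes f :: "('s \<Rightarrow>\<^sub>0 int) \<Rightarrow> ('t \<Rightarrow>\<^sub>0 int)"
  assumes "\<And>a b. f (a + b) = f a + f b"
  shows "f a = (\<Sum>c\<in>Poly_Mapping.keys a. frag_cmul (Poly_Mapping.lookup a c) (f (frag_of c)))"
  by (subst frag_eq_sum[of a], unfold additive_sum[of f, OF assms] additive_cmul[of f, OF assms]) (rule refl)

section \<open>Simple reflections of a finite root set, with symmetry still to be proved\<close>

locale simple_reflections =
  fixes \<Phi> :: "('s \<Rightarrow>\<^sub>0 int) set" and S :: "'s set"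
    and \<sigma> :: "'s \<Rightarrow> ('s \<Rightarrow>\<^sub>0 int) \<Rightarrow> ('s \<Rightarrow>\<^sub>0 int)"
  assumes finite_Phi: "finite \<Phi>"
    and zero_notin_Phi: "0 \<notin> \<Phi>"
    and keys_Phi: "a \<in> \<Phi> \<Longrightarrow> Poly_Mapping.keys a \<subseteq> S"
    and Phi_sign: "a \<in> \<Phi> \<Longrightarrow> dominant a \<or> dominant (- a)"
    and simple_in_Phi: "c \<in> S \<Longrightarrow> frag_of c \<in> \<Phi>"
    and sigma_add: "c \<in> S \<Longrightarrow> \<sigma> c (a + b) = \<sigma> c a + \<sigma> c b"
    and sigma_Phi: "c \<in> S \<Longrightarrow> a \<in> \<Phi> \<Longrightarrow> \<sigma> c a \<in> \<Phi>"
    and sigma_other: "c \<in> S \<Longrightarrow> a \<in> \<Phi> \<Longrightarrow> d \<noteq> c \<Longrightarrow> Poly_Mapping.lookup (\<sigma> c a) d = Poly_Mapping.lookup a d"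
    and sigma_simple: "c \<in> S \<Longrightarrow> \<sigma> c (frag_of c) = - frag_of c"
    and sigma_sigma: "c \<in> S \<Longrightarrow> a \<in> \<Phi> \<Longrightarrow> \<sigma> c (\<sigma> c a) = a"
begin

primrec act :: "'s list \<Rightarrow> ('s \<Rightarrow>\<^sub>0 int) \<Rightarrow> ('s \<Rightarrow>\<^sub>0 int)" where
  "act [] a = a"
| "act (c # cs) a = \<sigma> c (act cs a)"

lemma act_append: "act (cs @ ds) a = act cs (act ds a)"
  by (induction cs) auto

lemma act_add: "set cs \<subseteq> S \<Longrightarrow> act cs (a + b) = act cs a + act cs b"
  by (induction cs) (auto simp: sigma_add)

lemma act_uminus: "set cs \<subseteq> S \<Longrightarrow> act cs (- a) = - act cs a"
  by (rule additive_uminus) (rule act_add)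

lemma sigma_uminus: "c \<in> S \<Longrightarrow> \<sigma> c (- a) = - \<sigma> c a"
  by (rule additive_uminus) (rule sigma_add)

lemma act_Phi: "set cs \<subseteq> S \<Longrightarrow> a \<in> \<Phi> \<Longrightarrow> act cs a \<in> \<Phi>"
  by (induction cs) (auto simp: sigma_Phi)

lemma act_rev_act: "set cs \<subseteq> S \<Longrightarrow> a \<in> \<Phi> \<Longrightarrow> act (rev cs) (act cs a) = a"
  by (induction cs) (auto simp: act_append sigma_sigma act_Phi)

lemma sign_exclusive: "a \<in> \<Phi> \<Longrightarrow> dominant a \<Longrightarrow> \<not> dominant (- a)"
  using dominant_antisym zero_notin_Phi by blast

text \<open>\<open>\<sigma> c\<close> changes only the coefficient at \<open>c\<close>, so every
  other coefficient of \<open>a\<close> is both nonnegative and nonpositive. Proper multiples of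
  \<open>c\<close> are not excluded at this stage.\<close>

lemma simple_multiple:
  assumes "c \<in> S" "a \<in> \<Phi>" "dominant a" "dominant (- \<sigma> c a)"
  shows "a = frag_cmul (Poly_Mapping.lookup a c) (frag_of c)"
proof (rule poly_mapping_eqI)
  fix d
  have "Poly_Mapping.lookup a d = 0" if "d \<noteq> c"
  proof -
    have "0 \<le> - Poly_Mapping.lookup (\<sigma> c a) d" "0 \<le> Poly_Mapping.lookup a d"
      using assms(3,4) by (simp_all add: dominant_def)
    then show ?thesis using sigma_other[OF assms(1,2) that] by linarith
  qed
  then show "Poly_Mapping.lookup a d = Poly_Mapping.lookup (frag_cmul (Poly_Mapping.lookup a c) (frag_of c)) d"
    by (simp add: lookup_single when_def)
qed

lemma sigma_simple_multiple: "c \<in> S \<Longrightarrow> \<sigma> c (frag_cmul k (frag_of c)) = - frag_cmul k (frag_of c)"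
  by (subst additive_cmul) (auto simp: sigma_add sigma_simple)

definition inversions :: "(('s \<Rightarrow>\<^sub>0 int) \<Rightarrow> ('s \<Rightarrow>\<^sub>0 int)) \<Rightarrow> ('s \<Rightarrow>\<^sub>0 int) set" where
  "inversions f = {a \<in> \<Phi>. dominant a \<and> dominant (- f a)}"

lemma finite_inversions: "finite (inversions f)"
  by (simp add: inversions_def finite_Phi)

text \<open>Appending \<open>c\<close> transports the old inversions by \<open>\<sigma> c\<close>
  and adds the inversion \<open>c\<close>. Before reducedness is known, further multiples of
  \<open>c\<close> may become inversions, hence only an inclusion; it suffices for the maximality
  argument in \<open>longest_word\<close>.\<close>

lemma inversions_insert:
  assumes c: "c \<in> S" and cs: "set cs \<subseteq> S" and pos: "dominant (act cs (frag_of c))"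
  shows "insert (frag_of c) (\<sigma> c ` inversions (act cs)) \<subseteq> inversions (act (cs @ [c]))"
    and "card (insert (frag_of c) (\<sigma> c ` inversions (act cs))) = Suc (card (inversions (act cs)))"
proof -
  have "inj_on (\<sigma> c) (inversions (act cs))"
    by (rule inj_on_inverseI[where g = "\<sigma> c"]) (auto simp: inversions_def sigma_sigma c)
  moreover have "insert (frag_of c) (\<sigma> c ` inversions (act cs)) \<subseteq> inversions (act (cs @ [c]))"
  proof -
    have "\<sigma> c a \<in> inversions (act (cs @ [c]))" if a: "a \<in> inversions (act cs)" for a
    proof -
      have a': "a \<in> \<Phi>" "dominant a" "dominant (- act cs a)"
        using a by (auto simp: inversions_def)
      \<comment> \<open>If the transported root were negative, \<open>a\<close> would be a
        nonnegative multiple of \<open>c\<close>, and \<open>act cs\<close> would keep it positive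
        by \<open>pos\<close>.\<close>
      have "dominant (\<sigma> c a)"
      proof (rule ccontr)
        assume "\<not> dominant (\<sigma> c a)"
        then have "dominant (- \<sigma> c a)"
          using Phi_sign sigma_Phi c a' by blast
        then have eq: "a = frag_cmul (Poly_Mapping.lookup a c) (frag_of c)"
          using simple_multiple c a' by blast
        have "act cs a = frag_cmul (Poly_Mapping.lookup a c) (act cs (frag_of c))"
          by (subst eq, rule additive_cmul) (simp add: act_add cs)
        moreover have "0 \<le> Poly_Mapping.lookup a c"
          using a' by (simp add: dominant_def)
        ultimately have "dominant (act cs a)"
          using pos by (simp add: dominant_cmul)
        then show False using a' sign_exclusive act_Phi cs by blast
      qed
      then show ?thesis
        using a' by (simp add: inversions_def sigma_Phi c act_append sigma_sigma)
    qed
    moreover have "frag_of c \<in> inversions (act (cs @ [c]))"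
      using c cs pos by (simp add: inversions_def simple_in_Phi act_append sigma_simple act_uminus)
    ultimately show ?thesis by blast
  qed
  moreover have "frag_of c \<notin> \<sigma> c ` inversions (act cs)"
  proof
    assume "frag_of c \<in> \<sigma> c ` inversions (act cs)"
    then obtain a where a: "a \<in> \<Phi>" "dominant a" "\<sigma> c a = frag_of c"
      by (auto simp: inversions_def)
    then have "a = - frag_of c"
      using sigma_sigma[OF c a(1)] sigma_simple[OF c] by simp
    then show False using sign_exclusive[OF a(1,2)] by simp
  qed
  ultimately show "insert (frag_of c) (\<sigma> c ` inversions (act cs)) \<subseteq> inversions (act (cs @ [c]))"
    "card (insert (frag_of c) (\<sigma> c ` inversions (act cs))) = Suc (card (inversions (act cs)))"
    by (simp_all add: finite_inversions card_image)
qed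

text \<open>A word with the greatest number of inversions, which exists because
  \<open>card \<Phi>\<close> bounds that number, sends all simple roots to negative ones: otherwise
  another letter would add an inversion. Linearity extends this to the positive roots.\<close>

lemma longest_word:
  obtains cs where "set cs \<subseteq> S" "\<And>a. a \<in> \<Phi> \<Longrightarrow> dominant a \<Longrightarrow> dominant (- act cs a)"
proof -
  let ?C = "{card (inversions (act cs)) | cs. set cs \<subseteq> S}"
  have "card (inversions f) \<le> card \<Phi>" for f
    by (rule card_mono) (auto simp: finite_Phi inversions_def)
  then have "?C \<subseteq> {..card \<Phi>}" by auto
  then have fin: "finite ?C" by (rule finite_subset) simp
  have "card (inversions (act [])) \<in> ?C"
    by (rule CollectI, rule exI[of _ "[]"]) simp
  then have "Max ?C \<in> ?C" using fin by (intro Max_in) auto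
  then obtain cs where cs: "set cs \<subseteq> S" "card (inversions (act cs)) = Max ?C" by auto
  have simple: "dominant (- act cs (frag_of c))" if "c \<in> S" for c
  proof (rule ccontr)
    assume "\<not> dominant (- act cs (frag_of c))"
    then have "dominant (act cs (frag_of c))"
      using Phi_sign act_Phi cs simple_in_Phi that by blast
    then have "Max ?C < card (inversions (act (cs @ [c])))"
      using card_mono[OF finite_inversions inversions_insert(1)[OF that cs(1)]]
        inversions_insert(2)[OF that cs(1)] cs(2) by simp
    moreover have "card (inversions (act (cs @ [c]))) \<in> ?C"
      using cs that by (intro CollectI exI[of _ "cs @ [c]"]) simp
    ultimately show False using Max_ge[OF fin] by (meson leD)
  qed
  show thesis
  proof (rule that[OF cs(1)])
    fix a assume a: "a \<in> \<Phi>" "dominant a"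
    have "- act cs a = (\<Sum>c\<in>Poly_Mapping.keys a. frag_cmul (Poly_Mapping.lookup a c) (- act cs (frag_of c)))"
      by (subst additive_expand[of "act cs"]) (simp_all add: act_add cs flip: sum_negf)
    also have "dominant \<dots>"
    proof (intro dominant_sum dominant_cmul)
      show "0 \<le> Poly_Mapping.lookup a c" for c using a by (simp add: dominant_def)
      show "dominant (- act cs (frag_of c))" if "c \<in> Poly_Mapping.keys a" for c
        using that simple keys_Phi[OF a(1)] by blast
    qed
    finally show "dominant (- act cs a)" .
  qed
qed

text \<open>Letters are removed from the left until the image of \<open>a\<close> is positive; the
  letter removed last is \<open>c\<close>, and \<open>ds\<close> is what remains of the
  word.\<close>

lemma crossing:
  assumes "set cs \<subseteq> S" "a \<in> \<Phi>" "dominant a" "dominant (- act cs a)"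
  obtains ds c where "set ds \<subseteq> S" "c \<in> S" "dominant (act ds a)" "dominant (- \<sigma> c (act ds a))"
proof -
  have "\<exists>ds c. set ds \<subseteq> S \<and> c \<in> S \<and> dominant (act ds a) \<and> dominant (- \<sigma> c (act ds a))"
    using assms(1,4)
  proof (induction cs)
    case Nil
    then show ?case using assms sign_exclusive by simp
  next
    case (Cons c cs)
    show ?case
    proof (cases "dominant (act cs a)")
      case True
      with Cons.prems show ?thesis by (intro exI[of _ cs] exI[of _ c]) simp
    next
      case False
      then have "dominant (- act cs a)"
        using Phi_sign act_Phi Cons.prems assms(2) by (metis set_subset_Cons subset_trans)
      then show ?thesis using Cons by simp
    qed
  qed
  then show thesis using that by blast
qed

text \<open>Take an element making all positive roots negative and follow a positive root along a word
  for it: just before the root turns negative it is a multiple of a simple root, hence negated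
  by a simple reflection.\<close>

lemma uminus_Phi:
  assumes "a \<in> \<Phi>"
  shows "- a \<in> \<Phi>"
proof -
  have pos: "- a \<in> \<Phi>" if a: "a \<in> \<Phi>" "dominant a" for a
  proof -
    obtain cs where "set cs \<subseteq> S" "dominant (- act cs a)"
      using longest_word a by metis
    then obtain ds c where ds: "set ds \<subseteq> S" "c \<in> S" "dominant (act ds a)" "dominant (- \<sigma> c (act ds a))"
      using crossing a by metis
    let ?b = "act ds a"
    have b: "?b \<in> \<Phi>" using act_Phi ds a by blast
    have "?b = frag_cmul (Poly_Mapping.lookup ?b c) (frag_of c)"
      using simple_multiple ds b by blast
    then have "\<sigma> c ?b = - ?b"
      using sigma_simple_multiple[OF ds(2)] by metis
    then have "- ?b \<in> \<Phi>" using sigma_Phi[OF ds(2) b] by simp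
    then have "act (rev ds) (- ?b) \<in> \<Phi>" using act_Phi ds by simp
    then show ?thesis using act_rev_act act_uminus ds a by simp
  qed
  show ?thesis
  proof (cases "dominant a")
    \<comment> \<open>The longest word makes a negative root positive; the case already settled
      applies to its image, and the result is carried back by the reversed word.\<close>
    case False
    obtain cs where cs: "set cs \<subseteq> S" "\<And>a. a \<in> \<Phi> \<Longrightarrow> dominant a \<Longrightarrow> dominant (- act cs a)"
      using longest_word by metis
    let ?p = "{a \<in> \<Phi>. dominant a}" and ?m = "{a \<in> \<Phi>. dominant (- a)}"
    have "inj_on (act cs) \<Phi>"
      by (rule inj_on_inverseI[where g = "act (rev cs)"]) (rule act_rev_act[OF cs(1)])
    have neg: "dominant (act cs b)" if b: "b \<in> ?m" for b
    proof -
      have "act cs b = (\<Sum>c\<in>Poly_Mapping.keys b. frag_cmul (- Poly_Mapping.lookup b c) (- act cs (frag_of c)))"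
        by (subst additive_expand[of "act cs"]) (simp_all add: act_add cs)
      also have "dominant \<dots>"
      proof (intro dominant_sum dominant_cmul)
        show "0 \<le> - Poly_Mapping.lookup b c" for c using b by (simp add: dominant_def)
        show "dominant (- act cs (frag_of c))" if "c \<in> Poly_Mapping.keys b" for c
          using that b cs(2) keys_Phi[of b] simple_in_Phi[of c] by auto
      qed
      finally show ?thesis .
    qed
    have a: "a \<in> ?m" using assms False Phi_sign by blast
    have "- act cs a \<in> \<Phi>"
      using pos neg[OF a] act_Phi[OF cs(1) assms] by blast
    then have "act (rev cs) (- act cs a) \<in> \<Phi>"
      using act_Phi cs by simp
    then show ?thesis using act_rev_act act_uminus cs assms by simp
  qed (use pos assms in blast)
qed

end

section \<open>Reduced root systems: inversions and galleries\<close>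

locale reduced_simple_reflections = simple_reflections +
  assumes reduced: "c \<in> S \<Longrightarrow> frag_cmul k (frag_of c) \<in> \<Phi> \<Longrightarrow> k = 1 \<or> k = - 1"
begin

text \<open>The classical fact that a simple reflection permutes the positive roots other than its
  own, in contrapositive form; reducedness selects the coefficient 1.\<close>

lemma sigma_sign_change:
  assumes "c \<in> S" "a \<in> \<Phi>" "dominant a" "dominant (- \<sigma> c a)"
  shows "a = frag_of c"
proof -
  have eq: "a = frag_cmul (Poly_Mapping.lookup a c) (frag_of c)"
    using simple_multiple assms by blast
  then have "Poly_Mapping.lookup a c = 1 \<or> Poly_Mapping.lookup a c = - 1"
    using reduced assms by metis
  moreover have "0 \<le> Poly_Mapping.lookup a c"
    using assms(3) by (simp add: dominant_def)
  ultimately show ?thesis using eq by auto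
qed

lemma sigma_dominant: "c \<in> S \<Longrightarrow> a \<in> \<Phi> \<Longrightarrow> dominant a \<Longrightarrow> a \<noteq> frag_of c \<Longrightarrow> dominant (\<sigma> c a)"
  using sigma_sign_change Phi_sign sigma_Phi by blast

text \<open>The inclusion of \<open>inversions_insert\<close> becomes an equality: a new inversion
  other than \<open>c\<close> stays positive under \<open>\<sigma> c\<close>, hence comes from an
  old one.\<close>

lemma inversions_append:
  assumes c: "c \<in> S" and cs: "set cs \<subseteq> S" and pos: "dominant (act cs (frag_of c))"
  shows "card (inversions (act (cs @ [c]))) = Suc (card (inversions (act cs)))"
proof -
  have "inversions (act (cs @ [c])) \<subseteq> insert (frag_of c) (\<sigma> c ` inversions (act cs))"
  proof
    fix a assume a: "a \<in> inversions (act (cs @ [c]))"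
    then have a': "a \<in> \<Phi>" "dominant a" "dominant (- act cs (\<sigma> c a))"
      by (auto simp: inversions_def act_append)
    show "a \<in> insert (frag_of c) (\<sigma> c ` inversions (act cs))"
    proof (cases "a = frag_of c")
      case False
      then have "\<sigma> c a \<in> inversions (act cs)"
        using a' by (simp add: inversions_def sigma_Phi c sigma_dominant)
      then show ?thesis using sigma_sigma[OF c a'(1)] by (metis image_eqI insertI2)
    qed simp
  qed
  then show ?thesis
    using inversions_insert[OF assms] by (metis subset_antisym)
qed

lemma inversions_append_neg:
  assumes c: "c \<in> S" and cs: "set cs \<subseteq> S" and neg: "dominant (- act cs (frag_of c))"
  shows "card (inversions (act cs)) = Suc (card (inversions (act (cs @ [c]))))"
proof -
  \<comment> \<open>The increasing case is applied to \<open>cs @ [c]\<close>, since appending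
    \<open>c\<close> twice gives back the action of \<open>cs\<close> on roots.\<close>
  have "inversions (act ((cs @ [c]) @ [c])) = inversions (act cs)"
    using c by (auto simp: inversions_def act_append sigma_sigma)
  moreover have "dominant (act (cs @ [c]) (frag_of c))"
    using neg c cs by (simp add: act_append sigma_simple act_uminus)
  ultimately show ?thesis
    using inversions_append[OF c, of "cs @ [c]"] c cs by simp
qed

text \<open>A gallery is encoded by the simple roots \<open>a i\<close> and the set \<open>G\<close> of positions where it
  is not the identity.\<close>

fun prefix_word :: "(nat \<Rightarrow> 's) \<Rightarrow> nat set \<Rightarrow> nat \<Rightarrow> 's list" where
  "prefix_word a G 0 = []"
| "prefix_word a G (Suc i) = prefix_word a G i @ (if Suc i \<in> G then [a (Suc i)] else [])"

lemma set_prefix_word: "\<forall>i\<in>{1..r}. a i \<in> S \<Longrightarrow> i \<le> r \<Longrightarrow> set (prefix_word a G i) \<subseteq> S"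
  by (induction i) auto

text \<open>The two sets are \<open>J\<close> and \<open>D\<close>. At a position where the gallery
  stays, both conditions coincide and the word is unchanged. Where it moves, exactly one of them
  holds, according to the sign of the root crossed, and the number of inversions rises or falls by
  one accordingly.\<close>

lemma card_gallery_sets:
  assumes "\<forall>i\<in>{1..r}. a i \<in> S"
  shows "card {i \<in> {1..r}. dominant (act (prefix_word a G i) (- frag_of (a i)))} =
    card {i \<in> {1..r}. dominant (act (prefix_word a G (i - 1)) (- frag_of (a i)))} +
    card (inversions (act (prefix_word a G r)))"
  using assms
proof (induction r)
  case 0
  have "inversions (\<lambda>a. a) = {}" using sign_exclusive by (auto simp: inversions_def)
  then show ?case by simp
next
  case (Suc r)
  let ?J = "\<lambda>i. dominant (act (prefix_word a G i) (- frag_of (a i)))"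
  let ?D = "\<lambda>i. dominant (act (prefix_word a G (i - 1)) (- frag_of (a i)))"
  let ?w = "prefix_word a G r" and ?c = "a (Suc r)"
  have c: "?c \<in> S" using Suc.prems by simp
  have w: "set ?w \<subseteq> S" using Suc.prems by (intro set_prefix_word[of r]) auto
  have split: "card {i \<in> {1..Suc r}. R i} = card {i \<in> {1..r}. R i} + (if R (Suc r) then 1 else 0)" for R
  proof -
    have "{i \<in> {1..Suc r}. R i} = {i \<in> {1..r}. R i} \<union> (if R (Suc r) then {Suc r} else {})"
      by (auto simp: le_Suc_eq)
    then show ?thesis by (auto simp: card_insert_if)
  qed
  have IH: "card {i \<in> {1..r}. ?J i} = card {i \<in> {1..r}. ?D i} + card (inversions (act ?w))"
    using Suc by simp
  have root: "act ?w (frag_of ?c) \<in> \<Phi>" using act_Phi w c simple_in_Phi by blast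
  show ?case
  proof (cases "Suc r \<in> G")
    case False
    then show ?thesis unfolding split using IH by simp
  next
    case True
    then have pw: "prefix_word a G (Suc r) = ?w @ [?c]" by simp
    have J: "?J (Suc r) \<longleftrightarrow> dominant (act ?w (frag_of ?c))"
      unfolding pw using c w by (simp add: act_append sigma_uminus sigma_simple)
    have D: "?D (Suc r) \<longleftrightarrow> dominant (- act ?w (frag_of ?c))"
      using w by (simp add: act_uminus)
    show ?thesis
    proof (cases "dominant (act ?w (frag_of ?c))")
      case pos: True
      show ?thesis
        unfolding split J D unfolding pw inversions_append[OF c w pos]
        using IH pos sign_exclusive[OF root pos] by simp
    next
      case neg: False
      then have neg': "dominant (- act ?w (frag_of ?c))" using Phi_sign root by blast
      show ?thesis
        unfolding split J D unfolding pw
        using IH neg neg' inversions_append_neg[OF c w neg'] by simp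
    qed
  qed
qed

text \<open>The last letter is peeled off. Either \<open>b\<close> is still negative after that
  reflection, and an earlier position serves, or the reflection makes it positive; then
  \<open>b\<close> is minus the last simple root, and the last position serves.\<close>

lemma gallery_crosses_wall:
  assumes "\<forall>i\<in>{1..r}. a i \<in> S"
    and "b \<in> \<Phi>" "dominant (- b)" "dominant (act (prefix_word a G r) b)"
  shows "\<exists>i\<in>{1..r}. act (prefix_word a G i) (- frag_of (a i)) = act (prefix_word a G r) b"
  using assms
proof (induction r arbitrary: b)
  case 0
  then show ?case using sign_exclusive by auto
next
  case (Suc r)
  have c: "a (Suc r) \<in> S" using Suc.prems by simp
  show ?case
  proof (cases "Suc r \<in> G")
    case False
    then have "\<exists>i\<in>{1..r}. act (prefix_word a G i) (- frag_of (a i)) = act (prefix_word a G r) b"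
      using Suc by simp
    then show ?thesis using False by auto
  next
    case True
    let ?b = "\<sigma> (a (Suc r)) b"
    have b: "?b \<in> \<Phi>" using sigma_Phi c Suc.prems by blast
    show ?thesis
    proof (cases "dominant (- ?b)")
      case neg: True
      then have "\<exists>i\<in>{1..r}. act (prefix_word a G i) (- frag_of (a i)) = act (prefix_word a G r) ?b"
        using Suc True b by (auto simp: act_append)
      then show ?thesis using True by (auto simp: act_append)
    next
      case False
      then have "dominant ?b" using Phi_sign b by blast
      then have "- b = frag_of (a (Suc r))"
        using sigma_sign_change[OF c, of "- b"] uminus_Phi Suc.prems sigma_uminus[OF c] by simp
      then have "- frag_of (a (Suc r)) = b" by (metis minus_minus)
      then show ?thesis using True by (auto intro!: bexI[of _ "Suc r"])
    qed
  qed
qed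

end

section \<open>Words in the reflection group: exchange and length\<close>

locale reflection_generators = reduced_simple_reflections \<Phi> S \<sigma> + Group.group M
  for \<Phi> :: "('s \<Rightarrow>\<^sub>0 int) set" and S :: "'s set" and \<sigma> and M :: "('g, 'm) monoid_scheme" (structure) +
  fixes gen :: "'s \<Rightarrow> 'g"
  assumes gen_closed: "c \<in> S \<Longrightarrow> gen c \<in> carrier M"
    and gen_gen: "c \<in> S \<Longrightarrow> gen c \<otimes> gen c = \<one>"
begin

primrec word_prod :: "'s list \<Rightarrow> 'g" where
  "word_prod [] = \<one>"
| "word_prod (c # cs) = gen c \<otimes> word_prod cs"

lemma word_prod_closed: "set cs \<subseteq> S \<Longrightarrow> word_prod cs \<in> carrier M"
  by (induction cs) (auto simp: gen_closed)

lemma word_prod_append: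
  "set cs \<subseteq> S \<Longrightarrow> set ds \<subseteq> S \<Longrightarrow> word_prod (cs @ ds) = word_prod cs \<otimes> word_prod ds"
  by (induction cs) (auto simp: gen_closed word_prod_closed m_assoc)

definition word_length :: "'g \<Rightarrow> nat" where
  "word_length g = (LEAST k. \<exists>cs. set cs \<subseteq> S \<and> length cs = k \<and> g = word_prod cs)"

lemma word_length_le: "set cs \<subseteq> S \<Longrightarrow> word_length (word_prod cs) \<le> length cs"
  unfolding word_length_def by (rule Least_le) blast

lemma reduced_word:
  assumes "set cs \<subseteq> S"
  obtains ds where "set ds \<subseteq> S" "length ds = word_length (word_prod cs)" "word_prod cs = word_prod ds"
proof -
  have "\<exists>ds. set ds \<subseteq> S \<and> length ds = word_length (word_prod cs) \<and> word_prod cs = word_prod ds"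
    unfolding word_length_def by (rule LeastI_ex) (use assms in blast)
  then show thesis using that by blast
qed

end

text \<open>Two compatibilities between the group and its action on roots take the place of a
  Coxeter presentation: a word carrying one simple root to another intertwines their generators, and
  the action of a word depends only on its product.\<close>

locale coxeter_action = reflection_generators +
  assumes gen_conj: "set cs \<subseteq> S \<Longrightarrow> c \<in> S \<Longrightarrow> d \<in> S \<Longrightarrow> act cs (frag_of c) = frag_of d \<Longrightarrow>
      word_prod cs \<otimes> gen c = gen d \<otimes> word_prod cs"
    and act_cong: "set cs \<subseteq> S \<Longrightarrow> set ds \<subseteq> S \<Longrightarrow> word_prod cs = word_prod ds \<Longrightarrow> a \<in> \<Phi> \<Longrightarrow> act cs a = act ds a"
begin

text \<open>As the letters act on \<open>c\<close> from right to left, its image turns negative at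
  some letter \<open>d\<close>, just before which it equals the simple root of \<open>d\<close>.
  There \<open>gen_conj\<close> moves \<open>gen c\<close> to the left as \<open>gen d\<close>, and
  the two copies of \<open>gen d\<close> cancel.\<close>

lemma exchange:
  assumes "set cs \<subseteq> S" "c \<in> S" "dominant (- act cs (frag_of c))"
  shows "\<exists>ds. set ds \<subseteq> S \<and> length cs = Suc (length ds) \<and> word_prod (cs @ [c]) = word_prod ds"
  using assms(1,3)
proof (induction cs)
  case Nil
  then show ?case using sign_exclusive simple_in_Phi assms(2) by fastforce
next
  case (Cons d cs)
  then have d: "d \<in> S" and cs: "set cs \<subseteq> S" by auto
  have root: "act cs (frag_of c) \<in> \<Phi>" using act_Phi cs simple_in_Phi assms(2) by blast
  show ?case
  proof (cases "dominant (act cs (frag_of c))")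
    case True
    then have "act cs (frag_of c) = frag_of d"
      using sigma_sign_change[OF d root] Cons.prems by simp
    then have "word_prod cs \<otimes> gen c = gen d \<otimes> word_prod cs"
      using gen_conj cs assms(2) d by blast
    then have "word_prod ((d # cs) @ [c]) = gen d \<otimes> (gen d \<otimes> word_prod cs)"
      using cs assms(2) by (simp add: word_prod_append gen_closed)
    also have "\<dots> = word_prod cs"
      using d cs by (simp add: gen_gen gen_closed word_prod_closed flip: m_assoc)
    finally show ?thesis using cs by auto
  next
    case False
    then have "dominant (- act cs (frag_of c))" using Phi_sign root by blast
    then obtain ds where "set ds \<subseteq> S" "length cs = Suc (length ds)" "word_prod (cs @ [c]) = word_prod ds"
      using Cons.IH cs by blast
    then show ?thesis using d by (intro exI[of _ "d # ds"]) simp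
  qed
qed

text \<open>A prefix of a reduced word is reduced, and by the exchange condition the letter after it
  cannot remove an inversion; so each letter adds one.\<close>

lemma inversions_reduced:
  assumes "set cs \<subseteq> S" "length cs = word_length (word_prod cs)"
  shows "card (inversions (act cs)) = length cs"
  using assms
proof (induction cs rule: rev_induct)
  case Nil
  have "inversions (\<lambda>a. a) = {}" using sign_exclusive by (auto simp: inversions_def)
  then show ?case by simp
next
  case (snoc c cs)
  then have c: "c \<in> S" and cs: "set cs \<subseteq> S" by auto
  have "word_length (word_prod cs) = length cs"
  proof -
    obtain ds where ds: "set ds \<subseteq> S" "length ds = word_length (word_prod cs)" "word_prod cs = word_prod ds"
      using reduced_word cs by metis
    then have "word_prod (cs @ [c]) = word_prod (ds @ [c])"
      using cs c by (simp add: word_prod_append)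
    then have "length (cs @ [c]) \<le> length (ds @ [c])"
      using snoc.prems word_length_le[of "ds @ [c]"] ds c by simp
    then show ?thesis using ds word_length_le[OF cs] by simp
  qed
  then have IH: "card (inversions (act cs)) = length cs" using snoc cs by simp
  have "\<not> dominant (- act cs (frag_of c))"
  proof
    assume "dominant (- act cs (frag_of c))"
    then obtain ds where ds: "set ds \<subseteq> S" "length cs = Suc (length ds)" "word_prod (cs @ [c]) = word_prod ds"
      using exchange cs c by blast
    then show False using word_length_le[OF ds(1)] snoc.prems by simp
  qed
  then have "dominant (act cs (frag_of c))"
    using Phi_sign act_Phi cs simple_in_Phi c by blast
  then show ?case using inversions_append[OF c cs] IH by simp
qed

lemma card_inversions:
  assumes "set cs \<subseteq> S"
  shows "card (inversions (act cs)) = word_length (word_prod cs)"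
proof -
  obtain ds where ds: "set ds \<subseteq> S" "length ds = word_length (word_prod cs)" "word_prod cs = word_prod ds"
    using reduced_word assms by metis
  then have "inversions (act cs) = inversions (act ds)"
    using act_cong[OF assms ds(1,3)] by (auto simp: inversions_def)
  then show ?thesis using inversions_reduced ds by simp
qed

end

section \<open>Pinned groups\<close>

lemma invertible_one: "invertible (mat 1 :: 'a::semiring_1 ^ 'n ^ 'n)"
  unfolding invertible_def by (intro exI[of _ "mat 1"]) simp

lemma group_GLn: "Group.group (GLn :: ('n::finite) cmat monoid)"
proof (rule groupI)
  fix A :: "'n cmat" assume "A \<in> carrier GLn"
  then have "invertible A" by (simp add: GLn_def)
  then show "\<exists>B\<in>carrier GLn. B \<otimes>\<^bsub>GLn\<^esub> A = \<one>\<^bsub>GLn\<^esub>"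
    by (intro bexI[of _ "matrix_inv A"]) (simp_all add: GLn_def matrix_inv_left invertible_matrix_inv)
qed (auto simp: GLn_def matrix_mul_assoc invertible_mult invertible_one)

lemma mult_GLn [simp]: "x \<otimes>\<^bsub>GLn\<^esub> y = x ** y" and one_GLn [simp]: "\<one>\<^bsub>GLn\<^esub> = mat 1"
  by (simp_all add: GLn_def)

lemma inv_GLn: "invertible A \<Longrightarrow> inv\<^bsub>GLn\<^esub> A = matrix_inv (A :: ('n::finite) cmat)"
  by (rule group.inv_equality[OF group_GLn]) (simp_all add: GLn_def matrix_inv_left invertible_matrix_inv)

lemma subgroup_GLn_iff:
  "subgroup H GLn \<longleftrightarrow> mat 1 \<in> H \<and> (\<forall>x\<in>H. invertible x \<and> matrix_inv x \<in> H) \<and> (\<forall>x\<in>H. \<forall>y\<in>H. x ** y \<in> H)"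
  for H :: "('n::finite) cmat set"
proof -
  have "subgroup H GLn \<longleftrightarrow> H \<subseteq> {A. invertible A} \<and> mat 1 \<in> H \<and> (\<forall>x\<in>H. inv\<^bsub>GLn\<^esub> x \<in> H) \<and> (\<forall>x\<in>H. \<forall>y\<in>H. x ** y \<in> H)"
    unfolding subgroup_def by (auto simp: GLn_def)
  then show ?thesis by (auto simp: inv_GLn subset_iff)
qed

lemma inv_as_group:
  assumes "subgroup H GLn" "x \<in> H"
  shows "inv\<^bsub>as_group H\<^esub> x = matrix_inv (x :: ('n::finite) cmat)"
  using group.m_inv_consistent[OF group_GLn assms] assms by (simp add: inv_GLn subgroup_GLn_iff)

lemma normalizer_as_group:
  assumes G: "subgroup G GLn" and T: "T \<subseteq> G"
  shows "n \<in> normalizer (as_group G) T \<longleftrightarrow> n \<in> G \<and> conj_by n ` T = (T :: ('n::finite) cmat set)"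
proof -
  have "n <#\<^bsub>as_group G\<^esub> T #>\<^bsub>as_group G\<^esub> (inv\<^bsub>as_group G\<^esub> n) = conj_by n ` T" if "n \<in> G"
    using that by (auto simp: l_coset_def r_coset_def inv_as_group[OF G] conj_by_def)
  then show ?thesis
    using T by (auto simp: normalizer_def stabilizer_def)
qed

subsection \<open>Tangent spaces\<close>

text \<open>\<open>D\<close> lists the partial derivatives of \<open>f\<close> at the identity. The
  property ranges over all curves through the identity, so that lines and interpolating curves are
  treated alike.\<close>

definition is_gradient :: "(('n::finite) \<times> 'n) cpoly \<Rightarrow> ('n \<times> 'n \<Rightarrow> complex) \<Rightarrow> bool" where
  "is_gradient f D \<longleftrightarrow> (\<forall>p (B :: 'n cmat). (\<forall>i j. ((\<lambda>z. p z $ i $ j) has_field_derivative B $ i $ j) (at 0)) \<and> p 0 = mat 1 \<longrightarrow>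
     ((\<lambda>z. mat_eval f (p z)) has_field_derivative (\<Sum>(i, j)\<in>UNIV. D (i, j) * B $ i $ j)) (at 0))"

lemma is_gradient_exists: "\<exists>D. is_gradient f D"
proof -
  obtain D where D: "\<And>p b. (\<And>i. ((\<lambda>z. p z i) has_field_derivative b i) (at 0)) \<Longrightarrow> p 0 = (\<lambda>(i, j). mat 1 $ i $ j) \<Longrightarrow>
        ((\<lambda>z. peval f (p z)) has_field_derivative (\<Sum>i\<in>UNIV. D i * b i)) (at 0)"
    using peval_directional_derivative[where a = "\<lambda>(i, j). mat 1 $ i $ j" and f = f] by blast
  have "is_gradient f D"
    unfolding is_gradient_def mat_eval_def
  proof (intro allI impI, elim conjE)
    fix p :: "complex \<Rightarrow> 'a cmat" and B
    assume d: "\<forall>i j. ((\<lambda>z. p z $ i $ j) has_field_derivative B $ i $ j) (at 0)" and p0: "p 0 = mat 1"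
    have "((\<lambda>z. peval f ((\<lambda>z (i, j). p z $ i $ j) z)) has_field_derivative (\<Sum>i\<in>UNIV. D i * (\<lambda>(i, j). B $ i $ j) i)) (at 0)"
      by (rule D) (use d p0 in \<open>auto simp: split_beta\<close>)
    then show "((\<lambda>z. peval f (\<lambda>(i, j). p z $ i $ j)) has_field_derivative (\<Sum>(i, j)\<in>UNIV. D (i, j) * B $ i $ j)) (at 0)"
      by (simp add: split_beta)
  qed
  then show ?thesis by blast
qed

lemma is_gradient_line:
  assumes "is_gradient f D"
  shows "((\<lambda>z. mat_eval f (mat 1 + mat z ** X)) has_field_derivative (\<Sum>(i, j)\<in>UNIV. D (i, j) * X $ i $ j)) (at 0)"
proof -
  have "((\<lambda>z. (mat 1 + mat z ** X) $ i $ j) has_field_derivative X $ i $ j) (at 0)" for i j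
    by (auto intro!: derivative_eq_intros)
  then show ?thesis
    using assms unfolding is_gradient_def by simp
qed

text \<open>Tangency along lines turns into linear equations in \<open>X\<close>, from which it is
  visible that the tangent space is a linear subspace.\<close>

lemma lie_algebra_iff:
  "X \<in> lie_algebra G \<longleftrightarrow> (\<forall>f D. (\<forall>g\<in>G. mat_eval f g = 0) \<and> is_gradient f D \<longrightarrow> (\<Sum>(i, j)\<in>UNIV. D (i, j) * X $ i $ j) = 0)"
proof
  assume X: "X \<in> lie_algebra G"
  show "\<forall>f D. (\<forall>g\<in>G. mat_eval f g = 0) \<and> is_gradient f D \<longrightarrow> (\<Sum>(i, j)\<in>UNIV. D (i, j) * X $ i $ j) = 0"
  proof (intro allI impI, elim conjE)
    fix f :: "('a \<times> 'a) cpoly" and D assume "\<forall>g\<in>G. mat_eval f g = 0" "is_gradient f D"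
    then show "(\<Sum>(i, j)\<in>UNIV. D (i, j) * X $ i $ j) = 0"
      using X is_gradient_line[of f D X] DERIV_unique unfolding lie_algebra_def by blast
  qed
next
  assume *: "\<forall>f D. (\<forall>g\<in>G. mat_eval f g = 0) \<and> is_gradient f D \<longrightarrow> (\<Sum>(i, j)\<in>UNIV. D (i, j) * X $ i $ j) = 0"
  show "X \<in> lie_algebra G"
    unfolding lie_algebra_def
  proof (intro CollectI allI impI)
    fix f :: "('a \<times> 'a) cpoly" assume f: "\<forall>g\<in>G. mat_eval f g = 0"
    obtain D where D: "is_gradient f D" using is_gradient_exists by blast
    then show "((\<lambda>z. mat_eval f (mat 1 + mat z ** X)) has_field_derivative 0) (at 0)"
      using is_gradient_line[OF D, of X] * f by simp
  qed
qed

text \<open>The curve need not be known to lie in \<open>G\<close>: it suffices that the polynomials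
  vanishing on \<open>G\<close> vanish along it.\<close>

lemma lie_algebra_curve:
  assumes "\<And>i j. ((\<lambda>z. p z $ i $ j) has_field_derivative X $ i $ j) (at 0)" "p 0 = mat 1"
    and "\<And>f z. (\<forall>g\<in>G. mat_eval f g = 0) \<Longrightarrow> mat_eval f (p z) = 0"
  shows "X \<in> lie_algebra G"
  unfolding lie_algebra_iff
proof (intro allI impI, elim conjE)
  fix f :: "('a \<times> 'a) cpoly" and D assume f: "\<forall>g\<in>G. mat_eval f g = 0" "is_gradient f D"
  then have "((\<lambda>z. mat_eval f (p z)) has_field_derivative (\<Sum>(i, j)\<in>UNIV. D (i, j) * X $ i $ j)) (at 0)"
    using assms unfolding is_gradient_def by blast
  moreover have "((\<lambda>z. mat_eval f (p z)) has_field_derivative 0) (at 0)"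
    using assms(3)[OF f(1)] by simp
  ultimately show "(\<Sum>(i, j)\<in>UNIV. D (i, j) * X $ i $ j) = 0" by (rule DERIV_unique)
qed

lemma lie_algebra_scale: "X \<in> lie_algebra G \<Longrightarrow> mat z ** X \<in> lie_algebra G"
  unfolding lie_algebra_iff by (simp add: split_beta mult.left_commute[of _ z] flip: sum_distrib_left)

lemma lie_algebra_diff: "X \<in> lie_algebra G \<Longrightarrow> Y \<in> lie_algebra G \<Longrightarrow> X - Y \<in> lie_algebra G"
  unfolding lie_algebra_iff by (simp add: split_beta right_diff_distrib sum_subtractf)

lemma mat_eval_linear_subst:
  fixes L :: "('n::finite) cmat \<Rightarrow> 'n cmat"
  assumes "\<And>A i j. L A $ i $ j = (\<Sum>k\<in>UNIV. \<Sum>l\<in>UNIV. c i j k l * A $ k $ l)"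
  shows "\<exists>f'. \<forall>A. mat_eval f' A = mat_eval f (L A)"
proof (intro exI allI)
  fix A
  show "mat_eval (psubst f (\<lambda>(i, j). \<Sum>k\<in>UNIV. \<Sum>l\<in>UNIV. pconst (c i j k l) * pvar (k, l))) A = mat_eval f (L A)"
    unfolding mat_eval_def peval_psubst
    by (rule arg_cong[where f = "peval f"]) (simp add: fun_eq_iff assms)
qed

lemma matrix_triple_mult_nth:
  "(A ** X ** B) $ i $ j = (\<Sum>k\<in>UNIV. \<Sum>l\<in>UNIV. A $ i $ k * B $ l $ j * X $ k $ l)"
  for A B X :: "('n::finite) cmat"
proof -
  have "(A ** X ** B) $ i $ j = (\<Sum>l\<in>UNIV. \<Sum>k\<in>UNIV. A $ i $ k * X $ k $ l * B $ l $ j)"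
    by (simp add: matrix_matrix_mult_def sum_distrib_right)
  also have "\<dots> = (\<Sum>k\<in>UNIV. \<Sum>l\<in>UNIV. A $ i $ k * X $ k $ l * B $ l $ j)"
    by (rule sum.swap)
  finally show ?thesis by (simp add: mult_ac)
qed

lemma mat_eval_conj: "\<exists>f'. \<forall>A. mat_eval f' A = mat_eval f (conj_by g A)"
  by (rule mat_eval_linear_subst) (simp add: conj_by_def matrix_triple_mult_nth)

text \<open>Conjugation is linear in the matrix entries, so composing \<open>f\<close> with it gives
  another polynomial, which again vanishes on \<open>G\<close>.\<close>

lemma lie_algebra_conj_by:
  assumes G: "subgroup G GLn" and g: "g \<in> G" and X: "X \<in> lie_algebra G"
  shows "conj_by g X \<in> lie_algebra G"
  unfolding lie_algebra_def
proof (intro CollectI allI impI)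
  fix f :: "('a \<times> 'a) cpoly" assume f: "\<forall>g\<in>G. mat_eval f g = 0"
  obtain f' where f': "\<And>A. mat_eval f' A = mat_eval f (conj_by g A)"
    using mat_eval_conj by metis
  have "\<forall>h\<in>G. mat_eval f' h = 0"
    using f f' G g by (simp add: conj_by_def subgroup_GLn_iff)
  then have "((\<lambda>z. mat_eval f' (mat 1 + mat z ** X)) has_field_derivative 0) (at 0)"
    using X by (simp add: lie_algebra_def)
  moreover have "conj_by g (mat 1 + mat z ** X) = mat 1 + mat z ** conj_by g X" for z
    using G g by (simp add: conj_by_add conj_by_scale subgroup_GLn_iff)
  ultimately show "((\<lambda>z. mat_eval f (mat 1 + mat z ** conj_by g X)) has_field_derivative 0) (at 0)"
    by (simp add: f')
qed

section \<open>Powers and logarithms of unipotent matrices\<close>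

primrec matrix_power :: "('n::finite) cmat \<Rightarrow> nat \<Rightarrow> 'n cmat" where
  "matrix_power X 0 = mat 1"
| "matrix_power X (Suc k) = X ** matrix_power X k"

lemma matrix_power_binomial:
  "matrix_power (mat 1 + X) k = (\<Sum>j\<le>k. mat (of_nat (k choose j)) ** matrix_power X j)"
proof (induction k)
  case (Suc k)
  have "(\<Sum>j\<le>Suc k. mat (of_nat (Suc k choose j)) ** matrix_power X j) =
      mat 1 + (\<Sum>j\<le>k. mat (of_nat (Suc k choose Suc j)) ** matrix_power X (Suc j))"
    by (subst sum.atMost_Suc_shift) simp
  also have "\<dots> = mat 1 + (\<Sum>j\<le>k. mat (of_nat (k choose Suc j)) ** matrix_power X (Suc j)) +
      (\<Sum>j\<le>k. mat (of_nat (k choose j)) ** matrix_power X (Suc j))"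
    by (simp add: mat_add_mult sum.distrib add_ac)
  also have "mat 1 + (\<Sum>j\<le>k. mat (of_nat (k choose Suc j)) ** matrix_power X (Suc j)) =
      (\<Sum>j\<le>Suc k. mat (of_nat (k choose j)) ** matrix_power X j)"
    by (subst sum.atMost_Suc_shift) simp
  also have "\<dots> = matrix_power (mat 1 + X) k"
    by (simp add: Suc binomial_eq_0)
  also have "(\<Sum>j\<le>k. mat (of_nat (k choose j)) ** matrix_power X (Suc j)) = X ** matrix_power (mat 1 + X) k"
    unfolding Suc by (simp add: matrix_mult_sum_right mult_mat_left)
  finally show ?case by (simp add: matrix_mult_add_right)
qed simp

lemma gbinomial_poly: "\<exists>q. \<forall>z::complex. z gchoose j = poly q z"
proof (induction j)
  case 0
  then show ?case by (intro exI[of _ 1]) simp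
next
  case (Suc j)
  then obtain q where q: "\<And>z::complex. z gchoose j = poly q z" by blast
  have "z gchoose Suc j = poly (smult (1 / of_nat (Suc j)) (q * [:- of_nat j, 1:])) z" for z :: complex
  proof -
    have "of_nat (Suc j) * (z gchoose Suc j) = (z gchoose j) * (z - of_nat j)"
      using gbinomial_mult_1[of z j] by (simp add: algebra_simps)
    then show ?thesis by (simp add: q field_simps del: of_nat_Suc)
  qed
  then show ?case by blast
qed

lemma poly_zero_on_nats:
  fixes q :: "complex poly"
  assumes "\<And>k::nat. poly q (of_nat k) = 0"
  shows "q = 0"
proof (rule ccontr)
  assume "q \<noteq> 0"
  then have "finite {z. poly q z = 0}" by (rule poly_roots_finite)
  moreover have "range (of_nat :: nat \<Rightarrow> complex) \<subseteq> {z. poly q z = 0}" using assms by auto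
  ultimately have "finite (range (of_nat :: nat \<Rightarrow> complex))" using finite_subset by blast
  then show False using infinite_UNIV_nat inj_of_nat finite_imageD by blast
qed

lemma mat_eval_poly_curve:
  fixes q :: "'n::finite \<Rightarrow> 'n \<Rightarrow> complex poly"
  shows "\<exists>h. \<forall>z. mat_eval f (\<chi> i j. poly (q i j) z) = poly h z"
proof (intro exI allI)
  fix z
  show "mat_eval f (\<chi> i j. poly (q i j) z) =
    poly (\<Sum>m\<in>Poly_Mapping.keys f. [:Poly_Mapping.lookup f m:] *
       (\<Prod>(i, j)\<in>Poly_Mapping.keys m. q i j ^ Poly_Mapping.lookup m (i, j))) z"
    by (auto simp: mat_eval_def peval_def poly_sum poly_prod split_beta intro!: sum.cong prod.cong)
qed

text \<open>The curve \<open>\<Sum> (z choose j) X^j\<close> takes the values \<open>(1 + X)^k \<in> G\<close> at natural numbers, so every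
  polynomial vanishing on \<open>G\<close> vanishes on the whole curve. Its derivative at \<open>0\<close> is
  \<open>log (1 + X)\<close>, of which only the first two coefficients matter.\<close>

lemma lie_algebra_unipotent:
  fixes X :: "('n::finite) cmat"
  assumes G: "subgroup G GLn" and g: "mat 1 + X \<in> G" and nil: "matrix_power X (Suc n) = 0"
  obtains d where "d 0 = 0" "d 1 = 1" "(\<Sum>j\<le>n. mat (d j) ** matrix_power X j) \<in> lie_algebra G"
proof -
  obtain b where b: "\<And>j (z::complex). z gchoose j = poly (b j) z"
    using gbinomial_poly by metis
  have nil': "matrix_power X j = 0" if "n < j" for j
    using that
  proof (induction j)
    case (Suc j)
    then show ?case using nil by (cases "j = n") auto
  qed simp
  define p where "p z = (\<Sum>j\<le>n. mat (poly (b j) z) ** matrix_power X j)" for z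
  define d where "d j = poly (pderiv (b j)) 0" for j
  have "p 0 = (\<Sum>j\<le>n. if j = 0 then mat 1 else 0)"
    unfolding p_def by (rule sum.cong) (auto simp: gbinomial_0_left b[symmetric])
  then have p0: "p 0 = mat 1" by simp
  have der: "((\<lambda>z. p z $ i $ j) has_field_derivative (\<Sum>j\<le>n. mat (d j) ** matrix_power X j) $ i $ j) (at 0)" for i j
    unfolding p_def d_def sum_component mat_mult_nth
    by (auto intro!: derivative_eq_intros poly_DERIV)
  have pnat: "p (of_nat k) = matrix_power (mat 1 + X) k" for k
  proof -
    have "matrix_power (mat 1 + X) k = (\<Sum>j\<le>max k n. mat (of_nat (k choose j)) ** matrix_power X j)"
      unfolding matrix_power_binomial by (rule sum.mono_neutral_left) (simp_all add: binomial_eq_0)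
    also have "\<dots> = (\<Sum>j\<le>n. mat (of_nat (k choose j)) ** matrix_power X j)"
      by (rule sum.mono_neutral_right) (auto simp: nil')
    finally show ?thesis
      by (simp add: p_def binomial_gbinomial b)
  qed
  have pow: "matrix_power (mat 1 + X) k \<in> G" for k
    by (induction k) (use G g in \<open>auto simp: subgroup_GLn_iff\<close>)
  have "(\<Sum>j\<le>n. mat (d j) ** matrix_power X j) \<in> lie_algebra G"
  proof (rule lie_algebra_curve[OF der p0])
    fix f :: "('n \<times> 'n) cpoly" and z assume f: "\<forall>g\<in>G. mat_eval f g = 0"
    have pz: "p z = (\<chi> i j. poly (\<Sum>l\<le>n. smult (matrix_power X l $ i $ j) (b l)) z)" for z
      by (simp add: vec_eq_iff p_def poly_sum mult.commute)
    obtain h where h: "\<And>z. mat_eval f (p z) = poly h z"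
      using mat_eval_poly_curve[of f "\<lambda>i j. \<Sum>l\<le>n. smult (matrix_power X l $ i $ j) (b l)"]
      unfolding pz by blast
    have "poly h (of_nat k) = 0" for k
      using f pow by (simp add: h[symmetric] pnat)
    then have "h = 0" by (rule poly_zero_on_nats)
    then show "mat_eval f (p z) = 0" by (simp add: h)
  qed
  moreover have "d 0 = 0"
  proof -
    have "poly (b 0) = poly 1" by (simp add: fun_eq_iff b[symmetric])
    then have "b 0 = 1" using poly_eq_poly_eq_iff by blast
    then show ?thesis by (simp add: d_def)
  qed
  moreover have "d 1 = 1"
  proof -
    have "poly (b 1) = poly [:0, 1:]" by (simp add: fun_eq_iff b[symmetric])
    then have "b 1 = [:0, 1:]" using poly_eq_poly_eq_iff by blast
    then show ?thesis by (simp add: d_def pderiv_pCons)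
  qed
  ultimately show thesis using that by blast
qed

lemma power_int_prod: "(\<Prod>i\<in>I. f i) powi k = (\<Prod>i\<in>I. f i powi k)" for f :: "'i \<Rightarrow> complex"
  by (induction I rule: infinite_finite_induct) (auto simp: power_int_mult_distrib)

lemma characters_nonzero: "c \<in> characters T \<Longrightarrow> t \<in> T \<Longrightarrow> c t \<noteq> 0"
  and characters_mult: "c \<in> characters T \<Longrightarrow> t \<in> T \<Longrightarrow> u \<in> T \<Longrightarrow> c (t ** u) = c t * c u"
  and characters_ext: "c \<in> characters T \<Longrightarrow> c \<in> extensional T"
  by (auto simp: characters_def)

locale pinned =
  fixes Q :: "('n::finite) pinned_group"
  assumes pinned: "pinned_semisimple_adjoint_group Q"
begin

abbreviation "G \<equiv> Grp Q"
abbreviation "T \<equiv> Tor Q"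
abbreviation "S \<equiv> Simp Q"

lemma subgroup_G: "subgroup G GLn"
  using pinned by (simp add: pinned_semisimple_adjoint_group_def semisimple_group_def linear_algebraic_group_def)

lemma torus_T: "torus T" and T_subset_G: "T \<subseteq> G"
  using pinned by (simp_all add: pinned_semisimple_adjoint_group_def maximal_torus_def)

lemma subgroup_T: "subgroup T GLn"
  using torus_T by (simp add: torus_def linear_algebraic_group_def)

lemma G_one: "mat 1 \<in> G" and G_invertible: "g \<in> G \<Longrightarrow> invertible g"
  and G_inv: "g \<in> G \<Longrightarrow> matrix_inv g \<in> G" and G_mult: "g \<in> G \<Longrightarrow> h \<in> G \<Longrightarrow> g ** h \<in> G"
  using subgroup_G by (auto simp: subgroup_GLn_iff)

lemma T_one: "mat 1 \<in> T" and T_invertible: "t \<in> T \<Longrightarrow> invertible t"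
  and T_inv: "t \<in> T \<Longrightarrow> matrix_inv t \<in> T" and T_mult: "t \<in> T \<Longrightarrow> u \<in> T \<Longrightarrow> t ** u \<in> T"
  using subgroup_T by (auto simp: subgroup_GLn_iff)

subsection \<open>Diagonalisation of the torus\<close>

definition eigenbasis :: "'n cmat" where
  "eigenbasis = (SOME P. invertible P \<and> (\<forall>t\<in>T. \<forall>i j. i \<noteq> j \<longrightarrow> (matrix_inv P ** t ** P) $ i $ j = 0))"

lemma eigenbasis: "invertible eigenbasis"
  "t \<in> T \<Longrightarrow> i \<noteq> j \<Longrightarrow> (matrix_inv eigenbasis ** t ** eigenbasis) $ i $ j = 0"
proof -
  have "\<exists>P :: 'n cmat. invertible P \<and> (\<forall>t\<in>T. \<forall>i j. i \<noteq> j \<longrightarrow> (matrix_inv P ** t ** P) $ i $ j = 0)"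
    using torus_T by (simp add: torus_def)
  then have "invertible eigenbasis \<and> (\<forall>t\<in>T. \<forall>i j. i \<noteq> j \<longrightarrow> (matrix_inv eigenbasis ** t ** eigenbasis) $ i $ j = 0)"
    unfolding eigenbasis_def by (rule someI_ex)
  then show "invertible eigenbasis"
    "t \<in> T \<Longrightarrow> i \<noteq> j \<Longrightarrow> (matrix_inv eigenbasis ** t ** eigenbasis) $ i $ j = 0" by auto
qed

definition eigenvalue :: "'n \<Rightarrow> 'n cmat \<Rightarrow> complex" where
  "eigenvalue i t = (matrix_inv eigenbasis ** t ** eigenbasis) $ i $ i"

text \<open>The constant weight 0 is provisional: only the entries in the eigenbasis are used, and
  the true weights can be defined only once characters have been identified with lattice
  points.\<close>

interpretation pre: graded_matrices eigenbasis "\<lambda>_. 0 :: int"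
  by unfold_locales (rule eigenbasis)

lemma ent_torus: "t \<in> T \<Longrightarrow> pre.ent t i j = (if i = j then eigenvalue i t else 0)"
  by (simp add: pre.ent_def eigenvalue_def eigenbasis)

lemma ent_torus_left: "t \<in> T \<Longrightarrow> pre.ent (t ** X) i j = eigenvalue i t * pre.ent X i j"
  by (simp add: pre.ent_mult ent_torus if_distrib[of "\<lambda>x. x * _"] cong: if_cong)

lemma ent_torus_right: "t \<in> T \<Longrightarrow> pre.ent (X ** t) i j = pre.ent X i j * eigenvalue j t"
  by (simp add: pre.ent_mult ent_torus if_distrib[of "\<lambda>x. _ * x"] cong: if_cong)

lemma eigenvalue_mult: "t \<in> T \<Longrightarrow> u \<in> T \<Longrightarrow> eigenvalue i (t ** u) = eigenvalue i t * eigenvalue i u"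
  using ent_torus_left[of t u i i] ent_torus[of u i i] ent_torus[of "t ** u" i i] T_mult by simp

lemma eigenvalue_one: "eigenvalue i (mat 1) = 1"
  using ent_torus[OF T_one, of i i] by (simp add: pre.ent_one)

lemma eigenvalue_nonzero: "t \<in> T \<Longrightarrow> eigenvalue i t \<noteq> 0"
  using eigenvalue_mult[of t "matrix_inv t" i] T_inv by (auto simp: matrix_inv_right T_invertible eigenvalue_one)

lemma T_commute: "t \<in> T \<Longrightarrow> u \<in> T \<Longrightarrow> t ** u = u ** t"
  by (rule pre.ent_eqI) (simp add: ent_torus_left ent_torus_right ent_torus)

lemma ent_conj_torus:
  assumes t: "t \<in> T"
  shows "pre.ent (conj_by t X) i j = eigenvalue i t / eigenvalue j t * pre.ent X i j"
proof -
  have "pre.ent (conj_by t X ** t) i j = pre.ent (t ** X) i j"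
    using t by (simp add: conj_by_def matrix_inv_cancel T_invertible)
  then have "pre.ent (conj_by t X) i j * eigenvalue j t = eigenvalue i t * pre.ent X i j"
    using t by (simp add: ent_torus_left ent_torus_right)
  then show ?thesis using eigenvalue_nonzero[OF t] by (simp add: field_simps)
qed

lemma eigenvalue_poly: "\<exists>f. \<forall>A. mat_eval f A = (matrix_inv eigenbasis ** A ** eigenbasis) $ i $ i"
proof (intro exI allI)
  fix A
  show "mat_eval (\<Sum>k\<in>UNIV. \<Sum>l\<in>UNIV. pconst (matrix_inv eigenbasis $ i $ k * eigenbasis $ l $ i) * pvar (k, l)) A =
     (matrix_inv eigenbasis ** A ** eigenbasis) $ i $ i"
    by (simp add: mat_eval_def matrix_triple_mult_nth)
qed

lemma eigenvalue_character: "restrict (eigenvalue i) T \<in> characters T"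
proof -
  obtain f where "\<And>A. mat_eval f A = (matrix_inv eigenbasis ** A ** eigenbasis) $ i $ i"
    using eigenvalue_poly by blast
  then have "\<forall>t\<in>T. restrict (eigenvalue i) T t = mat_eval f t / det t ^ 0"
    by (simp add: eigenvalue_def)
  moreover have "restrict (eigenvalue i) T (t ** u) = restrict (eigenvalue i) T t * restrict (eigenvalue i) T u"
    if "t \<in> T" "u \<in> T" for t u
    using that by (simp add: eigenvalue_mult T_mult)
  ultimately show ?thesis
    unfolding characters_def by (auto simp: eigenvalue_nonzero intro!: exI[of _ f] exI[of _ "0::nat"])
qed

lemma det_torus:
  assumes t: "t \<in> T"
  shows "det t = (\<Prod>k\<in>UNIV. eigenvalue k t)"
proof -
  have "det (matrix_inv eigenbasis ** t ** eigenbasis) = det (matrix_inv eigenbasis ** eigenbasis) * det t"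
    by (simp add: det_mul)
  then have "det t = det (matrix_inv eigenbasis ** t ** eigenbasis)"
    by (simp add: matrix_inv_left eigenbasis)
  also have "\<dots> = (\<Prod>k\<in>UNIV. eigenvalue k t)"
    using eigenbasis(2)[OF t] by (subst det_diagonal) (auto simp: eigenvalue_def)
  finally show ?thesis .
qed

text \<open>Division by an eigenvalue is regular on \<open>T\<close> because the determinant is the
  product of all eigenvalues; one factor \<open>det t\<close> in the denominator is enough.\<close>

lemma eigenvalue_quotient_character: "(\<lambda>t\<in>T. eigenvalue i t / eigenvalue j t) \<in> characters T"
proof -
  obtain f where f: "\<And>i A. mat_eval (f i) A = (matrix_inv eigenbasis ** A ** eigenbasis) $ i $ i"
    using eigenvalue_poly by metis
  let ?f = "f i * (\<Prod>k\<in>UNIV - {j}. f k)"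
  have "eigenvalue i t / eigenvalue j t = mat_eval ?f t / det t ^ 1" if t: "t \<in> T" for t
  proof -
    have "mat_eval ?f t = eigenvalue i t * (\<Prod>k\<in>UNIV - {j}. eigenvalue k t)"
      using f by (simp add: mat_eval_def eigenvalue_def)
    moreover have "det t = eigenvalue j t * (\<Prod>k\<in>UNIV - {j}. eigenvalue k t)"
      using t by (simp add: det_torus prod.remove[of UNIV j])
    moreover have "(\<Prod>k\<in>UNIV - {j}. eigenvalue k t) \<noteq> 0"
      using t by (simp add: eigenvalue_nonzero)
    ultimately show ?thesis by simp
  qed
  then have "\<exists>f k. \<forall>t\<in>T. (\<lambda>t\<in>T. eigenvalue i t / eigenvalue j t) t = mat_eval f t / det t ^ k"
    by (intro exI[of _ ?f] exI[of _ "1::nat"]) simp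
  moreover have "\<forall>t\<in>T. \<forall>u\<in>T. (\<lambda>t\<in>T. eigenvalue i t / eigenvalue j t) (t ** u) =
      (\<lambda>t\<in>T. eigenvalue i t / eigenvalue j t) t * (\<lambda>t\<in>T. eigenvalue i t / eigenvalue j t) u"
    by (simp add: eigenvalue_mult T_mult)
  ultimately show ?thesis
    unfolding characters_def by (simp add: eigenvalue_nonzero)
qed

subsection \<open>The weight lattice\<close>

lemma root_base: "root_base G T S" and adjoint: "adjoint_type G T"
  using pinned by (simp_all add: pinned_semisimple_adjoint_group_def)

lemma S_subset_Roots: "S \<subseteq> Roots Q"
  using root_base by (simp add: root_base_def Roots_def)

lemma Roots_character: "c \<in> Roots Q \<Longrightarrow> c \<in> characters T"
  by (simp add: Roots_def root_set_def)

text \<open>The weight of a root vector can be read off at any nonzero entry in the eigenbasis.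
  Finiteness of the set of roots follows.\<close>

lemma root_is_quotient:
  assumes "c \<in> Roots Q"
  shows "\<exists>i j. c = (\<lambda>t\<in>T. eigenvalue i t / eigenvalue j t)"
proof -
  have "0 \<in> root_space G T c"
    by (auto simp: root_space_def lie_algebra_iff)
  then obtain X where X: "X \<in> root_space G T c" "X \<noteq> 0"
    using assms unfolding Roots_def root_set_def by blast
  then obtain i j where ij: "pre.ent X i j \<noteq> 0"
    using pre.ent_eqI[of X 0] by auto
  have "c t = eigenvalue i t / eigenvalue j t" if t: "t \<in> T" for t
  proof -
    have "conj_by t X = mat (c t) ** X"
      using X t by (simp add: root_space_def conj_by_def)
    then have "pre.ent (conj_by t X) i j = c t * pre.ent X i j" by simp
    then have "eigenvalue i t / eigenvalue j t * pre.ent X i j = c t * pre.ent X i j"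
      by (simp only: ent_conj_torus[OF t])
    then show ?thesis using ij by (metis mult_right_cancel)
  qed
  moreover have "c \<in> extensional T" using Roots_character assms characters_ext by blast
  ultimately have "c = (\<lambda>t\<in>T. eigenvalue i t / eigenvalue j t)"
    by (auto simp: fun_eq_iff extensional_def restrict_def)
  then show ?thesis by blast
qed

lemma finite_Roots: "finite (Roots Q)"
proof -
  have "Roots Q \<subseteq> (\<lambda>(i, j). \<lambda>t\<in>T. eigenvalue i t / eigenvalue j t) ` UNIV"
    using root_is_quotient by fastforce
  then show ?thesis by (rule finite_subset) simp
qed

lemma finite_S: "finite S"
  using S_subset_Roots finite_Roots finite_subset by blast

lemma S_character: "c \<in> S \<Longrightarrow> c \<in> characters T"
  using S_subset_Roots Roots_character by blast

text \<open>The character group in additive notation: finitely supported integer functions with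
  support in the simple roots. \<open>chi\<close> leads back to the multiplicative notation.\<close>

definition Lat :: "('n character \<Rightarrow>\<^sub>0 int) set" where
  "Lat = {m. Poly_Mapping.keys m \<subseteq> S}"

definition chi :: "('n character \<Rightarrow>\<^sub>0 int) \<Rightarrow> 'n character" where
  "chi m = char_comb T S (Poly_Mapping.lookup m)"

lemma Lat_zero [simp]: "0 \<in> Lat"
  by (simp add: Lat_def)

lemma Lat_add: "m \<in> Lat \<Longrightarrow> n \<in> Lat \<Longrightarrow> m + n \<in> Lat"
  unfolding Lat_def using keys_add[of m n] by auto

lemma Lat_uminus: "m \<in> Lat \<Longrightarrow> - m \<in> Lat"
  by (simp add: Lat_def)

lemma Lat_diff: "m \<in> Lat \<Longrightarrow> n \<in> Lat \<Longrightarrow> m - n \<in> Lat"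
  unfolding Lat_def using keys_diff[of m n] by auto

lemma Lat_cmul: "m \<in> Lat \<Longrightarrow> frag_cmul k m \<in> Lat"
  unfolding Lat_def using keys_cmul[of k m] by auto

lemma Lat_frag_of: "c \<in> S \<Longrightarrow> frag_of c \<in> Lat"
  by (simp add: Lat_def)

lemma Lat_sum: "(\<And>i. i \<in> I \<Longrightarrow> f i \<in> Lat) \<Longrightarrow> (\<Sum>i\<in>I. f i) \<in> Lat"
  by (induction I rule: infinite_finite_induct) (auto intro: Lat_add)

lemma chi_apply: "t \<in> T \<Longrightarrow> chi m t = (\<Prod>c\<in>S. c t powi Poly_Mapping.lookup m c)"
  by (simp add: chi_def char_comb_def)

lemma chi_ext: "chi m \<in> extensional T"
  by (simp add: chi_def char_comb_def)

lemma chi_zero: "t \<in> T \<Longrightarrow> chi 0 t = 1"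
  by (simp add: chi_apply)

lemma chi_nonzero: "t \<in> T \<Longrightarrow> chi m t \<noteq> 0"
  by (simp add: chi_apply finite_S characters_nonzero[OF S_character])

lemma chi_add: "t \<in> T \<Longrightarrow> chi (m + n) t = chi m t * chi n t"
  by (simp add: chi_apply lookup_add power_int_add characters_nonzero[OF S_character] prod.distrib)

lemma chi_uminus: "t \<in> T \<Longrightarrow> chi (- m) t = inverse (chi m t)"
  using chi_add[of t m "- m"] by (simp add: chi_zero inverse_unique)

lemma chi_diff: "t \<in> T \<Longrightarrow> chi (m - n) t = chi m t / chi n t"
  using chi_add[of t m "- n"] by (simp add: chi_uminus divide_inverse)

lemma chi_cmul: "t \<in> T \<Longrightarrow> chi (frag_cmul k m) t = chi m t powi k"
  by (simp add: chi_apply power_int_prod mult.commute[of k] power_int_mult)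

lemma chi_sum: "t \<in> T \<Longrightarrow> chi (\<Sum>i\<in>I. f i) t = (\<Prod>i\<in>I. chi (f i) t)"
  by (induction I rule: infinite_finite_induct) (simp_all add: chi_zero chi_add)

lemma chi_frag_of: "c \<in> S \<Longrightarrow> chi (frag_of c) = c"
proof
  fix t assume c: "c \<in> S"
  show "chi (frag_of c) t = c t"
  proof (cases "t \<in> T")
    case True
    have "chi (frag_of c) t = (\<Prod>d\<in>S. if d = c then d t else 1)"
      unfolding chi_apply[OF True] by (rule prod.cong) (auto simp: lookup_single when_def)
    then show ?thesis using c finite_S by simp
  next
    case False
    then show ?thesis using chi_ext characters_ext[OF S_character[OF c]] by (simp add: extensional_def)
  qed
qed

lemma chi_eqI: "(\<And>t. t \<in> T \<Longrightarrow> chi m t = c t) \<Longrightarrow> c \<in> extensional T \<Longrightarrow> chi m = c"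
  by (rule extensionalityI[OF chi_ext])

lemma chi_inj:
  assumes "m \<in> Lat" "n \<in> Lat" "chi m = chi n"
  shows "m = n"
proof -
  have "chi (m - n) = (\<lambda>t\<in>T. 1)"
    by (rule chi_eqI) (simp_all add: chi_diff assms chi_nonzero)
  then have "\<forall>c\<in>S. Poly_Mapping.lookup (m - n) c = 0"
    using root_base unfolding root_base_def chi_def by blast
  moreover have "Poly_Mapping.lookup (m - n) c = 0" if "c \<notin> S" for c
    using that Lat_diff[OF assms(1,2)] by (auto simp: Lat_def in_keys_iff)
  ultimately have "m - n = 0" by (intro poly_mapping_eqI) auto
  then show ?thesis by simp
qed

definition lattice_of :: "('n character \<Rightarrow> int) \<Rightarrow> ('n character \<Rightarrow>\<^sub>0 int)" where
  "lattice_of k = (\<Sum>c\<in>S. frag_cmul (k c) (frag_of c))"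

lemma lattice_of_Lat: "lattice_of k \<in> Lat"
  unfolding lattice_of_def by (intro Lat_sum Lat_cmul Lat_frag_of)

lemma lookup_lattice_of: "Poly_Mapping.lookup (lattice_of k) c = (if c \<in> S then k c else 0)"
  using finite_S by (simp add: lattice_of_def lookup_sum lookup_single when_def if_distrib[of "\<lambda>x. _ * x"] cong: if_cong)

lemma chi_lattice_of: "chi (lattice_of k) = char_comb T S k"
  unfolding chi_def char_comb_def by (auto simp: lookup_lattice_of intro!: restrict_ext prod.cong)

lemma root_in_Lat: "c \<in> Roots Q \<Longrightarrow> \<exists>m\<in>Lat. chi m = c"
  using root_base lattice_of_Lat chi_lattice_of unfolding root_base_def Roots_def by metis

text \<open>Adjoint type enters here: a character is a combination of roots, and each root is a
  combination of simple roots. Together with \<open>chi_inj\<close> this identifies the character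
  group with \<open>Lat\<close>.\<close>

lemma character_in_Lat:
  assumes "c \<in> characters T"
  shows "\<exists>m\<in>Lat. chi m = c"
proof -
  obtain k where k: "c = char_comb T (Roots Q) k"
    using adjoint assms by (auto simp: adjoint_type_def Roots_def)
  obtain l where l: "\<And>d. d \<in> Roots Q \<Longrightarrow> l d \<in> Lat \<and> chi (l d) = d"
    using root_in_Lat by metis
  have "chi (\<Sum>d\<in>Roots Q. frag_cmul (k d) (l d)) = c"
    by (rule chi_eqI) (auto simp: k char_comb_def chi_sum chi_cmul l intro!: prod.cong)
  moreover have "(\<Sum>d\<in>Roots Q. frag_cmul (k d) (l d)) \<in> Lat"
    by (intro Lat_sum Lat_cmul) (simp add: l)
  ultimately show ?thesis by blast
qed

definition crd :: "'n character \<Rightarrow> ('n character \<Rightarrow>\<^sub>0 int)" where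
  "crd c = (THE m. m \<in> Lat \<and> chi m = c)"

lemma crd_chi: "m \<in> Lat \<Longrightarrow> crd (chi m) = m"
  unfolding crd_def by (rule the_equality) (auto intro: chi_inj)

lemma crd_Lat: "c \<in> characters T \<Longrightarrow> crd c \<in> Lat"
  and chi_crd: "c \<in> characters T \<Longrightarrow> chi (crd c) = c"
  using character_in_Lat crd_chi by force+

definition weight :: "'n \<Rightarrow> ('n character \<Rightarrow>\<^sub>0 int)" where
  "weight i = crd (restrict (eigenvalue i) T)"

lemma weight_Lat: "weight i \<in> Lat"
  unfolding weight_def by (intro crd_Lat eigenvalue_character)

lemma eigenvalue_chi: "t \<in> T \<Longrightarrow> eigenvalue i t = chi (weight i) t"
  unfolding weight_def by (subst chi_crd[OF eigenvalue_character]) simp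

text \<open>The grading used from now on: for \<open>c\<close> in \<open>Lat\<close>, the component
  \<open>c\<close> is the part of weight \<open>c\<close> under conjugation by the torus, as
  \<open>deg_in_weight_iff\<close> shows.\<close>

sublocale graded_matrices eigenbasis weight
  by unfold_locales (rule eigenbasis)

lemma degrees_Lat: "c \<in> degrees \<Longrightarrow> c \<in> Lat"
  by (auto simp: degrees_def intro: Lat_diff weight_Lat)

lemma degrees_character:
  assumes "c \<in> degrees"
  shows "chi c \<in> characters T"
proof -
  obtain i j where c: "c = weight i - weight j" using assms by (auto simp: degrees_def)
  have "chi c = (\<lambda>t\<in>T. eigenvalue i t / eigenvalue j t)"
    by (rule chi_eqI) (simp_all add: c chi_diff eigenvalue_chi)
  then show ?thesis using eigenvalue_quotient_character by simp
qed

lemma ent_conj_by: "t \<in> T \<Longrightarrow> ent (conj_by t X) i j = chi (weight i - weight j) t * ent X i j"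
  using ent_conj_torus by (simp add: chi_diff eigenvalue_chi)

lemma component_conj_by: "t \<in> T \<Longrightarrow> component c (conj_by t X) = mat (chi c t) ** component c X"
  by (rule ent_eqI) (simp add: ent_component ent_conj_by)

lemma deg_in_weight_iff:
  assumes "m \<in> Lat"
  shows "deg_in {m} X \<longleftrightarrow> (\<forall>t\<in>T. conj_by t X = mat (chi m t) ** X)"
proof
  assume X: "deg_in {m} X"
  show "\<forall>t\<in>T. conj_by t X = mat (chi m t) ** X"
  proof
    fix t assume "t \<in> T"
    then show "conj_by t X = mat (chi m t) ** X"
      using X by (intro ent_eqI) (auto simp: ent_conj_by deg_in_def)
  qed
next
  assume *: "\<forall>t\<in>T. conj_by t X = mat (chi m t) ** X"
  show "deg_in {m} X"
    unfolding deg_in_def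
  proof (intro allI impI)
    fix i j assume "ent X i j \<noteq> 0"
    then have "chi (weight i - weight j) t = chi m t" if "t \<in> T" for t
      using that * ent_conj_by[OF that, of X i j] by simp
    then have "chi (weight i - weight j) = chi m"
      by (intro chi_eqI chi_ext) auto
    then show "weight i - weight j \<in> {m}"
      using chi_inj assms weight_Lat Lat_diff by blast
  qed
qed

lemma separate_weights:
  assumes "c \<in> Lat" "d \<in> Lat" "c \<noteq> d"
  obtains t where "t \<in> T" "chi c t \<noteq> chi d t"
  using chi_inj[OF assms(1,2)] chi_eqI[of c "chi d"] chi_ext assms(3) by blast

lemma deg_in_torus: "t \<in> T \<Longrightarrow> deg_in {0} t"
  by (subst deg_in_weight_iff)
    (auto simp: chi_zero conj_by_def T_commute[of _ t] T_inv matrix_inv_cancel T_invertible)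

subsection \<open>The Lie algebra\<close>

abbreviation "LA \<equiv> lie_algebra G"

text \<open>The Lie algebra is stable under the torus, so weights other than \<open>m\<close> can be
  removed one at a time by operators \<open>Ad(t) - chi d t\<close>; the induction is on the number
  of nonzero components.\<close>

lemma component_LA:
  assumes "X \<in> LA"
  shows "component m X \<in> LA"
  using assms
proof (induction "card {c \<in> degrees. component c X \<noteq> 0}" arbitrary: X rule: less_induct)
  case less
  let ?K = "\<lambda>X. {c \<in> degrees. component c X \<noteq> 0}"
  show ?case
  proof (cases "?K X \<subseteq> {m}")
    case True
    show ?thesis
    proof (cases "component m X = 0")
      case True
      then show ?thesis using lie_algebra_scale[OF less.prems, of 0] by simp
    next
      case False
      then have "m \<in> degrees" using component_eq_0_outside by blast
      then have "(\<Sum>c\<in>degrees. component c X) = (\<Sum>c\<in>{m}. component c X)"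
        using True by (intro sum.mono_neutral_right) (auto simp: finite_degrees)
      then show ?thesis using less.prems by (simp add: sum_components)
    qed
  next
    case False
    then obtain d where d: "d \<in> degrees" "component d X \<noteq> 0" "d \<noteq> m" by blast
    show ?thesis
    proof (cases "m \<in> degrees")
      case True
      obtain t where t: "t \<in> T" "chi m t \<noteq> chi d t"
        using separate_weights[of m d] True d degrees_Lat by metis
      \<comment> \<open>The factor normalises the operator so that it fixes the component
        \<open>m\<close>; the component \<open>d\<close> is killed.\<close>
      let ?z = "inverse (chi m t - chi d t)"
      let ?Y = "mat ?z ** (conj_by t X - mat (chi d t) ** X)"
      have Y: "?Y \<in> LA"
        using less.prems t T_subset_G
        by (intro lie_algebra_scale lie_algebra_diff lie_algebra_conj_by[OF subgroup_G]) auto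
      have comp: "component c ?Y = mat (?z * (chi c t - chi d t)) ** component c X" for c
        using t by (intro ent_eqI) (simp add: component_scale component_diff component_conj_by algebra_simps)
      have "?K ?Y \<subset> ?K X"
      proof
        show "?K ?Y \<subseteq> ?K X" unfolding comp by auto
        show "?K ?Y \<noteq> ?K X" using d comp[of d] by auto
      qed
      then have "card (?K ?Y) < card (?K X)"
        by (intro psubset_card_mono) (simp_all add: finite_degrees)
      then have "component m ?Y \<in> LA" using less.hyps Y by blast
      then show ?thesis using comp[of m] t by simp
    next
      case False
      then show ?thesis using lie_algebra_scale[OF less.prems, of 0] component_eq_0_outside by simp
    qed
  qed
qed

definition \<Phi> :: "('n character \<Rightarrow>\<^sub>0 int) set" where
  "\<Phi> = {a \<in> Lat. chi a \<in> Roots Q}"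

lemma Phi_Lat: "a \<in> \<Phi> \<Longrightarrow> a \<in> Lat"
  by (simp add: \<Phi>_def)

lemma Roots_eq: "Roots Q = chi ` \<Phi>"
  using root_in_Lat by (auto simp: \<Phi>_def)

lemma inj_chi: "inj_on chi Lat"
  by (rule inj_onI) (rule chi_inj)

lemma finite_Phi: "finite \<Phi>"
  using finite_Roots inj_on_subset[OF inj_chi] finite_imageD unfolding Roots_eq by (metis Phi_Lat subsetI)

lemma zero_notin_Phi: "0 \<notin> \<Phi>"
proof
  assume "0 \<in> \<Phi>"
  moreover have "chi 0 = (\<lambda>t\<in>T. 1)" by (rule chi_eqI) (simp_all add: chi_zero)
  ultimately show False by (simp add: \<Phi>_def Roots_def root_set_def)
qed

lemma simple_in_Phi: "c \<in> S \<Longrightarrow> frag_of c \<in> \<Phi>"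
  using S_subset_Roots by (auto simp: \<Phi>_def chi_frag_of Lat_frag_of)

lemma Phi_sign:
  assumes "a \<in> \<Phi>"
  shows "dominant a \<or> dominant (- a)"
proof -
  obtain k where k: "chi a = char_comb T S k" "(\<forall>d\<in>S. 0 \<le> k d) \<or> (\<forall>d\<in>S. k d \<le> 0)"
    using assms root_base by (auto simp: \<Phi>_def root_base_def Roots_def)
  then have "a = lattice_of k"
    using chi_inj lattice_of_Lat chi_lattice_of assms by (metis Phi_Lat)
  then show ?thesis using k(2) by (auto simp: dominant_def lookup_lattice_of)
qed

subsection \<open>Root homomorphisms\<close>

abbreviation u :: "('n character \<Rightarrow>\<^sub>0 int) \<Rightarrow> complex \<Rightarrow> 'n cmat" where
  "u a \<equiv> rhom Q (chi a)"

definition E :: "('n character \<Rightarrow>\<^sub>0 int) \<Rightarrow> 'n cmat" where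
  "E a = (\<chi> i j. deriv (\<lambda>x. u a x $ i $ j) 0)"

lemma root_hom_u: "a \<in> \<Phi> \<Longrightarrow> root_hom G T (chi a) (u a)"
  using pinned by (simp add: pinned_semisimple_adjoint_group_def \<Phi>_def)

lemma u_G: "a \<in> \<Phi> \<Longrightarrow> u a x \<in> G" and u_add: "a \<in> \<Phi> \<Longrightarrow> u a (x + y) = u a x ** u a y"
  and u_torus: "a \<in> \<Phi> \<Longrightarrow> t \<in> T \<Longrightarrow> conj_by t (u a x) = u a (chi a t * x)"
  and E_nonzero: "a \<in> \<Phi> \<Longrightarrow> E a \<noteq> 0"
  and root_space_E: "a \<in> \<Phi> \<Longrightarrow> root_space G T (chi a) = range (\<lambda>z. mat z ** E a)"
  using root_hom_u[of a] by (auto simp: root_hom_def E_def Let_def conj_by_def)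

definition upoly :: "('n character \<Rightarrow>\<^sub>0 int) \<Rightarrow> 'n \<Rightarrow> 'n \<Rightarrow> complex poly" where
  "upoly a i j = (SOME q. \<forall>x. u a x $ i $ j = poly q x)"

lemma upoly: "a \<in> \<Phi> \<Longrightarrow> u a x $ i $ j = poly (upoly a i j) x"
  using root_hom_u[of a] someI_ex[of "\<lambda>q. \<forall>x. u a x $ i $ j = poly q x"]
  unfolding root_hom_def upoly_def by blast

text \<open>Coefficient of \<open>x ^ k\<close> in \<open>u a x\<close>: the divided power
  \<open>E^k / k!\<close> of the root vector, as \<open>U_zero\<close> and \<open>U_Suc\<close>
  show.\<close>

definition U :: "('n character \<Rightarrow>\<^sub>0 int) \<Rightarrow> nat \<Rightarrow> 'n cmat" where
  "U a k = (\<chi> i j. coeff (upoly a i j) k)"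

definition udeg :: "('n character \<Rightarrow>\<^sub>0 int) \<Rightarrow> nat" where
  "udeg a = Max (range (\<lambda>(i, j). degree (upoly a i j)))"

lemma degree_upoly: "degree (upoly a i j) \<le> udeg a"
  unfolding udeg_def by (rule Max_ge) (auto intro: image_eqI[of _ _ "(i, j)"])

lemma u_expand:
  assumes "a \<in> \<Phi>" "udeg a \<le> N"
  shows "u a x = (\<Sum>k\<le>N. mat (x ^ k) ** U a k)"
  unfolding vec_eq_iff
proof (intro allI)
  fix i j
  have "u a x $ i $ j = (\<Sum>k\<le>degree (upoly a i j). coeff (upoly a i j) k * x ^ k)"
    unfolding upoly[OF assms(1)] by (rule poly_altdef)
  also have "\<dots> = (\<Sum>k\<le>N. coeff (upoly a i j) k * x ^ k)"
    using order_trans[OF degree_upoly assms(2)]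
    by (intro sum.mono_neutral_left) (auto simp: coeff_eq_0 intro: order_trans)
  finally have "u a x $ i $ j = (\<Sum>k\<le>N. coeff (upoly a i j) k * x ^ k)" .
  then show "u a x $ i $ j = (\<Sum>k\<le>N. mat (x ^ k) ** U a k) $ i $ j"
    by (simp add: U_def mult.commute)
qed

lemma u_zero: "a \<in> \<Phi> \<Longrightarrow> u a 0 = mat 1"
  using u_add[of a 0 0] matrix_inv_cancel(2)[OF G_invertible[OF u_G], of a 0 "u a 0"]
  by (simp add: matrix_inv_left G_invertible u_G)

lemma u_inverse: "a \<in> \<Phi> \<Longrightarrow> matrix_inv (u a x) = u a (- x)"
  using u_add[of a x "- x"] by (intro matrix_inv_unique) (simp add: u_zero)

lemma U_zero: "a \<in> \<Phi> \<Longrightarrow> U a 0 = mat 1"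
  using u_zero[of a] by (simp add: U_def vec_eq_iff upoly poly_0_coeff_0)

lemma deriv_u:
  assumes "a \<in> \<Phi>"
  shows "((\<lambda>x. u a x $ i $ j) has_field_derivative poly (pderiv (upoly a i j)) x) (at x)"
  using assms by (simp add: upoly poly_DERIV)

lemma U_one: "a \<in> \<Phi> \<Longrightarrow> U a 1 = E a"
  using deriv_u[THEN DERIV_imp_deriv, of a _ _ 0]
  by (simp add: U_def E_def vec_eq_iff poly_0_coeff_0 coeff_pderiv)

text \<open>Coefficients of \<open>x ^ k\<close> are compared in the torus equivariance of
  \<open>u a\<close>; this gives \<open>U a k\<close> the weight \<open>k\<close> times
  \<open>a\<close>.\<close>

lemma U_conj:
  assumes "a \<in> \<Phi>" "t \<in> T"
  shows "conj_by t (U a k) = mat (chi a t ^ k) ** U a k"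
  unfolding vec_eq_iff
proof (intro allI)
  fix i j
  let ?q = "\<Sum>l\<in>UNIV. \<Sum>m\<in>UNIV. smult (t $ i $ l * matrix_inv t $ m $ j) (upoly a l m)"
  have "poly ?q x = poly (pcompose (upoly a i j) [:0, chi a t:]) x" for x
  proof -
    have "poly ?q x = conj_by t (u a x) $ i $ j"
      by (simp add: conj_by_def matrix_triple_mult_nth poly_sum upoly assms)
    then show ?thesis by (simp add: u_torus assms upoly poly_pcompose mult.commute)
  qed
  then have "?q = pcompose (upoly a i j) [:0, chi a t:]"
    by (simp add: poly_eq_poly_eq_iff[symmetric] fun_eq_iff)
  then have "coeff ?q k = chi a t ^ k * coeff (upoly a i j) k"
    by (simp add: coeff_pcompose_linear)
  then show "conj_by t (U a k) $ i $ j = (mat (chi a t ^ k) ** U a k) $ i $ j"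
    by (simp add: conj_by_def matrix_triple_mult_nth U_def coeff_sum)
qed

lemma deg_in_U:
  assumes "a \<in> \<Phi>"
  shows "deg_in {frag_cmul (int k) a} (U a k)"
  by (subst deg_in_weight_iff) (simp_all add: Lat_cmul Phi_Lat assms U_conj chi_cmul)

lemma deg_in_E: "a \<in> \<Phi> \<Longrightarrow> deg_in {a} (E a)"
  using deg_in_U[of a 1] U_one[of a] by simp

text \<open>The homomorphism property of \<open>u a\<close> is differentiated at
  \<open>h = 0\<close> in \<open>u a (h + y)\<close> and in \<open>u a (y + h)\<close>; then
  coefficients of powers of \<open>y\<close> are compared.\<close>

lemma U_Suc:
  assumes "a \<in> \<Phi>"
  shows "mat (of_nat (Suc k)) ** U a (Suc k) = E a ** U a k"
    and "mat (of_nat (Suc k)) ** U a (Suc k) = U a k ** E a"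
proof -
  have E: "E a $ i $ j = poly (pderiv (upoly a i j)) 0" for i j
    using deriv_u[OF assms, THEN DERIV_imp_deriv, of i j 0] by (simp add: E_def)
  have left: "pderiv (upoly a i j) = (\<Sum>l\<in>UNIV. smult (E a $ i $ l) (upoly a l j))" for i j
  proof -
    have "poly (pderiv (upoly a i j)) y = (\<Sum>l\<in>UNIV. E a $ i $ l * poly (upoly a l j) y)" for y
    proof (rule DERIV_unique)
      show "((\<lambda>h. u a (h + y) $ i $ j) has_field_derivative poly (pderiv (upoly a i j)) y) (at 0)"
        using DERIV_shift[of "\<lambda>h. u a h $ i $ j" _ 0 y] deriv_u[OF assms, of i j y] by simp
      have "((\<lambda>h. \<Sum>l\<in>UNIV. u a h $ i $ l * u a y $ l $ j) has_field_derivative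
          (\<Sum>l\<in>UNIV. E a $ i $ l * u a y $ l $ j)) (at 0)"
        unfolding E by (intro DERIV_sum DERIV_cmult_right deriv_u assms)
      then show "((\<lambda>h. u a (h + y) $ i $ j) has_field_derivative (\<Sum>l\<in>UNIV. E a $ i $ l * poly (upoly a l j) y)) (at 0)"
        by (simp add: u_add assms matrix_matrix_mult_def upoly)
    qed
    then show ?thesis
      by (simp add: poly_eq_poly_eq_iff[symmetric] fun_eq_iff poly_sum)
  qed
  have right: "pderiv (upoly a i j) = (\<Sum>l\<in>UNIV. smult (E a $ l $ j) (upoly a i l))" for i j
  proof -
    have "poly (pderiv (upoly a i j)) y = (\<Sum>l\<in>UNIV. E a $ l $ j * poly (upoly a i l) y)" for y
    proof (rule DERIV_unique)
      show "((\<lambda>h. u a (y + h) $ i $ j) has_field_derivative poly (pderiv (upoly a i j)) y) (at 0)"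
        using DERIV_shift[of "\<lambda>h. u a h $ i $ j" _ 0 y] deriv_u[OF assms, of i j y] by (simp add: add.commute)
      have "((\<lambda>h. \<Sum>l\<in>UNIV. u a y $ i $ l * u a h $ l $ j) has_field_derivative
          (\<Sum>l\<in>UNIV. u a y $ i $ l * E a $ l $ j)) (at 0)"
        unfolding E by (intro DERIV_sum DERIV_cmult deriv_u assms)
      then show "((\<lambda>h. u a (y + h) $ i $ j) has_field_derivative (\<Sum>l\<in>UNIV. E a $ l $ j * poly (upoly a i l) y)) (at 0)"
        by (simp add: u_add assms matrix_matrix_mult_def upoly mult.commute)
    qed
    then show ?thesis
      by (simp add: poly_eq_poly_eq_iff[symmetric] fun_eq_iff poly_sum)
  qed
  have c: "of_nat (Suc k) * coeff (upoly a i j) (Suc k) = coeff (pderiv (upoly a i j)) k" for i j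
    by (simp add: coeff_pderiv)
  show "mat (of_nat (Suc k)) ** U a (Suc k) = E a ** U a k"
    unfolding vec_eq_iff mat_mult_nth U_def vec_lambda_beta c
    by (simp add: left coeff_sum matrix_matrix_mult_def)
  show "mat (of_nat (Suc k)) ** U a (Suc k) = U a k ** E a"
    unfolding vec_eq_iff mat_mult_nth U_def vec_lambda_beta c
    by (simp add: right coeff_sum matrix_matrix_mult_def mult.commute)
qed

subsection \<open>Heights\<close>

definition hgt :: "('n character \<Rightarrow>\<^sub>0 int) \<Rightarrow> int" where
  "hgt m = (\<Sum>c\<in>S. Poly_Mapping.lookup m c)"

lemma hgt_add [simp]: "hgt (m + n) = hgt m + hgt n"
  by (simp add: hgt_def lookup_add sum.distrib)

lemma hgt_zero [simp]: "hgt 0 = 0"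
  by (simp add: hgt_def)

lemma hgt_uminus [simp]: "hgt (- m) = - hgt m"
  by (simp add: hgt_def sum_negf)

lemma hgt_cmul [simp]: "hgt (frag_cmul k m) = k * hgt m"
  by (simp add: hgt_def sum_distrib_left)

lemma hgt_sum: "hgt (\<Sum>i\<in>I. f i) = (\<Sum>i\<in>I. hgt (f i))"
  by (induction I rule: infinite_finite_induct) auto

lemma hgt_nonneg: "dominant m \<Longrightarrow> 0 \<le> hgt m"
  by (auto simp: hgt_def dominant_def intro: sum_nonneg)

lemma hgt_pos: "m \<in> Lat \<Longrightarrow> dominant m \<Longrightarrow> m \<noteq> 0 \<Longrightarrow> 0 < hgt m"
proof -
  assume m: "m \<in> Lat" "dominant m" "m \<noteq> 0"
  then obtain c where "Poly_Mapping.lookup m c \<noteq> 0" using poly_mapping_eqI[of m 0] by auto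
  then have "c \<in> S" using m by (auto simp: Lat_def in_keys_iff)
  then show "0 < hgt m"
    unfolding hgt_def using m(2) \<open>Poly_Mapping.lookup m c \<noteq> 0\<close>
    by (intro sum_pos2[of S c]) (auto simp: finite_S dominant_def order.not_eq_order_implies_strict)
qed

lemma ht_chi: "a \<in> Lat \<Longrightarrow> ht Q (chi a) = hgt a"
proof -
  assume a: "a \<in> Lat"
  have "k = hgt a" if "chi a = char_comb T S m" "k = (\<Sum>d\<in>S. m d)" for k m
  proof -
    have "a = lattice_of m"
      using chi_inj[OF a lattice_of_Lat] chi_lattice_of that by simp
    then show ?thesis using that by (simp add: hgt_def lookup_lattice_of)
  qed
  moreover have "\<exists>m. chi a = char_comb T S m \<and> hgt a = (\<Sum>d\<in>S. m d)"
    by (intro exI[of _ "Poly_Mapping.lookup a"]) (simp add: chi_def hgt_def)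
  ultimately show ?thesis
    unfolding ht_def by (intro the_equality) auto
qed

abbreviation high :: "int \<Rightarrow> 'n cmat \<Rightarrow> bool" where
  "high k \<equiv> deg_in {m. k \<le> hgt m}"

lemma high_mult: "high k X \<Longrightarrow> high l Y \<Longrightarrow> high (k + l) (X ** Y)"
  by (rule deg_in_mult) auto

text \<open>Only finitely many degrees occur among the matrix entries, so the filtration by height
  ends. This gives nilpotency of \<open>g - mat 1\<close> in \<open>leading_part_LA\<close> and
  termination of the correction process in \<open>conj_Borel_iff\<close>.\<close>

lemma high_bound: obtains n where "\<And>k X. n < k \<Longrightarrow> high k X \<Longrightarrow> X = 0" "1 \<le> n"
proof
  let ?n = "Max (insert 1 (hgt ` degrees))"
  show "X = 0" if "?n < k" "high k X" for k X
  proof -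
    have "component c X = 0" if "c \<in> degrees" for c
    proof (rule component_deg_in[OF \<open>high k X\<close>])
      have "hgt c \<le> ?n" using that finite_degrees by (intro Max_ge) auto
      then show "c \<notin> {m. k \<le> hgt m}" using \<open>?n < k\<close> by simp
    qed
    then show ?thesis using sum_components[of X] by simp
  qed
  show "1 \<le> ?n" using finite_degrees by (intro Max_ge) auto
qed

lemma LA_weight_vector:
  assumes "X \<in> LA" "deg_in {m} X" "X \<noteq> 0" "m \<noteq> 0"
  shows "m \<in> \<Phi>" "\<exists>z. X = mat z ** E m"
proof -
  have "component m X \<noteq> 0" using assms by (simp add: component_self)
  then have m: "m \<in> degrees" using component_eq_0_outside by blast
  have X: "X \<in> root_space G T (chi m)"
    using assms deg_in_weight_iff[OF degrees_Lat[OF m]] by (simp add: root_space_def conj_by_def)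
  have "chi m \<noteq> (\<lambda>t\<in>T. 1)"
  proof
    assume "chi m = (\<lambda>t\<in>T. 1)"
    then have "chi m = chi 0" using chi_eqI[of 0 "\<lambda>t\<in>T. 1"] chi_zero by simp
    then show False using chi_inj[OF degrees_Lat[OF m] Lat_zero] assms(4) by simp
  qed
  then have "chi m \<in> root_set G T"
    using X assms(3) degrees_character[OF m] by (auto simp: root_set_def)
  then show "m \<in> \<Phi>" using degrees_Lat[OF m] by (simp add: \<Phi>_def Roots_def)
  then show "\<exists>z. X = mat z ** E m" using X root_space_E by auto
qed

text \<open>In the logarithm of \<open>g\<close> the powers of \<open>g - mat 1\<close> from the
  second on start at height \<open>2 * k\<close>, so its part of height \<open>k\<close> is that of
  \<open>g - mat 1\<close>.\<close>

lemma leading_part_LA: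
  assumes g: "g \<in> G" and high: "high k (g - mat 1)" and k: "1 \<le> k" and m: "hgt m = k"
  shows "component m (g - mat 1) \<in> LA"
proof -
  let ?X = "g - mat 1"
  obtain n where n: "\<And>k X. n < k \<Longrightarrow> high k X \<Longrightarrow> X = 0" "1 \<le> n"
    using high_bound by metis
  define N where "N = nat n"
  have pow: "high (int j * k) (matrix_power ?X j)" for j
  proof (induction j)
    case (Suc j)
    then show ?case using high_mult[OF high Suc] by (simp add: algebra_simps)
  qed (simp add: deg_in_one)
  have "n < int (Suc N) * k"
  proof -
    have "n < int (Suc N) * 1" using n(2) by (simp add: N_def)
    also have "\<dots> \<le> int (Suc N) * k" using k by (intro mult_left_mono) auto
    finally show ?thesis .
  qed
  then have nil: "matrix_power ?X (Suc N) = 0" using n(1) pow by blast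
  have "mat 1 + ?X \<in> G" using g by simp
  then obtain d where d: "d 0 = 0" "d 1 = 1" "(\<Sum>j\<le>N. mat (d j) ** matrix_power ?X j) \<in> LA"
    using lie_algebra_unipotent[OF subgroup_G _ nil] by blast
  have "component m (\<Sum>j\<le>N. mat (d j) ** matrix_power ?X j) = (\<Sum>j\<le>N. if j = 1 then component m ?X else 0)"
    unfolding component_sum
  proof (rule sum.cong[OF refl])
    fix j
    have high_power: "component m (matrix_power ?X j) = 0" if "2 \<le> j"
    proof (rule component_deg_in[OF pow])
      have "2 * k \<le> int j * k" using that k by (intro mult_right_mono) auto
      then show "m \<notin> {m. int j * k \<le> hgt m}" using m k by simp
    qed
    consider "j = 0" | "j = 1" | "2 \<le> j" by linarith
    then show "component m (mat (d j) ** matrix_power ?X j) = (if j = 1 then component m ?X else 0)"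
      by cases (use d high_power in \<open>simp_all add: component_scale\<close>)
  qed
  also have "\<dots> = component m ?X" using n(2) by (simp add: N_def)
  finally show ?thesis using component_LA[OF d(3)] by metis
qed

subsection \<open>The normaliser of the torus\<close>

abbreviation Nrm :: "'n cmat set" where
  "Nrm \<equiv> normalizer (GG Q) T"

lemma Nrm_iff: "n \<in> Nrm \<longleftrightarrow> n \<in> G \<and> conj_by n ` T = T"
  by (rule normalizer_as_group[OF subgroup_G T_subset_G])

lemma Nrm_G: "n \<in> Nrm \<Longrightarrow> n \<in> G" and Nrm_invertible: "n \<in> Nrm \<Longrightarrow> invertible n"
  and Nrm_conj: "n \<in> Nrm \<Longrightarrow> t \<in> T \<Longrightarrow> conj_by n t \<in> T"
  by (auto simp: Nrm_iff G_invertible)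

lemma Nrm_mult:
  assumes "n \<in> Nrm" "n' \<in> Nrm"
  shows "n ** n' \<in> Nrm"
proof -
  have "conj_by (n ** n') ` T = conj_by n ` conj_by n' ` T"
    using assms by (simp add: image_image conj_by_conj_by Nrm_invertible)
  then show ?thesis using assms by (simp add: Nrm_iff G_mult)
qed

lemma Nrm_inv:
  assumes "n \<in> Nrm"
  shows "matrix_inv n \<in> Nrm"
proof -
  have "conj_by (matrix_inv n) ` T = conj_by (matrix_inv n) ` conj_by n ` T"
    using assms by (simp add: Nrm_iff)
  also have "\<dots> = T" using assms by (simp add: image_image conj_by_inverse Nrm_invertible)
  finally show ?thesis using assms by (simp add: Nrm_iff G_inv)
qed

lemma conj_by_torus: "t \<in> T \<Longrightarrow> s \<in> T \<Longrightarrow> conj_by t s = s"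
  by (simp add: conj_by_def T_commute[of t s] matrix_inv_cancel T_invertible)

lemma T_Nrm: "t \<in> T \<Longrightarrow> t \<in> Nrm"
  using T_subset_G by (auto simp: Nrm_iff conj_by_torus)

section \<open>Action of the normaliser on characters, roots and weights\<close>

definition cact :: "'n cmat \<Rightarrow> 'n character \<Rightarrow> 'n character" where
  "cact n c = (\<lambda>t\<in>T. c (conj_by (matrix_inv n) t))"

text \<open>Two representatives differ by an element of \<open>T\<close>, which acts trivially on
  \<open>T\<close> by conjugation, so the value does not depend on the choice made in
  \<open>wact\<close>.\<close>

lemma wact_coset:
  assumes "n \<in> Nrm"
  shows "wact Q (T #>\<^bsub>GG Q\<^esub> n) c = cact n c"
proof -
  have "mat 1 ** n \<in> T #>\<^bsub>GG Q\<^esub> n" unfolding r_coset_def using T_one by fastforce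
  then have "(SOME n'. n' \<in> T #>\<^bsub>GG Q\<^esub> n) \<in> T #>\<^bsub>GG Q\<^esub> n" by (rule someI)
  then obtain t where t: "t \<in> T" "(SOME n'. n' \<in> T #>\<^bsub>GG Q\<^esub> n) = t ** n"
    by (auto simp: r_coset_def)
  have "matrix_inv (t ** n) ** s ** (t ** n) = conj_by (matrix_inv n) s" if s: "s \<in> T" for s
  proof -
    have "matrix_inv (t ** n) ** s ** (t ** n) = matrix_inv n ** (matrix_inv t ** (s ** t)) ** n"
      using t assms by (simp add: matrix_inv_mult T_invertible Nrm_invertible matrix_mul_assoc)
    also have "\<dots> = conj_by (matrix_inv n) s"
      using t s assms by (simp add: T_commute[of s t] matrix_inv_cancel T_invertible Nrm_invertible
          conj_by_def matrix_inv_matrix_inv)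
    finally show ?thesis .
  qed
  then show ?thesis
    unfolding wact_def t(2) Let_def cact_def by (auto intro: restrict_ext)
qed

lemma cact_ext: "cact n c \<in> extensional T"
  by (simp add: cact_def)

lemma cact_character:
  assumes n: "n \<in> Nrm" and c: "c \<in> characters T"
  shows "cact n c \<in> characters T"
proof -
  let ?m = "matrix_inv n"
  have m: "?m \<in> Nrm" using Nrm_inv n by blast
  obtain f k where f: "\<forall>t\<in>T. c t = mat_eval f t / det t ^ k"
    using c by (auto simp: characters_def)
  obtain f' where f': "\<And>A. mat_eval f' A = mat_eval f (conj_by ?m A)"
    using mat_eval_conj by metis
  have "det (conj_by ?m t) = det t" for t
  proof -
    have "det (conj_by ?m t) = det (?m ** matrix_inv ?m) * det t"
      by (simp add: conj_by_def det_mul)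
    then show ?thesis using m by (simp add: matrix_inv_right Nrm_invertible)
  qed
  then have "\<forall>t\<in>T. cact n c t = mat_eval f' t / det t ^ k"
    using f f' m Nrm_conj by (simp add: cact_def)
  moreover have "cact n c (t ** s) = cact n c t * cact n c s" if "t \<in> T" "s \<in> T" for t s
    using that m c by (simp add: cact_def T_mult conj_by_mult Nrm_invertible characters_mult Nrm_conj)
  moreover have "\<forall>t\<in>T. cact n c t \<noteq> 0"
    using c m by (simp add: cact_def characters_nonzero Nrm_conj)
  ultimately show ?thesis
    unfolding characters_def using cact_ext by blast
qed

lemma E_LA:
  assumes "a \<in> \<Phi>"
  shows "E a \<in> LA"
proof -
  have "mat 1 ** E a \<in> root_space G T (chi a)"
    unfolding root_space_E[OF assms] by (rule rangeI)
  then show ?thesis by (simp add: root_space_def)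
qed

lemma conj_by_exchange:
  assumes "invertible t" "invertible n"
  shows "conj_by t (conj_by n X) = conj_by n (conj_by (conj_by (matrix_inv n) t) X)"
proof -
  have eq: "conj_by (matrix_inv n) t = matrix_inv n ** (t ** n)"
    using assms by (simp add: conj_by_def matrix_inv_matrix_inv matrix_mul_assoc)
  have "conj_by n (conj_by (matrix_inv n ** (t ** n)) X) = conj_by (n ** (matrix_inv n ** (t ** n))) X"
    using assms by (intro conj_by_conj_by) (simp_all add: invertible_mult invertible_matrix_inv)
  then show ?thesis
    using assms by (simp add: eq matrix_inv_cancel conj_by_conj_by)
qed

text \<open>Conjugation by \<open>n\<close> carries a root vector to a nonzero vector of the Lie
  algebra whose weight is the transformed character.\<close>

lemma cact_root:
  assumes n: "n \<in> Nrm" and c: "c \<in> Roots Q"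
  shows "cact n c \<in> Roots Q"
proof -
  let ?m = "matrix_inv n"
  have m: "?m \<in> Nrm" using Nrm_inv n by blast
  obtain a where a: "a \<in> \<Phi>" "c = chi a" using c Roots_eq by auto
  have "conj_by n (E a) \<in> root_space G T (cact n c)"
    unfolding root_space_def
  proof (intro CollectI conjI ballI)
    show "conj_by n (E a) \<in> LA" using lie_algebra_conj_by[OF subgroup_G] Nrm_G n E_LA a(1) by blast
    fix t assume t: "t \<in> T"
    have "conj_by t (conj_by n (E a)) = conj_by n (conj_by (conj_by ?m t) (E a))"
      using n t by (intro conj_by_exchange) (simp_all add: T_invertible Nrm_invertible)
    also have "\<dots> = conj_by n (mat (chi a (conj_by ?m t)) ** E a)"
      using deg_in_weight_iff[OF Phi_Lat[OF a(1)]] deg_in_E[OF a(1)] Nrm_conj[OF m t] by simp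
    also have "\<dots> = mat (cact n c t) ** conj_by n (E a)"
      using t a by (simp add: conj_by_scale cact_def)
    finally show "t ** conj_by n (E a) ** matrix_inv t = mat (cact n c t) ** conj_by n (E a)"
      by (simp add: conj_by_def[of t])
  qed
  moreover have "conj_by n (E a) \<noteq> 0"
  proof
    assume "conj_by n (E a) = 0"
    then have "conj_by ?m (conj_by n (E a)) = 0" by simp
    then show False using E_nonzero[OF a(1)] n by (simp add: conj_by_inverse Nrm_invertible)
  qed
  moreover have "cact n c \<noteq> (\<lambda>t\<in>T. 1)"
  proof
    assume *: "cact n c = (\<lambda>t\<in>T. 1)"
    have "c t = 1" if t: "t \<in> T" for t
    proof -
      have "cact n c (conj_by n t) = c t"
        using t n by (simp add: cact_def Nrm_conj conj_by_inverse Nrm_invertible)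
      then show ?thesis using * t n by (simp add: Nrm_conj)
    qed
    then have "c = (\<lambda>t\<in>T. 1)"
      using characters_ext[OF Roots_character[OF c]] by (intro extensionalityI) auto
    then show False using c by (simp add: Roots_def root_set_def)
  qed
  ultimately show ?thesis
    using cact_character[OF n Roots_character[OF c]] by (auto simp: Roots_def root_set_def)
qed

definition lact :: "'n cmat \<Rightarrow> ('n character \<Rightarrow>\<^sub>0 int) \<Rightarrow> ('n character \<Rightarrow>\<^sub>0 int)" where
  "lact n = frag_extend (\<lambda>c. crd (cact n c))"

lemma lact_add: "lact n (a + b) = lact n a + lact n b"
  by (simp add: lact_def frag_extend_add)

lemma lact_uminus: "lact n (- a) = - lact n a"
  by (rule additive_uminus) (rule lact_add)

lemma lact_diff: "lact n (a - b) = lact n a - lact n b"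
  using lact_add[of n a "- b"] by (simp add: lact_uminus)

lemma lact_cmul: "lact n (frag_cmul k a) = frag_cmul k (lact n a)"
  by (rule additive_cmul) (rule lact_add)

lemma lact_expand: "lact n m = (\<Sum>c\<in>Poly_Mapping.keys m. frag_cmul (Poly_Mapping.lookup m c) (crd (cact n c)))"
  by (simp add: lact_def frag_extend_def)

lemma cact_simple_character: "n \<in> Nrm \<Longrightarrow> c \<in> S \<Longrightarrow> cact n c \<in> characters T"
  using cact_character S_character by blast

lemma lact_Lat: "n \<in> Nrm \<Longrightarrow> m \<in> Lat \<Longrightarrow> lact n m \<in> Lat"
  unfolding lact_expand
  by (intro Lat_sum Lat_cmul crd_Lat cact_simple_character) (auto simp: Lat_def)

lemma chi_lact:
  assumes n: "n \<in> Nrm" and m: "m \<in> Lat"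
  shows "chi (lact n m) = cact n (chi m)"
proof (rule chi_eqI[OF _ cact_ext])
  fix t assume t: "t \<in> T"
  let ?t = "conj_by (matrix_inv n) t"
  have t': "?t \<in> T" using Nrm_conj Nrm_inv n t by blast
  have keys: "Poly_Mapping.keys m \<subseteq> S" using m by (simp add: Lat_def)
  have "chi (lact n m) t = (\<Prod>c\<in>Poly_Mapping.keys m. chi (crd (cact n c)) t powi Poly_Mapping.lookup m c)"
    using t by (simp add: lact_expand chi_sum chi_cmul)
  also have "\<dots> = (\<Prod>c\<in>Poly_Mapping.keys m. c ?t powi Poly_Mapping.lookup m c)"
  proof (rule prod.cong[OF refl])
    fix c assume "c \<in> Poly_Mapping.keys m"
    then have "c \<in> S" using keys by blast
    then show "chi (crd (cact n c)) t powi Poly_Mapping.lookup m c = c ?t powi Poly_Mapping.lookup m c"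
      using t by (subst chi_crd[OF cact_simple_character[OF n]]) (auto simp: cact_def)
  qed
  also have "\<dots> = chi m ?t"
    unfolding chi_apply[OF t'] using keys finite_S
    by (intro prod.mono_neutral_left) (auto simp: in_keys_iff)
  finally show "chi (lact n m) t = cact n (chi m) t" using t by (simp add: cact_def)
qed

lemma lact_eqI: "n \<in> Nrm \<Longrightarrow> m \<in> Lat \<Longrightarrow> m' \<in> Lat \<Longrightarrow> cact n (chi m) = chi m' \<Longrightarrow> lact n m = m'"
  using chi_inj chi_lact lact_Lat by metis

lemma cact_mult:
  assumes "n \<in> Nrm" "n' \<in> Nrm"
  shows "cact (n ** n') c = cact n (cact n' c)"
  unfolding cact_def
  by (rule restrict_ext)
    (use assms in \<open>simp add: Nrm_conj Nrm_inv matrix_inv_mult Nrm_invertible conj_by_conj_by invertible_matrix_inv\<close>)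

lemma lact_mult: "n \<in> Nrm \<Longrightarrow> n' \<in> Nrm \<Longrightarrow> m \<in> Lat \<Longrightarrow> lact (n ** n') m = lact n (lact n' m)"
  by (rule lact_eqI) (simp_all add: Nrm_mult lact_Lat cact_mult chi_lact)

lemma lact_torus: "t \<in> T \<Longrightarrow> m \<in> Lat \<Longrightarrow> lact t m = m"
proof (rule lact_eqI)
  assume "t \<in> T"
  then have "chi m = cact t (chi m)"
    by (intro chi_eqI[OF _ cact_ext]) (simp add: cact_def conj_by_torus T_inv)
  then show "cact t (chi m) = chi m" by simp
qed (auto simp: T_Nrm)

lemma lact_one: "m \<in> Lat \<Longrightarrow> lact (mat 1) m = m"
  by (rule lact_torus[OF T_one])

lemma lact_inv: "n \<in> Nrm \<Longrightarrow> m \<in> Lat \<Longrightarrow> lact (matrix_inv n) (lact n m) = m"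
  and lact_inv': "n \<in> Nrm \<Longrightarrow> m \<in> Lat \<Longrightarrow> lact n (lact (matrix_inv n) m) = m"
  by (simp_all add: Nrm_inv lact_one matrix_inv_left matrix_inv_right Nrm_invertible flip: lact_mult)

lemma lact_Phi: "n \<in> Nrm \<Longrightarrow> a \<in> \<Phi> \<Longrightarrow> lact n a \<in> \<Phi>"
  by (simp add: \<Phi>_def lact_Lat chi_lact cact_root)

lemma deg_in_conj_by:
  assumes n: "n \<in> Nrm" and m: "m \<in> Lat" and X: "deg_in {m} X"
  shows "deg_in {lact n m} (conj_by n X)"
proof (subst deg_in_weight_iff[OF lact_Lat[OF n m]], intro ballI)
  let ?m = "matrix_inv n"
  have inv: "?m \<in> Nrm" using Nrm_inv n by blast
  fix t assume t: "t \<in> T"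
  have "conj_by t (conj_by n X) = conj_by n (conj_by (conj_by ?m t) X)"
    using n t by (intro conj_by_exchange) (simp_all add: T_invertible Nrm_invertible)
  also have "\<dots> = conj_by n (mat (chi m (conj_by ?m t)) ** X)"
    using deg_in_weight_iff[OF m] X Nrm_conj[OF inv t] by simp
  also have "\<dots> = mat (chi (lact n m) t) ** conj_by n X"
    using t by (simp add: conj_by_scale chi_lact n m cact_def)
  finally show "conj_by t (conj_by n X) = mat (chi (lact n m) t) ** conj_by n X" .
qed

lemma component_conj_Nrm:
  assumes n: "n \<in> Nrm" and m: "m \<in> Lat"
  shows "component (lact n m) (conj_by n X) = conj_by n (component m X)"
proof -
  have inj: "lact n c = lact n m \<longleftrightarrow> c = m" if "c \<in> Lat" for c
    using lact_inv n m that by metis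
  have "component (lact n m) (conj_by n X) = component (lact n m) (\<Sum>c\<in>degrees. conj_by n (component c X))"
    by (simp add: sum_components flip: conj_by_sum)
  also have "\<dots> = (\<Sum>c\<in>degrees. if c = m then conj_by n (component m X) else 0)"
    unfolding component_sum
  proof (rule sum.cong[OF refl])
    fix c assume c: "c \<in> degrees"
    have "deg_in {lact n c} (conj_by n (component c X))"
      using deg_in_conj_by n degrees_Lat[OF c] deg_in_component by blast
    then show "component (lact n m) (conj_by n (component c X)) = (if c = m then conj_by n (component m X) else 0)"
      using inj[OF degrees_Lat[OF c]] by (auto simp: component_self intro: component_other)
  qed
  also have "\<dots> = conj_by n (component m X)"
    using component_eq_0_outside[of m X] by (simp add: finite_degrees)
  finally show ?thesis .
qed

subsection \<open>Simple reflections\<close>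

abbreviation nr :: "'n character \<Rightarrow> 'n cmat" where
  "nr c \<equiv> nrep Q c"

lemma nr_reflection: "c \<in> S \<Longrightarrow> represents_reflection G T c (nr c)"
  using pinned by (simp add: pinned_semisimple_adjoint_group_def)

lemma nr_Nrm: "c \<in> S \<Longrightarrow> nr c \<in> Nrm"
  using nr_reflection by (simp add: represents_reflection_def)

section \<open>Laurent functions and the pairing of characters with cocharacters\<close>

lemma laurent_closed:
  defines "L \<equiv> {\<phi> :: complex \<Rightarrow> complex. \<exists>q k. \<forall>z. z \<noteq> 0 \<longrightarrow> \<phi> z = poly q z / z ^ k}"
  shows "(\<lambda>z. c) \<in> L" "f \<in> L \<Longrightarrow> g \<in> L \<Longrightarrow> (\<lambda>z. f z + g z) \<in> L"
    "f \<in> L \<Longrightarrow> g \<in> L \<Longrightarrow> (\<lambda>z. f z * g z) \<in> L"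
proof -
  have "\<forall>z. z \<noteq> 0 \<longrightarrow> c = poly [:c:] z / z ^ 0" by simp
  then show "(\<lambda>z. c) \<in> L" unfolding L_def by blast
  assume "f \<in> L" "g \<in> L"
  then obtain q k q' k' where f: "\<And>z. z \<noteq> 0 \<Longrightarrow> f z = poly q z / z ^ k" and g: "\<And>z. z \<noteq> 0 \<Longrightarrow> g z = poly q' z / z ^ k'"
    by (auto simp: L_def)
  have "\<forall>z. z \<noteq> 0 \<longrightarrow> f z + g z = poly (q * monom 1 k' + q' * monom 1 k) z / z ^ (k + k')"
    by (auto simp: f g poly_monom power_add field_simps)
  then show "(\<lambda>z. f z + g z) \<in> L" unfolding L_def by blast
  have "\<forall>z. z \<noteq> 0 \<longrightarrow> f z * g z = poly (q * q') z / z ^ (k + k')"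
    by (auto simp: f g power_add)
  then show "(\<lambda>z. f z * g z) \<in> L" unfolding L_def by blast
qed

lemma laurent_sum_prod:
  defines "L \<equiv> {\<phi> :: complex \<Rightarrow> complex. \<exists>q k. \<forall>z. z \<noteq> 0 \<longrightarrow> \<phi> z = poly q z / z ^ k}"
  assumes "\<And>i. i \<in> I \<Longrightarrow> f i \<in> L"
  shows "(\<lambda>z. \<Sum>i\<in>I. f i z) \<in> L" "(\<lambda>z. \<Prod>i\<in>I. f i z) \<in> L"
  using assms(2) unfolding L_def
  by (induction I rule: infinite_finite_induct)
    (simp_all only: sum.insert prod.insert sum.empty prod.empty sum.infinite prod.infinite insert_iff
      laurent_closed simp_thms)

lemma laurent_power:
  defines "L \<equiv> {\<phi> :: complex \<Rightarrow> complex. \<exists>q k. \<forall>z. z \<noteq> 0 \<longrightarrow> \<phi> z = poly q z / z ^ k}"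
  assumes "f \<in> L"
  shows "(\<lambda>z. f z ^ k) \<in> L"
  using assms(2) unfolding L_def
  by (induction k) (simp_all only: power_0 power_Suc laurent_closed)

text \<open>After the power of the variable is split off no root is left, and the fundamental
  theorem of algebra makes the cofactor constant.\<close>

lemma poly_no_nonzero_root:
  fixes q :: "complex poly"
  assumes "\<And>z. z \<noteq> 0 \<Longrightarrow> poly q z \<noteq> 0"
  shows "\<exists>c k. c \<noteq> 0 \<and> q = monom c k"
proof -
  have q0: "q \<noteq> 0" using assms[of 1] by auto
  define k where "k = Polynomial.order 0 q"
  obtain p where p: "q = [:- 0, 1:] ^ k * p" "\<not> [:- 0, 1:] dvd p"
    using order_decomp[OF q0, of 0] unfolding k_def by blast
  have "poly p z \<noteq> 0" for z
  proof (cases "z = 0")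
    case True
    then show ?thesis using p(2) by (simp add: poly_eq_0_iff_dvd)
  next
    case False
    then show ?thesis using assms[of z] p(1) by auto
  qed
  then have "constant (poly p)" using fundamental_theorem_of_algebra by blast
  then obtain c where "p = [:c:]" using constant_degree degree_eq_zeroE by metis
  moreover have "c \<noteq> 0" using q0 p(1) calculation by auto
  moreover have "[:c:] * monom 1 k = monom c k" by (simp add: smult_monom)
  ultimately show ?thesis
    using p(1) by (intro exI[of _ c] exI[of _ k]) (simp add: monom_altdef)
qed

text \<open>Along a cocharacter a character is a nowhere vanishing Laurent function, so numerator
  and denominator are monomials. Multiplicativity at 1 fixes the constant to be 1; the exponent
  \<open>k\<close> is the pairing.\<close>

lemma character_cocharacter:
  assumes c: "c \<in> characters T" and h: "cocharacter T h"
  shows "\<exists>k::int. \<forall>z. z \<noteq> 0 \<longrightarrow> c (h z) = z powi k"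
proof -
  let ?L = "{\<phi> :: complex \<Rightarrow> complex. \<exists>q k. \<forall>z. z \<noteq> 0 \<longrightarrow> \<phi> z = poly q z / z ^ k}"
  obtain f k where f: "\<And>t. t \<in> T \<Longrightarrow> c t = mat_eval f t / det t ^ k"
    using c by (auto simp: characters_def)
  have hT: "h z \<in> T" if "z \<noteq> 0" for z using h that by (simp add: cocharacter_def)
  have hm: "h (z * y) = h z ** h y" if "z \<noteq> 0" "y \<noteq> 0" for z y using h that by (simp add: cocharacter_def)
  have ent: "(\<lambda>z. h z $ i $ j) \<in> ?L" for i j
    using h by (simp add: cocharacter_def)
  have "(\<lambda>z. mat_eval f (h z)) \<in> ?L"
    unfolding mat_eval_def peval_def split_beta
    by (intro laurent_sum_prod(1) laurent_closed laurent_sum_prod(2) laurent_power ent)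
  then obtain q k1 where q: "\<And>z. z \<noteq> 0 \<Longrightarrow> mat_eval f (h z) = poly q z / z ^ k1" by auto
  have "(\<lambda>z. det (h z) ^ k) \<in> ?L"
    unfolding det_def by (intro laurent_power laurent_sum_prod laurent_closed ent)
  then obtain p k2 where p: "\<And>z. z \<noteq> 0 \<Longrightarrow> det (h z) ^ k = poly p z / z ^ k2" by auto
  have nz: "c (h z) \<noteq> 0" if "z \<noteq> 0" for z using characters_nonzero c hT that by blast
  have "poly q z \<noteq> 0" if "z \<noteq> 0" for z
    using nz[OF that] f[OF hT[OF that]] q[OF that] by auto
  then obtain a l where q': "a \<noteq> 0" "q = monom a l" using poly_no_nonzero_root by metis
  have "poly p z \<noteq> 0" if "z \<noteq> 0" for z
    using nz[OF that] f[OF hT[OF that]] p[OF that] by auto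
  then obtain b m where p': "b \<noteq> 0" "p = monom b m" using poly_no_nonzero_root by metis
  have eq: "c (h z) = a / b * z powi (int l + int k2 - int m - int k1)" if z: "z \<noteq> 0" for z
  proof -
    have "z powi (int l + int k2 - int m - int k1) = z ^ l * z ^ k2 / (z ^ m * z ^ k1)"
      using z by (simp add: power_int_add power_int_diff)
    then show ?thesis
      unfolding f[OF hT[OF z]] q[OF z] p[OF z] q'(2) p'(2) poly_monom using z p'(1) by (simp add: field_simps)
  qed
  have "c (h 1) * c (h 1) = c (h 1)"
    using hm[of 1 1] hT[of 1] characters_mult[OF c, of "h 1" "h 1"] by simp
  then have "c (h 1) = 1" using nz[of 1] by simp
  then have "a / b = 1" using eq[of 1] by simp
  then show ?thesis using eq by auto
qed

text \<open>The pinning describes conjugation by \<open>nr c\<close>, while \<open>cact\<close> uses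
  the inverse; the two agree on \<open>T\<close> because the reflection is an involution
  there.\<close>

lemma reflection_cact:
  assumes c: "c \<in> S"
  obtains h where "cocharacter T h" "\<And>z. z \<noteq> 0 \<Longrightarrow> c (h z) = z\<^sup>2"
    "\<And>d t. t \<in> T \<Longrightarrow> d \<in> characters T \<Longrightarrow> cact (nr c) d t = d t * d (h (inverse (c t)))"
proof -
  obtain h where h: "cocharacter T h" "\<And>z. z \<noteq> 0 \<Longrightarrow> c (h z) = z\<^sup>2"
    "\<And>t. t \<in> T \<Longrightarrow> conj_by (nr c) t = t ** h (inverse (c t))"
    using nr_reflection[OF c] by (auto simp: represents_reflection_def conj_by_def)
  have hT: "h z \<in> T" if "z \<noteq> 0" for z using h that by (simp add: cocharacter_def)
  have hm: "h (z * y) = h z ** h y" if "z \<noteq> 0" "y \<noteq> 0" for z y using h that by (simp add: cocharacter_def)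
  have h1: "h 1 = mat 1"
  proof -
    have "matrix_inv (h 1) ** (h 1 ** h 1) = matrix_inv (h 1) ** h 1"
      using hm[of 1 1] by simp
    then show ?thesis using T_invertible[OF hT[of 1]] by (simp add: matrix_inv_cancel matrix_inv_left)
  qed
  have "conj_by (matrix_inv (nr c)) t = t ** h (inverse (c t))" if t: "t \<in> T" for t
  proof -
    have ct: "c t \<noteq> 0" using characters_nonzero S_character c t by blast
    let ?s = "t ** h (inverse (c t))"
    have s: "?s \<in> T" using t hT ct by (simp add: T_mult)
    have "c ?s = c t * c (h (inverse (c t)))"
      by (rule characters_mult[OF S_character[OF c] t]) (simp add: hT ct)
    then have "c ?s = inverse (c t)" using h(2)[of "inverse (c t)"] ct by (simp add: power2_eq_square)
    then have "conj_by (nr c) ?s = t ** (h (inverse (c t)) ** h (c t))"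
      using h(3)[OF s] by (simp add: matrix_mul_assoc)
    also have "h (inverse (c t)) ** h (c t) = mat 1"
      using hm[of "inverse (c t)" "c t"] ct h1 by simp
    finally have "conj_by (matrix_inv (nr c)) (conj_by (nr c) ?s) = conj_by (matrix_inv (nr c)) t" by simp
    then show ?thesis using nr_Nrm[OF c] by (simp add: conj_by_inverse Nrm_invertible)
  qed
  then have "cact (nr c) d t = d t * d (h (inverse (c t)))" if "t \<in> T" "d \<in> characters T" for d t
    using that characters_mult[OF that(2,1) hT] characters_nonzero[OF S_character[OF c]] by (simp add: cact_def)
  then show thesis using that h by blast
qed

lemma lact_nr_simple:
  assumes c: "c \<in> S"
  shows "lact (nr c) (frag_of c) = - frag_of c"
proof (rule lact_eqI)
  obtain h where h: "cocharacter T h" "\<And>z. z \<noteq> 0 \<Longrightarrow> c (h z) = z\<^sup>2"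
    "\<And>d t. t \<in> T \<Longrightarrow> d \<in> characters T \<Longrightarrow> cact (nr c) d t = d t * d (h (inverse (c t)))"
    using reflection_cact[OF c] by metis
  have "chi (- frag_of c) = cact (nr c) c"
  proof (rule chi_eqI[OF _ cact_ext])
    fix t assume t: "t \<in> T"
    have "c t \<noteq> 0" using characters_nonzero S_character c t by blast
    then show "chi (- frag_of c) t = cact (nr c) c t"
      using t c h(2)[of "inverse (c t)"] by (simp add: h(3) S_character chi_uminus chi_frag_of power2_eq_square)
  qed
  then show "cact (nr c) (chi (frag_of c)) = chi (- frag_of c)" using c by (simp add: chi_frag_of)
qed (use c in \<open>auto simp: nr_Nrm Lat_frag_of Lat_uminus\<close>)

lemma lact_nr_other:
  assumes c: "c \<in> S" and d: "d \<in> S"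
  shows "\<exists>k. lact (nr c) (frag_of d) = frag_of d - frag_cmul k (frag_of c)"
proof -
  obtain h where h: "cocharacter T h" "\<And>z. z \<noteq> 0 \<Longrightarrow> c (h z) = z\<^sup>2"
    "\<And>d t. t \<in> T \<Longrightarrow> d \<in> characters T \<Longrightarrow> cact (nr c) d t = d t * d (h (inverse (c t)))"
    using reflection_cact[OF c] by metis
  obtain k where k: "\<And>z. z \<noteq> 0 \<Longrightarrow> d (h z) = z powi k"
    using character_cocharacter[OF S_character[OF d] h(1)] by blast
  have "chi (frag_of d - frag_cmul k (frag_of c)) = cact (nr c) d"
  proof (rule chi_eqI[OF _ cact_ext])
    fix t assume t: "t \<in> T"
    have "c t \<noteq> 0" using characters_nonzero S_character c t by blast
    then show "chi (frag_of d - frag_cmul k (frag_of c)) t = cact (nr c) d t"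
      using t c d k by (simp add: h(3) S_character chi_diff chi_cmul chi_frag_of power_int_inverse divide_inverse)
  qed
  then have "lact (nr c) (frag_of d) = frag_of d - frag_cmul k (frag_of c)"
    using c d by (intro lact_eqI) (auto simp: nr_Nrm Lat_frag_of Lat_cmul Lat_diff chi_frag_of)
  then show ?thesis by blast
qed

lemma lact_nr:
  assumes c: "c \<in> S" and m: "m \<in> Lat"
  shows "\<exists>k. lact (nr c) m = m - frag_cmul k (frag_of c)"
proof -
  obtain k where k: "\<And>d. d \<in> S \<Longrightarrow> lact (nr c) (frag_of d) = frag_of d - frag_cmul (k d) (frag_of c)"
    using lact_nr_other[OF c] by metis
  have keys: "Poly_Mapping.keys m \<subseteq> S" using m by (simp add: Lat_def)
  have "lact (nr c) m = (\<Sum>d\<in>Poly_Mapping.keys m. frag_cmul (Poly_Mapping.lookup m d) (lact (nr c) (frag_of d)))"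
    by (rule additive_expand) (rule lact_add)
  also have "\<dots> = (\<Sum>d\<in>Poly_Mapping.keys m. frag_cmul (Poly_Mapping.lookup m d) (frag_of d) -
      frag_cmul (Poly_Mapping.lookup m d * k d) (frag_of c))"
    using keys by (intro sum.cong) (auto simp: k subset_iff frag_cmul_diff_distrib frag_cmul_distrib2 poly_mapping_eq_iff fun_eq_iff lookup_minus algebra_simps)
  also have "\<dots> = m - (\<Sum>d\<in>Poly_Mapping.keys m. frag_cmul (Poly_Mapping.lookup m d * k d) (frag_of c))"
    unfolding sum_subtractf frag_eq_sum[of m, symmetric] ..
  also have "\<dots> = m - frag_cmul (\<Sum>d\<in>Poly_Mapping.keys m. Poly_Mapping.lookup m d * k d) (frag_of c)"
    by (rule poly_mapping_eqI) (simp add: lookup_minus lookup_sum sum_distrib_right)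
  finally show ?thesis by blast
qed

lemma simple_reflections: "simple_reflections \<Phi> S (\<lambda>c. lact (nr c))"
proof
  fix c a assume c: "c \<in> S" and a: "a \<in> \<Phi>"
  obtain k where k: "lact (nr c) a = a - frag_cmul k (frag_of c)"
    using lact_nr[OF c Phi_Lat[OF a]] by blast
  show "lact (nr c) (lact (nr c) a) = a"
    unfolding k lact_diff by (simp add: lact_cmul lact_nr_simple c k)
  show "Poly_Mapping.lookup (lact (nr c) a) d = Poly_Mapping.lookup a d" if "d \<noteq> c" for d
    using that by (simp add: k lookup_minus lookup_single when_def)
next
  fix a assume "a \<in> \<Phi>"
  then show "Poly_Mapping.keys a \<subseteq> S" by (simp add: \<Phi>_def Lat_def)
qed (simp_all add: finite_Phi zero_notin_Phi Phi_sign simple_in_Phi lact_add lact_Phi nr_Nrm lact_nr_simple)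

sublocale sr: simple_reflections \<Phi> S "\<lambda>c. lact (nr c)"
  by (rule simple_reflections)

end

section \<open>Lie brackets of matrices\<close>

definition lie_bracket :: "('n::finite) cmat \<Rightarrow> 'n cmat \<Rightarrow> 'n cmat" where
  "lie_bracket X Y = X ** Y - Y ** X"

lemma lie_bracket_zero [simp]: "lie_bracket X 0 = 0" "lie_bracket 0 Y = 0" "lie_bracket X X = 0"
  by (simp_all add: lie_bracket_def)

lemma lie_bracket_scale: "lie_bracket X (mat z ** Y) = mat z ** lie_bracket X Y"
    "lie_bracket (mat z ** X) Y = mat z ** lie_bracket X Y"
  by (simp_all add: lie_bracket_def mult_mat_left matrix_mult_diff flip: matrix_mul_assoc)

lemma lie_bracket_swap: "lie_bracket X Y = - lie_bracket Y X"
  by (simp add: lie_bracket_def)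

lemma conj_by_lie_bracket: "invertible g \<Longrightarrow> conj_by g (lie_bracket X Y) = lie_bracket (conj_by g X) (conj_by g Y)"
  by (simp add: lie_bracket_def conj_by_diff conj_by_mult)

lemma mat_mult_eq_0_iff: "mat z ** X = 0 \<longleftrightarrow> z = 0 \<or> X = (0 :: 'a::field ^ 'n ^ 'n)"
  by (auto simp: vec_eq_iff)

lemma mult_scale_triple:
  fixes A B Y :: "'a::comm_ring_1 ^ 'n ^ 'n"
  shows "(mat p ** A) ** Y ** (mat q ** B) = mat (p * q) ** (A ** Y ** B)"
proof -
  have "(mat p ** A) ** Y ** (mat q ** B) = mat q ** ((mat p ** A) ** Y ** B)"
    by (rule mult_mat_left)
  also have "(mat p ** A) ** Y ** B = mat p ** (A ** Y ** B)"
    by (simp only: matrix_mul_assoc)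
  finally show ?thesis by (simp only: mat_mult_mat mult.commute)
qed

lemma mat_minus_one: "mat (- 1) ** X = - (X :: 'a::field ^ 'n ^ 'n)"
  by (simp add: vec_eq_iff)

context pinned
begin

subsection \<open>The adjoint action of root subgroups\<close>

lemma eq_by_components:
  assumes "\<And>c. component c X = component c Y"
  shows "X = Y"
proof -
  have "(\<Sum>c\<in>degrees. component c X) = (\<Sum>c\<in>degrees. component c Y)"
    by (rule sum.cong[OF refl]) (rule assms)
  then show ?thesis by (simp only: sum_components)
qed

lemma frag_cmul_cancel: "a \<noteq> 0 \<Longrightarrow> frag_cmul k a = frag_cmul l a \<longleftrightarrow> k = l"
  using frag_cmul_eq_0_iff[of "k - l" a] frag_cmul_distrib[of "k - l" l a] by auto

text \<open>Coefficient of \<open>x ^ k\<close> in \<open>conj_by (u a x) Y\<close>, that is,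
  \<open>ad(E a)^k Y / k!\<close>; the recursion is \<open>Ad_Suc\<close>.\<close>

definition Ad :: "('n character \<Rightarrow>\<^sub>0 int) \<Rightarrow> 'n cmat \<Rightarrow> nat \<Rightarrow> 'n cmat" where
  "Ad a Y k = (\<Sum>i\<le>k. mat ((- 1) ^ (k - i)) ** (U a i ** Y ** U a (k - i)))"

lemma deg_in_u: "a \<in> \<Phi> \<Longrightarrow> deg_in {frag_cmul (int k) a | k. True} (u a x)"
  unfolding u_expand[OF _ order_refl]
  by (intro deg_in_sum deg_in_scale deg_in_mono[OF deg_in_U]) auto

lemma conj_by_u: "a \<in> \<Phi> \<Longrightarrow> conj_by (u a x) Y = u a x ** Y ** u a (- x)"
  by (simp add: conj_by_def u_inverse)

lemma deg_in_conj_by_u: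
  assumes a: "a \<in> \<Phi>" and Y: "deg_in {c} Y"
  shows "deg_in {c + frag_cmul (int k) a | k. True} (conj_by (u a x) Y)"
  unfolding conj_by_u[OF a]
proof (rule deg_in_mult[OF _ deg_in_u[OF a]])
  show "deg_in {frag_cmul (int k) a + c | k. True} (u a x ** Y)"
    by (rule deg_in_mult[OF deg_in_u[OF a] Y]) auto
  fix s s' assume "s \<in> {frag_cmul (int k) a + c | k. True}" "s' \<in> {frag_cmul (int k) a | k. True}"
  then obtain k l where "s = frag_cmul (int k) a + c" "s' = frag_cmul (int l) a" by auto
  then have "s + s' = c + frag_cmul (int (k + l)) a"
    by (simp add: frag_cmul_distrib add_ac)
  then show "s + s' \<in> {c + frag_cmul (int k) a | k. True}" by blast
qed

text \<open>In the double expansion the term \<open>U a i ** Y ** U a j\<close> has weight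
  \<open>c + (i + j) a\<close>, so the weight selects the power of \<open>x\<close>; the signs come
  from \<open>u a (- x)\<close>.\<close>

lemma component_conj_by_u:
  assumes a: "a \<in> \<Phi>" and Y: "deg_in {c} Y"
  shows "component (c + frag_cmul (int k) a) (conj_by (u a x) Y) = mat (x ^ k) ** Ad a Y k"
proof -
  let ?N = "max (udeg a) k"
  let ?t = "\<lambda>i j. U a i ** Y ** U a j"
  have a0: "a \<noteq> 0" using a zero_notin_Phi by blast
  have "conj_by (u a x) Y = (\<Sum>i\<le>?N. \<Sum>j\<le>?N. mat (x ^ i * (- x) ^ j) ** ?t i j)"
    unfolding conj_by_u[OF a] unfolding u_expand[OF a max.cobounded1[of _ k]]
    by (simp only: matrix_mult_sum_left matrix_mult_sum_right mult_scale_triple) (rule sum.swap)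
  moreover have "component (c + frag_cmul (int k) a) (mat (x ^ i * (- x) ^ j) ** ?t i j) =
      (if j = k - i \<and> i \<le> k then mat (x ^ k) ** (mat ((- 1) ^ (k - i)) ** ?t i (k - i)) else 0)" for i j
  proof -
    have deg: "deg_in {c + frag_cmul (int (i + j)) a} (?t i j)"
      by (rule deg_in_mult[OF deg_in_mult[OF deg_in_U[OF a] Y] deg_in_U[OF a]])
        (auto simp: frag_cmul_distrib)
    show ?thesis
    proof (cases "i + j = k")
      case True
      then have "component (c + frag_cmul (int k) a) (?t i j) = ?t i j"
        using deg by (auto intro: component_self)
      moreover have "x ^ i * (- x) ^ j = x ^ k * (- 1) ^ j"
        using True power_minus[of x j] by (auto simp: power_add)
      ultimately show ?thesis using True by (auto simp: component_scale mat_mult_mat)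
    next
      case False
      then have "c + frag_cmul (int k) a \<noteq> c + frag_cmul (int (i + j)) a"
        using frag_cmul_cancel[OF a0] by simp
      then have "component (c + frag_cmul (int k) a) (?t i j) = 0"
        using deg by (rule component_other[rotated])
      moreover have "\<not> (j = k - i \<and> i \<le> k)" using False by auto
      ultimately show ?thesis by (simp only: component_scale matrix_mult_zero if_False)
    qed
  qed
  ultimately have "component (c + frag_cmul (int k) a) (conj_by (u a x) Y) =
      (\<Sum>i\<le>?N. \<Sum>j\<le>?N. if j = k - i \<and> i \<le> k then mat (x ^ k) ** (mat ((- 1) ^ (k - i)) ** ?t i (k - i)) else 0)"
    by (simp add: component_sum)
  also have "\<dots> = (\<Sum>i\<le>?N. if i \<le> k then mat (x ^ k) ** (mat ((- 1) ^ (k - i)) ** ?t i (k - i)) else 0)"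
  proof (rule sum.cong[OF refl])
    fix i
    have "k - i \<le> ?N" by simp
    then show "(\<Sum>j\<le>?N. if j = k - i \<and> i \<le> k then mat (x ^ k) ** (mat ((- 1) ^ (k - i)) ** ?t i (k - i)) else 0) =
        (if i \<le> k then mat (x ^ k) ** (mat ((- 1) ^ (k - i)) ** ?t i (k - i)) else 0)"
      by (cases "i \<le> k") simp_all
  qed
  also have "\<dots> = (\<Sum>i\<le>k. mat (x ^ k) ** (mat ((- 1) ^ (k - i)) ** ?t i (k - i)))"
    by (rule sum.mono_neutral_cong_right) auto
  finally show ?thesis by (simp add: Ad_def matrix_mult_sum_right)
qed

lemma Ad_0: "a \<in> \<Phi> \<Longrightarrow> Ad a Y 0 = Y"
  by (simp add: Ad_def U_zero)

lemma Ad_Suc: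
  assumes a: "a \<in> \<Phi>"
  shows "mat (of_nat (Suc k)) ** Ad a Y (Suc k) = lie_bracket (E a) (Ad a Y k)"
proof -
  let ?t = "\<lambda>i j. mat ((- 1) ^ j) ** (U a i ** Y ** U a j)"
  \<comment> \<open>The factor \<open>Suc k\<close> is split as \<open>i + (Suc k - i)\<close>; by
    \<open>U_Suc\<close> the first summand lowers the left divided power and the second the right
    one.\<close>
  have "mat (of_nat (Suc k)) ** Ad a Y (Suc k) = (\<Sum>i\<le>Suc k. mat (of_nat i) ** ?t i (Suc k - i)) +
      (\<Sum>i\<le>Suc k. mat (of_nat (Suc k - i)) ** ?t i (Suc k - i))"
    unfolding Ad_def matrix_mult_sum_right sum.distrib[symmetric] mat_add_mult[symmetric]
    by (intro sum.cong) (auto simp flip: of_nat_add)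
  also have "(\<Sum>i\<le>Suc k. mat (of_nat i) ** ?t i (Suc k - i)) = (\<Sum>i\<le>k. mat (of_nat (Suc i)) ** ?t (Suc i) (k - i))"
    by (subst sum.atMost_Suc_shift) simp
  also have "\<dots> = (\<Sum>i\<le>k. E a ** ?t i (k - i))"
  proof (rule sum.cong[OF refl])
    fix i
    have "mat (of_nat (Suc i)) ** ?t (Suc i) (k - i) = mat ((- 1) ^ (k - i)) ** ((mat (of_nat (Suc i)) ** U a (Suc i)) ** Y ** U a (k - i))"
      by (simp only: mat_mult_mat mult.commute matrix_mul_assoc[symmetric])
    also have "\<dots> = mat ((- 1) ^ (k - i)) ** (E a ** (U a i ** Y ** U a (k - i)))"
      by (simp only: U_Suc(1)[OF a] matrix_mul_assoc)
    also have "\<dots> = E a ** ?t i (k - i)"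
      by (rule mult_mat_left[symmetric])
    finally show "mat (of_nat (Suc i)) ** ?t (Suc i) (k - i) = E a ** ?t i (k - i)" .
  qed
  also have "\<dots> = E a ** Ad a Y k" by (simp add: Ad_def matrix_mult_sum_right)
  also have "(\<Sum>i\<le>Suc k. mat (of_nat (Suc k - i)) ** ?t i (Suc k - i)) = (\<Sum>i\<le>k. mat (of_nat (Suc (k - i))) ** ?t i (Suc (k - i)))"
  proof -
    have "(\<Sum>i\<le>Suc k. mat (of_nat (Suc k - i)) ** ?t i (Suc k - i)) = (\<Sum>i\<le>k. mat (of_nat (Suc k - i)) ** ?t i (Suc k - i))"
      by simp
    also have "\<dots> = (\<Sum>i\<le>k. mat (of_nat (Suc (k - i))) ** ?t i (Suc (k - i)))"
      by (rule sum.cong[OF refl]) (simp only: Suc_diff_le atMost_iff)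
    finally show ?thesis .
  qed
  also have "\<dots> = (\<Sum>i\<le>k. - (?t i (k - i) ** E a))"
  proof (rule sum.cong[OF refl])
    fix i
    have "mat (of_nat (Suc (k - i))) ** ?t i (Suc (k - i)) =
        mat ((- 1) ^ Suc (k - i)) ** (U a i ** Y ** (mat (of_nat (Suc (k - i))) ** U a (Suc (k - i))))"
      by (simp only: mat_mult_mat mult_mat_left[of "U a i ** Y"] mult.commute)
    also have "\<dots> = - (mat ((- 1) ^ (k - i)) ** (U a i ** Y ** (U a (k - i) ** E a)))"
      by (simp only: U_Suc(2)[OF a] power_Suc mat_mult_mat[symmetric] mat_minus_one)
    also have "\<dots> = - (?t i (k - i) ** E a)"
      by (simp only: matrix_mul_assoc)
    finally show "mat (of_nat (Suc (k - i))) ** ?t i (Suc (k - i)) = - (?t i (k - i) ** E a)" .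
  qed
  also have "\<dots> = - (Ad a Y k ** E a)" by (simp add: Ad_def matrix_mult_sum_left sum_negf)
  finally show ?thesis by (simp add: lie_bracket_def)
qed

lemma Ad_1: "a \<in> \<Phi> \<Longrightarrow> Ad a Y 1 = lie_bracket (E a) Y"
  using Ad_Suc[of a 0 Y] by (simp add: Ad_0)

lemma Ad_2: "a \<in> \<Phi> \<Longrightarrow> mat 2 ** Ad a Y 2 = lie_bracket (E a) (lie_bracket (E a) Y)"
  using Ad_Suc[of a 1 Y] Ad_1[of a Y] by (simp add: numeral_2_eq_2)

lemma Ad_eq_component:
  assumes "a \<in> \<Phi>" "deg_in {c} Y"
  shows "Ad a Y k = component (c + frag_cmul (int k) a) (conj_by (u a 1) Y)"
  using component_conj_by_u[OF assms, of k 1] by simp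

lemma Ad_LA: "a \<in> \<Phi> \<Longrightarrow> deg_in {c} Y \<Longrightarrow> Y \<in> LA \<Longrightarrow> Ad a Y k \<in> LA"
  by (simp add: Ad_eq_component component_LA lie_algebra_conj_by[OF subgroup_G] u_G)

lemma deg_in_Ad: "a \<in> \<Phi> \<Longrightarrow> deg_in {c} Y \<Longrightarrow> deg_in {c + frag_cmul (int k) a} (Ad a Y k)"
  by (simp add: Ad_eq_component deg_in_component)

lemma conj_by_u_fixed:
  assumes a: "a \<in> \<Phi>" and Y: "deg_in {c} Y" and Ad: "\<And>k. 0 < k \<Longrightarrow> Ad a Y k = 0"
  shows "conj_by (u a x) Y = Y"
proof (rule eq_by_components)
  fix d
  have a0: "a \<noteq> 0" using a zero_notin_Phi by blast
  show "component d (conj_by (u a x) Y) = component d Y"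
  proof (cases "\<exists>k. d = c + frag_cmul (int k) a")
    case True
    then obtain k where k: "d = c + frag_cmul (int k) a" by blast
    show ?thesis
    proof (cases "k = 0")
      case True
      then show ?thesis using component_conj_by_u[OF a Y, of 0 x] k Y by (simp add: Ad_0 a component_self)
    next
      case False
      then have "d \<noteq> c" using k a0 by simp
      then show ?thesis using component_conj_by_u[OF a Y, of k x] k False Ad Y by (simp add: component_other)
    qed
  next
    case False
    then have "d \<noteq> c" using frag_cmul_zero2 by (metis add.right_neutral frag_cmul_zero of_nat_0)
    then show ?thesis
      using component_deg_in[OF deg_in_conj_by_u[OF a Y]] False component_other[OF Y] by auto
  qed
qed

lemma Ad_self: "a \<in> \<Phi> \<Longrightarrow> 0 < k \<Longrightarrow> Ad a (mat z ** E a) k = 0"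
proof (induction k)
  case (Suc k)
  have "lie_bracket (E a) (Ad a (mat z ** E a) k) = 0"
    using Suc by (cases "k = 0") (simp_all add: Ad_0 lie_bracket_scale)
  then have "mat (of_nat (Suc k)) ** Ad a (mat z ** E a) (Suc k) = 0"
    using Ad_Suc Suc.prems by metis
  then show ?case by (simp add: mat_mult_eq_0_iff del: of_nat_Suc)
qed simp

subsection \<open>Rank one\<close>

lemma neg_simple_Phi: "c \<in> S \<Longrightarrow> - frag_of c \<in> \<Phi>"
  using sr.uminus_Phi simple_in_Phi by blast

lemma rneg_chi: "rneg Q (chi a) = chi (- a)"
  by (rule sym, rule chi_eqI) (simp_all add: char_neg_def chi_uminus)

lemma nr_eq: "c \<in> S \<Longrightarrow> nr c = u (frag_of c) 1 ** u (- frag_of c) (- 1) ** u (frag_of c) 1"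
  unfolding nrep_def using rneg_chi[of "frag_of c"] by (simp add: chi_frag_of)

lemma conj_by_nr:
  assumes c: "c \<in> S"
  shows "conj_by (nr c) X = conj_by (u (frag_of c) 1) (conj_by (u (- frag_of c) (- 1)) (conj_by (u (frag_of c) 1) X))"
  using c by (simp add: nr_eq conj_by_conj_by G_invertible u_G simple_in_Phi neg_simple_Phi invertible_mult matrix_mul_assoc)

text \<open>Of the three factors of \<open>nr c\<close> the first to act fixes \<open>X\<close>, and
  the last is moved to the other side. Weights then descend from \<open>d\<close> on the left and
  ascend from the reflected weight on the right, so components can be compared.\<close>

lemma rank_one_equation:
  assumes c: "c \<in> S" and X: "deg_in {d} X" and Ad: "\<And>k. 0 < k \<Longrightarrow> Ad (frag_of c) X k = 0"
  shows "conj_by (u (- frag_of c) (- 1)) X = conj_by (u (frag_of c) (- 1)) (conj_by (nr c) X)"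
proof -
  let ?a = "frag_of c"
  have a: "?a \<in> \<Phi>" using simple_in_Phi c by blast
  have "conj_by (nr c) X = conj_by (u ?a 1) (conj_by (u (- ?a) (- 1)) X)"
    using conj_by_nr[OF c] conj_by_u_fixed[OF a X Ad] by simp
  then have "conj_by (matrix_inv (u ?a 1)) (conj_by (nr c) X) = conj_by (u (- ?a) (- 1)) X"
    using a by (simp add: conj_by_inverse G_invertible u_G)
  then show ?thesis using a by (simp add: u_inverse)
qed

text \<open>If \<open>m \<ge> 2\<close> is maximal such that \<open>m c\<close> is a root, then \<open>rank_one_equation\<close> for a vector
  of weight \<open>m c\<close> has a nonzero component of weight \<open>m c\<close> on the left. On the right
  the component of weight \<open>c\<close> is a multiple of the root vector, so all later ones vanish.\<close>

lemma reduced_root_system: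
  assumes c: "c \<in> S" and k: "frag_cmul k (frag_of c) \<in> \<Phi>"
  shows "k = 1 \<or> k = - 1"
proof -
  let ?a = "frag_of c"
  let ?K = "{j. frag_cmul j ?a \<in> \<Phi>}"
  have a: "?a \<in> \<Phi>" and b: "- ?a \<in> \<Phi>" using simple_in_Phi neg_simple_Phi c by auto
  have a0: "?a \<noteq> 0" by simp
  have "inj_on (\<lambda>j. frag_cmul j ?a) ?K" using frag_cmul_cancel[OF a0] by (auto intro: inj_onI)
  then have fin: "finite ?K" by (rule inj_on_finite[OF _ _ finite_Phi]) auto
  define M where "M = Max ?K"
  have one: "1 \<in> ?K" using a by simp
  then have ne: "?K \<noteq> {}" by blast
  have M: "frag_cmul M ?a \<in> \<Phi>" and M1: "1 \<le> M" and max: "\<And>j. frag_cmul j ?a \<in> \<Phi> \<Longrightarrow> j \<le> M"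
    using Max_in[OF fin ne] Max_ge[OF fin] one unfolding M_def by auto
  define m where "m = nat M"
  have m: "M = int m" using M1 by (simp add: m_def)
  have "m < 2"
  proof (rule ccontr)
    assume "\<not> m < 2"
    then have m2: "2 \<le> m" by simp
    let ?X = "E (frag_cmul M ?a)"
    have degX: "deg_in {frag_cmul M ?a} ?X" using deg_in_E M by blast
    have "Ad ?a ?X k = 0" if "0 < k" for k
    proof (rule ccontr)
      assume nz: "Ad ?a ?X k \<noteq> 0"
      have eq: "frag_cmul M ?a + frag_cmul (int k) ?a = frag_cmul (M + int k) ?a"
        by (simp add: frag_cmul_distrib)
      have "deg_in {frag_cmul (M + int k) ?a} (Ad ?a ?X k)"
        using deg_in_Ad[OF a degX] eq by metis
      moreover have "frag_cmul (M + int k) ?a \<noteq> 0" using M1 by simp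
      ultimately have "frag_cmul (M + int k) ?a \<in> \<Phi>"
        using LA_weight_vector(1) nz Ad_LA[OF a degX E_LA[OF M]] by blast
      then show False using max that by fastforce
    qed
    then have eq: "conj_by (u (- ?a) (- 1)) ?X = conj_by (u ?a (- 1)) (conj_by (nr c) ?X)"
      using rank_one_equation[OF c degX] by blast
    let ?F = "conj_by (nr c) ?X"
    have degF: "deg_in {frag_cmul (- M) ?a} ?F"
      using deg_in_conj_by[OF nr_Nrm[OF c] Phi_Lat[OF M] degX] by (simp add: lact_cmul lact_nr_simple c)
    have F: "?F \<in> LA" using lie_algebra_conj_by[OF subgroup_G] Nrm_G nr_Nrm c E_LA[OF M] by blast
    \<comment> \<open>From weight \<open>- M\<close> times \<open>c\<close> it takes
      \<open>m + 1\<close> steps to reach weight \<open>c\<close>, where the Lie algebra is spanned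
      by \<open>E ?a\<close>.\<close>
    have "frag_cmul (- M) ?a + frag_cmul (int (Suc m)) ?a = ?a"
      by (simp add: m flip: frag_cmul_distrib)
    then have "deg_in {?a} (Ad ?a ?F (Suc m))"
      using deg_in_Ad[OF a degF, of "Suc m"] by simp
    then have "\<exists>z. Ad ?a ?F (Suc m) = mat z ** E ?a"
      using LA_weight_vector(2)[OF Ad_LA[OF a degF F]] a0 by (metis mat_0 matrix_mult_zero(2))
    then have zero: "Ad ?a ?F (Suc (Suc m) + i) = 0" for i
    proof (induction i)
      case 0
      then obtain z where "Ad ?a ?F (Suc m) = mat z ** E ?a" by blast
      then have "mat (of_nat (Suc (Suc m))) ** Ad ?a ?F (Suc (Suc m)) = 0"
        by (simp only: Ad_Suc[OF a] lie_bracket_scale lie_bracket_zero matrix_mult_zero)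
      then show ?case by (simp add: mat_mult_eq_0_iff del: of_nat_Suc)
    next
      case (Suc i)
      then have "mat (of_nat (Suc (Suc (Suc m) + i))) ** Ad ?a ?F (Suc (Suc (Suc m) + i)) = 0"
        by (simp only: Ad_Suc[OF a] lie_bracket_zero)
      then show ?case by (simp add: mat_mult_eq_0_iff del: of_nat_Suc)
    qed
    have "component (frag_cmul (- M) ?a + frag_cmul (int (2 * m)) ?a) (conj_by (u ?a (- 1)) ?F) =
        mat ((- 1) ^ (2 * m)) ** Ad ?a ?F (2 * m)"
      by (rule component_conj_by_u[OF a degF])
    \<comment> \<open>Here \<open>m \<ge> 2\<close> enters, in the form
      \<open>m + 2 \<le> 2 * m\<close>: the vanishing range includes the index that leads back to
      weight \<open>M\<close>.\<close>
    moreover have "Ad ?a ?F (2 * m) = 0"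
    proof -
      have "Suc (Suc m) + (m - 2) = 2 * m" using m2 by simp
      then show ?thesis using zero[of "m - 2"] by (simp only:)
    qed
    moreover have "frag_cmul (- M) ?a + frag_cmul (int (2 * m)) ?a = frag_cmul M ?a"
      by (simp add: m flip: frag_cmul_distrib)
    ultimately have "component (frag_cmul M ?a) (conj_by (u ?a (- 1)) ?F) = 0" by simp
    moreover have "component (frag_cmul M ?a) (conj_by (u (- ?a) (- 1)) ?X) = ?X"
      using component_conj_by_u[OF b degX, of 0 "- 1"] by (simp add: Ad_0 b)
    ultimately show False using eq E_nonzero[OF M] by simp
  qed
  then have "k \<le> 1" using max[OF k] m by simp
  moreover have "- k \<le> 1"
  proof -
    have "frag_cmul (- k) ?a \<in> \<Phi>" using sr.uminus_Phi[OF k] by simp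
    then show ?thesis using max[of "- k"] \<open>m < 2\<close> m by simp
  qed
  moreover have "k \<noteq> 0" using k zero_notin_Phi by auto
  ultimately show ?thesis by linarith
qed

text \<open>Write \<open>E_c\<close>, \<open>F\<close> and \<open>H = [E_c, F]\<close> for the root
  vectors of \<open>c\<close> and \<open>-c\<close> and their bracket. Then
  \<open>Ad(n_c) E_c = z F\<close> for some \<open>z\<close>. In the rank one equation weight 0
  gives \<open>H = - z H\<close>, and weight \<open>c\<close> gives
  \<open>2 E_c = z [E_c, H]\<close>. The latter shows \<open>H \<noteq> 0\<close>, so
  \<open>z = - 1\<close>.\<close>

lemma sl2_relation:
  assumes c: "c \<in> S"
  shows "lie_bracket (lie_bracket (E (frag_of c)) (E (- frag_of c))) (E (frag_of c)) = mat 2 ** E (frag_of c)"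
proof -
  let ?a = "frag_of c" and ?b = "- frag_of c :: 'n character \<Rightarrow>\<^sub>0 int"
  let ?H = "lie_bracket (E ?a) (E ?b)"
  have a: "?a \<in> \<Phi>" and b: "?b \<in> \<Phi>" using simple_in_Phi neg_simple_Phi c by auto
  have degF: "deg_in {?b} (conj_by (nr c) (E ?a))"
    using deg_in_conj_by[OF nr_Nrm[OF c] Phi_Lat[OF a] deg_in_E[OF a]] lact_nr_simple[OF c] by simp
  have "conj_by (nr c) (E ?a) \<in> LA"
    using lie_algebra_conj_by[OF subgroup_G] Nrm_G nr_Nrm c E_LA[OF a] by blast
  then obtain z where z: "conj_by (nr c) (E ?a) = mat z ** E ?b"
    using LA_weight_vector(2)[OF _ degF] by (metis mat_0 matrix_mult_zero(2) b zero_notin_Phi)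
  have "conj_by (u ?b (- 1)) (E ?a) = conj_by (u ?a (- 1)) (conj_by (nr c) (E ?a))"
    using rank_one_equation[OF c deg_in_E[OF a]] Ad_self[OF a, of _ 1] by simp
  then have eq: "conj_by (u ?b (- 1)) (E ?a) = conj_by (u ?a (- 1)) (mat z ** E ?b)"
    by (simp add: z)
  have degF': "deg_in {?b} (mat z ** E ?b)" using deg_in_E[OF b] by (rule deg_in_scale)
  have left0: "component 0 (conj_by (u ?b (- 1)) (E ?a)) = ?H"
    using component_conj_by_u[OF b deg_in_E[OF a], of 1 "- 1"] Ad_1[OF b, of "E ?a"]
    by (simp add: mat_minus_one lie_bracket_swap[of "E ?b"])
  have right0: "component 0 (conj_by (u ?a (- 1)) (mat z ** E ?b)) = - (mat z ** ?H)"
    using component_conj_by_u[OF a degF', of 1 "- 1"] Ad_1[OF a, of "mat z ** E ?b"]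
    by (simp add: mat_minus_one lie_bracket_scale)
  have lefta: "component ?a (conj_by (u ?b (- 1)) (E ?a)) = E ?a"
    using component_conj_by_u[OF b deg_in_E[OF a], of 0 "- 1"] by (simp add: Ad_0 b)
  have "?b + frag_cmul (int 2) ?a = ?a"
    using frag_cmul_distrib[of 1 1 ?a] by simp
  then have righta: "component ?a (conj_by (u ?a (- 1)) (mat z ** E ?b)) = Ad ?a (mat z ** E ?b) 2"
    using component_conj_by_u[OF a degF', of 2 "- 1"] by simp
  have 2: "mat 2 ** E ?a = mat z ** lie_bracket (E ?a) ?H"
    using Ad_2[OF a, of "mat z ** E ?b"] lefta righta eq by (simp add: lie_bracket_scale)
  have "?H \<noteq> 0"
  proof
    assume "?H = 0"
    then have "mat 2 ** E ?a = 0" using 2 by simp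
    then show False using E_nonzero[OF a] by (simp add: mat_mult_eq_0_iff)
  qed
  moreover have "mat (1 + z) ** ?H = 0"
  proof -
    have "?H = - (mat z ** ?H)" using left0 right0 eq by metis
    then have "?H + mat z ** ?H = 0" by (metis add.left_inverse)
    then show ?thesis by (simp add: mat_add_mult)
  qed
  ultimately have "1 + z = 0" unfolding mat_mult_eq_0_iff by blast
  then have "z = - 1" by (simp add: add_eq_0_iff minus_equation_iff)
  then show ?thesis using 2 by (simp add: mat_minus_one flip: lie_bracket_swap)
qed

sublocale sr: reduced_simple_reflections \<Phi> S "\<lambda>c. lact (nr c)"
  by unfold_locales (rule reduced_root_system)

subsection \<open>Conjugation of root homomorphisms\<close>

definition tc :: "'n cmat \<Rightarrow> 'n cmat set" where
  "tc n = (\<lambda>t. t ** n) ` T"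

lemma r_coset_tc: "T #>\<^bsub>GLn\<^esub> n = tc n" "T #>\<^bsub>GG Q\<^esub> n = tc n" "T #>\<^bsub>(GG Q)\<lparr>carrier := Nrm\<rparr>\<^esub> n = tc n"
  unfolding r_coset_def tc_def by auto

lemma sref_tc: "sref Q c = tc (nr c)"
  unfolding sref_def by (rule r_coset_tc)

lemma wact_tc: "n \<in> Nrm \<Longrightarrow> wact Q (tc n) c = cact n c"
  using wact_coset unfolding r_coset_tc .

lemma conj_by_nr_u:
  assumes "c \<in> S" "a \<in> \<Phi>"
  shows "\<exists>e\<in>{1, - 1}. \<forall>x. conj_by (nr c) (u a x) = u (lact (nr c) a) (e * x)"
proof -
  have "\<exists>e\<in>{1, - 1}. \<forall>x. nr c ** u a x ** matrix_inv (nr c) = rhom Q (wact Q (sref Q c) (chi a)) (e * x)"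
    using pinned assms by (simp add: pinned_semisimple_adjoint_group_def \<Phi>_def)
  moreover have "wact Q (sref Q c) (chi a) = chi (lact (nr c) a)"
    using assms by (simp add: sref_tc wact_tc nr_Nrm chi_lact Phi_Lat)
  ultimately show ?thesis by (simp add: conj_by_def)
qed

section \<open>Representatives of words of simple reflections\<close>

primrec nword :: "'n character list \<Rightarrow> 'n cmat" where
  "nword [] = mat 1"
| "nword (c # cs) = nr c ** nword cs"

lemma nword_Nrm: "set cs \<subseteq> S \<Longrightarrow> nword cs \<in> Nrm"
  by (induction cs) (auto simp: T_Nrm T_one Nrm_mult nr_Nrm)

lemma nword_append: "nword (cs @ ds) = nword cs ** nword ds"
  by (induction cs) (simp_all add: matrix_mul_assoc)

lemma lact_nword: "set cs \<subseteq> S \<Longrightarrow> a \<in> Lat \<Longrightarrow> lact (nword cs) a = sr.act cs a"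
  by (induction cs) (auto simp: lact_one lact_mult nr_Nrm nword_Nrm)

lemma conj_by_nword_u:
  assumes "set cs \<subseteq> S" "a \<in> \<Phi>"
  shows "\<exists>e\<in>{1, - 1}. \<forall>x. conj_by (nword cs) (u a x) = u (sr.act cs a) (e * x)"
  using assms(1)
proof (induction cs)
  case (Cons c cs)
  then have c: "c \<in> S" and cs: "set cs \<subseteq> S" by auto
  obtain e where e: "e \<in> {1, - 1}" "\<And>x. conj_by (nword cs) (u a x) = u (sr.act cs a) (e * x)"
    using Cons.IH[OF cs] by blast
  have act: "sr.act cs a \<in> \<Phi>" using sr.act_Phi cs assms(2) by simp
  obtain e' where e': "e' \<in> {1, - 1}" "\<And>x. conj_by (nr c) (u (sr.act cs a) x) = u (lact (nr c) (sr.act cs a)) (e' * x)"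
    using conj_by_nr_u[OF c act] by blast
  have "conj_by (nword (c # cs)) (u a x) = u (sr.act (c # cs) a) ((e' * e) * x)" for x
  proof -
    have "conj_by (nword (c # cs)) (u a x) = conj_by (nr c) (conj_by (nword cs) (u a x))"
      using Cons.prems by (simp add: conj_by_conj_by Nrm_invertible nr_Nrm nword_Nrm)
    then show ?thesis using e e' by (simp add: mult.assoc)
  qed
  moreover have "e' * e \<in> {1, - 1}" using e(1) e'(1) by auto
  ultimately show ?case by blast
qed (auto intro: bexI[of _ 1])

lemma component_u: "a \<in> \<Phi> \<Longrightarrow> component a (u a x) = mat x ** E a"
proof -
  assume a: "a \<in> \<Phi>"
  then have a0: "a \<noteq> 0" using zero_notin_Phi by blast
  have "component a (u a x) = (\<Sum>k\<le>max (udeg a) 1. component a (mat (x ^ k) ** U a k))"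
    by (simp add: u_expand[OF a max.cobounded1[of _ 1]] component_sum)
  also have "\<dots> = (\<Sum>k\<le>max (udeg a) 1. if k = 1 then mat x ** E a else 0)"
  proof (rule sum.cong[OF refl])
    fix k
    show "component a (mat (x ^ k) ** U a k) = (if k = 1 then mat x ** E a else 0)"
    proof (cases "k = 1")
      case True
      then show ?thesis using U_one[OF a] component_self[OF deg_in_E[OF a]] by (simp add: component_scale)
    next
      case False
      then have "a \<noteq> frag_cmul (int k) a"
        using frag_cmul_cancel[OF a0, of 1 "int k"] by auto
      then show ?thesis using False component_other[OF deg_in_U[OF a]] by (simp add: component_scale)
    qed
  qed
  finally show ?thesis by simp
qed

lemma conj_by_E:
  assumes n: "n \<in> Nrm" and a: "a \<in> \<Phi>" and e: "\<And>x. conj_by n (u a x) = u (lact n a) (e * x)"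
  shows "conj_by n (E a) = mat e ** E (lact n a)"
  using component_conj_Nrm[OF n Phi_Lat[OF a], of "u a 1"] e[of 1]
  by (simp add: component_u a lact_Phi n)

lemma torus_minus_one:
  assumes c: "c \<in> S"
  obtains t where "t \<in> T" "chi (frag_of c) t = - 1"
proof -
  obtain h where h: "cocharacter T h" "\<And>z. z \<noteq> 0 \<Longrightarrow> c (h z) = z\<^sup>2"
    using reflection_cact[OF c] by metis
  \<comment> \<open>The coroot is evaluated at \<open>\<i>\<close> because \<open>c (h z)\<close> is
    the square of \<open>z\<close>.\<close>
  have "h \<i> \<in> T" using h(1) by (simp add: cocharacter_def)
  moreover have "chi (frag_of c) (h \<i>) = - 1" using c h(2)[of "\<i>"] by (simp add: chi_frag_of)
  ultimately show thesis using that by blast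
qed

lemma nr_inverse:
  assumes c: "c \<in> S"
  shows "matrix_inv (nr c) = u (frag_of c) (- 1) ** u (- frag_of c) 1 ** u (frag_of c) (- 1)"
  using c by (simp add: nr_eq matrix_inv_mult G_invertible u_G simple_in_Phi neg_simple_Phi invertible_mult
      u_inverse matrix_mul_assoc)

text \<open>A torus element on which \<open>c\<close> is \<open>- 1\<close> reverses the signs of
  all three parameters in \<open>nr c\<close>, so conjugation by it gives the inverse. As
  \<open>nr c\<close> normalises \<open>T\<close>, the two differ by a torus element; hence simple
  reflections are involutions in the Weyl group.\<close>

lemma nr_inverse_torus:
  assumes c: "c \<in> S"
  obtains t where "t \<in> T" "matrix_inv (nr c) = t ** nr c"
proof -
  let ?a = "frag_of c"
  have a: "?a \<in> \<Phi>" and b: "- ?a \<in> \<Phi>" using simple_in_Phi neg_simple_Phi c by auto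
  obtain t where t: "t \<in> T" "chi ?a t = - 1" using torus_minus_one[OF c] .
  have "conj_by t (nr c) = u ?a (- 1) ** u (- ?a) 1 ** u ?a (- 1)"
    unfolding nr_eq[OF c] using t a b by (simp add: conj_by_mult T_invertible u_torus chi_uminus)
  then have "conj_by t (nr c) = matrix_inv (nr c)"
    unfolding nr_inverse[OF c] .
  also have "conj_by t (nr c) = t ** conj_by (nr c) (matrix_inv t) ** nr c"
    using nr_Nrm[OF c] by (simp add: conj_by_def matrix_inv_cancel Nrm_invertible matrix_mul_assoc)
  finally have "matrix_inv (nr c) = (t ** conj_by (nr c) (matrix_inv t)) ** nr c" by simp
  moreover have "t ** conj_by (nr c) (matrix_inv t) \<in> T"
    using t nr_Nrm[OF c] by (simp add: T_mult T_inv Nrm_conj)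
  ultimately show thesis using that by blast
qed

text \<open>Conjugation moves the representative of \<open>s\<^sub>c\<close> to \<open>u\<^sub>d(e) u\<^sub>-\<^sub>d(-e') u\<^sub>d(e)\<close>;
  the \<open>sl\<^sub>2\<close> relation forces \<open>e = e'\<close>.\<close>

lemma conj_by_nword_nr:
  assumes cs: "set cs \<subseteq> S" and c: "c \<in> S" and d: "d \<in> S" and cd: "sr.act cs (frag_of c) = frag_of d"
  shows "\<exists>t\<in>T. conj_by (nword cs) (nr c) = t ** nr d"
proof -
  let ?n = "nword cs"
  let ?a = "frag_of c" and ?b = "frag_of d"
  have n: "?n \<in> Nrm" using nword_Nrm cs by blast
  have inv: "invertible ?n" using Nrm_invertible n by blast
  have roots: "?a \<in> \<Phi>" "- ?a \<in> \<Phi>" "?b \<in> \<Phi>" "- ?b \<in> \<Phi>" using simple_in_Phi neg_simple_Phi c d by auto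
  have la: "lact ?n ?a = ?b" "lact ?n (- ?a) = - ?b"
    using cd lact_nword[OF cs] Phi_Lat[OF roots(1)] by (simp_all add: lact_uminus)
  obtain e where e: "e \<in> {1, - 1}" "\<And>x. conj_by ?n (u ?a x) = u ?b (e * x)"
    using conj_by_nword_u[OF cs roots(1)] unfolding cd by blast
  obtain e' where e': "e' \<in> {1, - 1}" "\<And>x. conj_by ?n (u (- ?a) x) = u (- ?b) (e' * x)"
    using conj_by_nword_u[OF cs roots(2)] unfolding sr.act_uminus[OF cs] cd by blast
  have E: "conj_by ?n (E ?a) = mat e ** E ?b" using conj_by_E[OF n roots(1), of e] la e by simp
  have E': "conj_by ?n (E (- ?a)) = mat e' ** E (- ?b)" using conj_by_E[OF n roots(2), of e'] la e' by simp
  have "conj_by ?n (lie_bracket (lie_bracket (E ?a) (E (- ?a))) (E ?a)) = conj_by ?n (mat 2 ** E ?a)"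
    using sl2_relation[OF c] by simp
  then have "mat (e * e' * e) ** lie_bracket (lie_bracket (E ?b) (E (- ?b))) (E ?b) = mat (2 * e) ** E ?b"
    using inv by (simp add: conj_by_lie_bracket conj_by_scale E E' lie_bracket_scale mat_mult_mat mult_ac)
  then have "mat (e * e' * e * 2) ** E ?b = mat (2 * e) ** E ?b"
    by (simp add: sl2_relation[OF d] mat_mult_mat)
  then have "mat (e * e' * e * 2 - 2 * e) ** E ?b = 0"
    by (simp add: vec_eq_iff algebra_simps)
  then have "e * e' * e * 2 - 2 * e = 0"
    using E_nonzero[OF roots(3)] unfolding mat_mult_eq_0_iff by blast
  then have ee: "e' = e" using e(1) e'(1) by auto
  have conj: "conj_by ?n (nr c) = u ?b e ** u (- ?b) (- e) ** u ?b e"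
    unfolding nr_eq[OF c] using inv by (simp add: conj_by_mult e e' ee)
  show ?thesis
  \<comment> \<open>For \<open>e = 1\<close> the conjugate is \<open>nr d\<close>; for
    \<open>e = - 1\<close> it is the inverse of \<open>nr d\<close>, which lies in the same coset of
    \<open>T\<close>.\<close>
  proof (cases "e = 1")
    case True
    then have "conj_by ?n (nr c) = mat 1 ** nr d" using conj by (simp add: nr_eq[OF d])
    then show ?thesis using T_one by blast
  next
    case False
    then have "conj_by ?n (nr c) = matrix_inv (nr d)" using conj e(1) by (simp add: nr_inverse[OF d])
    then show ?thesis using nr_inverse_torus[OF d] by metis
  qed
qed

subsection \<open>The Weyl group\<close>

lemma tc_torus: "t \<in> T \<Longrightarrow> tc (t ** n) = tc n"
proof
  assume t: "t \<in> T"
  show "tc (t ** n) \<subseteq> tc n"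
  proof
    fix x assume "x \<in> tc (t ** n)"
    then obtain s where "s \<in> T" "x = (s ** t) ** n" by (auto simp: tc_def matrix_mul_assoc)
    then show "x \<in> tc n" using t T_mult unfolding tc_def by blast
  qed
  show "tc n \<subseteq> tc (t ** n)"
  proof
    fix x assume "x \<in> tc n"
    then obtain s where s: "s \<in> T" "x = s ** n" by (auto simp: tc_def)
    then have "x = (s ** matrix_inv t) ** (t ** n)"
      using t by (simp add: matrix_mul_assoc matrix_inv_cancel T_invertible)
    then show "x \<in> tc (t ** n)" using s t T_mult T_inv unfolding tc_def by blast
  qed
qed

lemma self_in_tc: "n \<in> tc n"
  unfolding tc_def using T_one by (intro image_eqI[of _ _ "mat 1"]) simp_all

lemma tc_one: "tc (mat 1) = T"
  by (simp add: tc_def)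

lemma tc_eqD: "tc n = tc n' \<Longrightarrow> \<exists>t\<in>T. n = t ** n'"
  using self_in_tc[of n] by (auto simp: tc_def)

lemma lact_tc: "tc n = tc n' \<Longrightarrow> n' \<in> Nrm \<Longrightarrow> m \<in> Lat \<Longrightarrow> lact n m = lact n' m"
  using tc_eqD[of n n'] by (auto simp: lact_mult T_Nrm lact_torus lact_Lat)

lemma group_GG: "Group.group (GG Q)"
  using subgroup.subgroup_is_group[OF subgroup_G group_GLn] by simp

lemma subgroup_T_GG: "subgroup T (GG Q)"
  using group.subgroup_incl[OF group_GLn subgroup_T subgroup_G T_subset_G] .

lemma group_Weyl: "Group.group (Weyl Q)"
  unfolding Weyl_def
  by (rule normal.factorgroup_is_group, rule group.subgroup_in_normalizer[OF group_GG subgroup_T_GG])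

lemma carrier_Weyl: "carrier (Weyl Q) = tc ` Nrm"
  by (auto simp: Weyl_def FactGroup_def RCOSETS_def r_coset_tc)

lemma one_Weyl: "\<one>\<^bsub>Weyl Q\<^esub> = T"
  by (simp add: Weyl_def FactGroup_def)

lemma mult_Weyl: "n \<in> Nrm \<Longrightarrow> tc n \<otimes>\<^bsub>Weyl Q\<^esub> tc n' = tc (n ** n')"
proof -
  assume n: "n \<in> Nrm"
  have "tc n \<otimes>\<^bsub>Weyl Q\<^esub> tc n' = {s ** n ** (t ** n') | s t. s \<in> T \<and> t \<in> T}"
    by (auto simp: Weyl_def FactGroup_def set_mult_def tc_def)
  also have "\<dots> = tc (n ** n')"
  proof (intro equalityI subsetI)
    fix x assume "x \<in> {s ** n ** (t ** n') | s t. s \<in> T \<and> t \<in> T}"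
    then obtain s t where st: "s \<in> T" "t \<in> T" "x = s ** n ** (t ** n')" by blast
    then have "x = (s ** conj_by n t) ** (n ** n')"
      using n by (simp add: conj_by_def matrix_mul_assoc matrix_inv_cancel Nrm_invertible)
    moreover have "s ** conj_by n t \<in> T" using st n by (simp add: T_mult Nrm_conj)
    ultimately show "x \<in> tc (n ** n')" unfolding tc_def by blast
  next
    fix x assume "x \<in> tc (n ** n')"
    then obtain s where "s \<in> T" "x = s ** (n ** n')" by (auto simp: tc_def)
    then have "x = s ** n ** (mat 1 ** n')" "s \<in> T" by (simp_all add: matrix_mul_assoc)
    then show "x \<in> {s ** n ** (t ** n') | s t. s \<in> T \<and> t \<in> T}" using T_one by blast
  qed
  finally show ?thesis .
qed

sublocale cox: reflection_generators \<Phi> S "\<lambda>c. lact (nr c)" "Weyl Q" "sref Q"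
proof (intro reflection_generators.intro reflection_generators_axioms.intro group_Weyl)
  show "reduced_simple_reflections \<Phi> S (\<lambda>c. lact (nr c))" by unfold_locales
  fix c assume c: "c \<in> S"
  then show "sref Q c \<in> carrier (Weyl Q)" by (simp add: sref_tc carrier_Weyl nr_Nrm)
  obtain t where t: "t \<in> T" "matrix_inv (nr c) = t ** nr c" using nr_inverse_torus[OF c] .
  have inv: "invertible (nr c)" using nr_Nrm Nrm_invertible c by blast
  have "tc (nr c ** nr c) = tc (t ** (nr c ** nr c))" using tc_torus t by simp
  also have "t ** (nr c ** nr c) = matrix_inv (nr c) ** nr c" by (simp add: t(2) matrix_mul_assoc)
  finally show "sref Q c \<otimes>\<^bsub>Weyl Q\<^esub> sref Q c = \<one>\<^bsub>Weyl Q\<^esub>"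
    using c inv by (simp add: sref_tc mult_Weyl nr_Nrm matrix_inv_left tc_one one_Weyl)
qed

lemma word_prod_tc: "set cs \<subseteq> S \<Longrightarrow> cox.word_prod cs = tc (nword cs)"
  by (induction cs) (auto simp: one_Weyl tc_one sref_tc mult_Weyl nr_Nrm)

sublocale cox: coxeter_action \<Phi> S "\<lambda>c. lact (nr c)" "Weyl Q" "sref Q"
proof (intro coxeter_action.intro coxeter_action_axioms.intro cox.reflection_generators_axioms)
  fix cs c d assume *: "set cs \<subseteq> S" "c \<in> S" "d \<in> S" "sr.act cs (frag_of c) = frag_of d"
  let ?n = "nword cs"
  have n: "?n \<in> Nrm" using nword_Nrm * by blast
  obtain t where t: "t \<in> T" "conj_by ?n (nr c) = t ** nr d" using conj_by_nword_nr * by blast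
  have "?n ** nr c = conj_by ?n (nr c) ** ?n"
    using n by (simp add: conj_by_def matrix_inv_cancel Nrm_invertible)
  then have "tc (?n ** nr c) = tc (nr d ** ?n)"
    using t tc_torus by (simp flip: matrix_mul_assoc)
  then show "cox.word_prod cs \<otimes>\<^bsub>Weyl Q\<^esub> sref Q c = sref Q d \<otimes>\<^bsub>Weyl Q\<^esub> cox.word_prod cs"
    using * n by (simp add: word_prod_tc sref_tc mult_Weyl nr_Nrm)
next
  fix cs ds a assume *: "set cs \<subseteq> S" "set ds \<subseteq> S" "cox.word_prod cs = cox.word_prod ds" "a \<in> \<Phi>"
  then have "tc (nword cs) = tc (nword ds)" by (simp add: word_prod_tc)
  then have "lact (nword cs) a = lact (nword ds) a"
    by (rule lact_tc[OF _ nword_Nrm[OF *(2)] Phi_Lat[OF *(4)]])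
  then show "sr.act cs a = sr.act ds a"
    by (simp only: lact_nword[OF *(1) Phi_Lat[OF *(4)]] lact_nword[OF *(2) Phi_Lat[OF *(4)]])
qed

subsection \<open>Positive roots and the Borel subgroup\<close>

lemma chi_eq_char_comb: "a \<in> Lat \<Longrightarrow> chi a = char_comb T S m \<Longrightarrow> a = lattice_of m"
  using chi_inj[OF _ lattice_of_Lat] chi_lattice_of by simp

lemma dominant_lattice_of: "dominant (lattice_of m) \<longleftrightarrow> (\<forall>d\<in>S. 0 \<le> m d)"
  by (auto simp: dominant_def lookup_lattice_of)

lemma chi_PosRoots_iff:
  assumes "a \<in> \<Phi>"
  shows "chi a \<in> PosRoots Q \<longleftrightarrow> dominant a"
proof
  assume "chi a \<in> PosRoots Q"
  then obtain m where "chi a = char_comb T S m" "\<forall>d\<in>S. 0 \<le> m d" by (auto simp: PosRoots_def)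
  then show "dominant a" using chi_eq_char_comb[OF Phi_Lat[OF assms]] dominant_lattice_of by simp
next
  assume "dominant a"
  then show "chi a \<in> PosRoots Q"
    using assms by (auto simp: PosRoots_def \<Phi>_def chi_def dominant_def intro!: exI[of _ "Poly_Mapping.lookup a"])
qed

lemma PosRoots_eq: "PosRoots Q = chi ` {a \<in> \<Phi>. dominant a}"
proof
  show "PosRoots Q \<subseteq> chi ` {a \<in> \<Phi>. dominant a}"
  proof
    fix c assume c: "c \<in> PosRoots Q"
    then obtain a where "a \<in> \<Phi>" "c = chi a" using Roots_eq by (auto simp: PosRoots_def)
    then show "c \<in> chi ` {a \<in> \<Phi>. dominant a}" using c chi_PosRoots_iff by blast
  qed
qed (auto simp: chi_PosRoots_iff)

lemma NegRoots_eq: "NegRoots Q = chi ` {a \<in> \<Phi>. dominant (- a)}"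
proof -
  have "{a \<in> \<Phi>. dominant (- a)} = uminus ` {a \<in> \<Phi>. dominant a}"
    using sr.uminus_Phi by force
  then show ?thesis by (simp add: NegRoots_def PosRoots_eq image_image rneg_chi)
qed

abbreviation "B \<equiv> Borel Q"

lemma Borel_generators: "T \<union> (\<Union>c\<in>PosRoots Q. range (rhom Q c)) \<subseteq> G"
  using T_subset_G by (auto simp: PosRoots_eq intro: u_G)

lemma subgroup_B: "subgroup B (GG Q)"
  unfolding Borel_def by (rule group.generate_is_subgroup[OF group_GG]) (use Borel_generators in simp)

lemma B_G: "b \<in> B \<Longrightarrow> b \<in> G" and B_one: "mat 1 \<in> B"
  and B_mult: "b \<in> B \<Longrightarrow> b' \<in> B \<Longrightarrow> b ** b' \<in> B"
  using subgroup.subset[OF subgroup_B] subgroup.one_closed[OF subgroup_B] subgroup.m_closed[OF subgroup_B, of b b']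
  by auto

lemma B_inv: "b \<in> B \<Longrightarrow> matrix_inv b \<in> B"
  using subgroup.m_inv_closed[OF subgroup_B, of b] inv_as_group[OF subgroup_G] B_G by simp

lemma B_invertible: "b \<in> B \<Longrightarrow> invertible b"
  using B_G G_invertible by blast

lemma T_B: "t \<in> T \<Longrightarrow> t \<in> B" and u_B: "a \<in> \<Phi> \<Longrightarrow> dominant a \<Longrightarrow> u a x \<in> B"
  unfolding Borel_def by (auto intro!: generate.incl simp: PosRoots_eq)

lemma deg_in_u_dominant: "a \<in> \<Phi> \<Longrightarrow> dominant a \<Longrightarrow> deg_in {m. dominant m} (u a x)"
  by (rule deg_in_mono[OF deg_in_u]) (auto intro: dominant_cmul)

lemma deg_in_T_dominant: "t \<in> T \<Longrightarrow> deg_in {m. dominant m} t"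
  by (rule deg_in_mono[OF deg_in_torus]) auto

text \<open>Generators and their inverses have degrees in the positive cone, which is closed under
  addition. Every later exclusion of an element from \<open>B\<close> rests on this bound.\<close>

lemma deg_in_Borel:
  assumes "b \<in> B"
  shows "deg_in {m. dominant m} b"
proof -
  have gen: "deg_in {m. dominant m} h \<and> deg_in {m. dominant m} (matrix_inv h)"
    if "h \<in> T \<union> (\<Union>c\<in>PosRoots Q. range (rhom Q c))" for h
    using that by (auto simp: PosRoots_eq u_inverse deg_in_u_dominant deg_in_T_dominant T_inv)
  show ?thesis
    using assms unfolding Borel_def
  proof (induction rule: generate.induct)
    case one
    then show ?case by (simp add: deg_in_one)
  next
    case (incl h)
    then show ?case using gen by blast
  next
    case (inv h)
    then have "h \<in> G" using Borel_generators by blast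
    then show ?case using gen[OF inv] inv_as_group[OF subgroup_G] by simp
  next
    case (eng h1 h2)
    then show ?case by (auto intro: deg_in_mult dominant_add)
  qed
qed

lemma u_neg_simple_B:
  assumes c: "c \<in> S" and "u (- frag_of c) x \<in> B"
  shows "x = 0"
proof -
  have b: "- frag_of c \<in> \<Phi>" using neg_simple_Phi c by blast
  have "\<not> dominant (- frag_of c)" using sr.sign_exclusive[OF simple_in_Phi[OF c]] by simp
  then have "component (- frag_of c) (u (- frag_of c) x) = 0"
    using component_deg_in[OF deg_in_Borel[OF assms(2)]] by simp
  then show ?thesis using component_u[OF b] E_nonzero[OF b] by (simp add: mat_mult_eq_0_iff)
qed

lemma Parabolic_generators:
  assumes "c \<in> S"
  shows "B \<union> sref Q c \<subseteq> G"
proof -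
  have "nr c \<in> G" using Nrm_G nr_Nrm assms by blast
  then have "sref Q c \<subseteq> G" using T_subset_G G_mult by (auto simp: sref_tc tc_def)
  then show ?thesis using B_G by blast
qed

lemma Parabolic_closed:
  assumes c: "c \<in> S"
  shows "b \<in> B \<Longrightarrow> b \<in> Parabolic Q c" "nr c \<in> Parabolic Q c"
    "x \<in> Parabolic Q c \<Longrightarrow> y \<in> Parabolic Q c \<Longrightarrow> x ** y \<in> Parabolic Q c"
    "x \<in> Parabolic Q c \<Longrightarrow> matrix_inv x \<in> Parabolic Q c"
proof -
  have sub: "subgroup (Parabolic Q c) (GG Q)"
    unfolding Parabolic_def by (rule group.generate_is_subgroup[OF group_GG]) (use Parabolic_generators[OF c] in simp)
  show "b \<in> B \<Longrightarrow> b \<in> Parabolic Q c" "nr c \<in> Parabolic Q c"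
    unfolding Parabolic_def by (auto intro!: generate.incl simp: sref_tc self_in_tc)
  show "x \<in> Parabolic Q c \<Longrightarrow> y \<in> Parabolic Q c \<Longrightarrow> x ** y \<in> Parabolic Q c"
    using subgroup.m_closed[OF sub, of x y] by simp
  assume x: "x \<in> Parabolic Q c"
  then have "x \<in> G" using subgroup.subset[OF sub] by auto
  then show "matrix_inv x \<in> Parabolic Q c"
    using subgroup.m_inv_closed[OF sub x] inv_as_group[OF subgroup_G] by simp
qed

text \<open>The negative root subgroup is the conjugate by \<open>nr c\<close> of the positive one,
  which lies in \<open>B\<close>; the sign \<open>e\<close> is absorbed in the parameter.\<close>

lemma u_simple_Parabolic:
  assumes c: "c \<in> S"
  shows "u (frag_of c) x \<in> Parabolic Q c" "u (- frag_of c) x \<in> Parabolic Q c"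
proof -
  have a: "frag_of c \<in> \<Phi>" using simple_in_Phi c by blast
  show pos: "u (frag_of c) x \<in> Parabolic Q c" for x
    using Parabolic_closed(1)[OF c] u_B[OF a] by simp
  obtain e where e: "e \<in> {1, - 1}" "\<And>x. conj_by (nr c) (u (frag_of c) x) = u (- frag_of c) (e * x)"
    using conj_by_nr_u[OF c a] unfolding lact_nr_simple[OF c] by blast
  have "conj_by (nr c) (u (frag_of c) (e * x)) = u (- frag_of c) x" using e by auto
  then show "u (- frag_of c) x \<in> Parabolic Q c"
    using Parabolic_closed[OF c] pos unfolding conj_by_def by metis
qed

subsection \<open>Unipotent elements of a conjugate of the Borel subgroup\<close>

text \<open>A linear form equal to 1 on \<open>E a\<close>, realised by one matrix entry. On other
  matrices of degree \<open>a\<close> its value depends on the entry chosen; it detects vanishing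
  only for multiples of \<open>E a\<close>, and \<open>conj_Borel_iff\<close> relies on it in that
  situation.\<close>

definition leading_coeff :: "('n character \<Rightarrow>\<^sub>0 int) \<Rightarrow> 'n cmat \<Rightarrow> complex" where
  "leading_coeff a X = (let (i, j) = (SOME (i, j). E a $ i $ j \<noteq> 0) in X $ i $ j / E a $ i $ j)"

lemma leading_coeff_linear:
  "leading_coeff a (mat z ** X) = z * leading_coeff a X"
  "leading_coeff a (X + Y) = leading_coeff a X + leading_coeff a Y"
  "leading_coeff a 0 = 0"
  by (simp_all add: leading_coeff_def split_beta add_divide_distrib)

lemma leading_coeff_sum: "leading_coeff a (\<Sum>i\<in>I. f i) = (\<Sum>i\<in>I. leading_coeff a (f i))"
  by (induction I rule: infinite_finite_induct) (simp_all add: leading_coeff_linear)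

lemma leading_coeff_E:
  assumes "a \<in> \<Phi>"
  shows "leading_coeff a (E a) = 1"
proof -
  have "\<exists>p. case p of (i, j) \<Rightarrow> E a $ i $ j \<noteq> 0"
    using E_nonzero[OF assms] by (auto simp: vec_eq_iff)
  then have "case (SOME (i, j). E a $ i $ j \<noteq> 0) of (i, j) \<Rightarrow> E a $ i $ j \<noteq> 0"
    by (rule someI_ex)
  then show ?thesis by (auto simp: leading_coeff_def split_beta)
qed

lemma hgt_Phi_pos: "a \<in> \<Phi> \<Longrightarrow> dominant a \<Longrightarrow> 1 \<le> hgt a"
  using hgt_pos[of a] Phi_Lat zero_notin_Phi by fastforce

lemma Phi_hgt_dominant: "a \<in> \<Phi> \<Longrightarrow> 1 \<le> hgt a \<Longrightarrow> dominant a"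
  using Phi_sign[of a] hgt_nonneg[of "- a"] by fastforce

lemma high_mono: "high k X \<Longrightarrow> l \<le> k \<Longrightarrow> high l X"
  by (erule deg_in_mono) auto

text \<open>Unipotence is recorded by height alone. That the leading weights are positive roots is
  recovered in \<open>leading_part_root_vector\<close>, since a root of positive height is
  positive.\<close>

definition unip :: "'n cmat \<Rightarrow> bool" where
  "unip g \<longleftrightarrow> g \<in> G \<and> high 1 (g - mat 1)"

lemma unip_high_zero: "unip g \<Longrightarrow> high 0 g"
  using deg_in_add[OF high_mono[of 1 "g - mat 1" 0] deg_in_one] by (simp add: unip_def)

lemma unip_one: "unip (mat 1)"
  by (simp add: unip_def G_one)

lemma mult_minus_one: "g ** h - mat 1 = (g - mat 1) ** h + (h - mat 1)" for g h :: "'n cmat"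
  by (simp add: matrix_mult_diff)

lemma unip_mult: "unip g \<Longrightarrow> unip h \<Longrightarrow> unip (g ** h)"
  using high_mult[of 1 "g - mat 1" 0 h] unip_high_zero[of h] deg_in_add
  by (auto simp: unip_def G_mult mult_minus_one)

text \<open>The coefficients of \<open>u a\<close> from the second on have height at least
  \<open>2 * hgt a\<close>, so up to height \<open>hgt a\<close> only the linear term is
  visible.\<close>

lemma component_u_minus_one:
  assumes "a \<in> \<Phi>" "dominant a" "hgt m \<le> hgt a"
  shows "component m (u a x - mat 1) = (if m = a then mat x ** E a else 0)"
proof (cases "m = a")
  case True
  then show ?thesis using assms zero_notin_Phi by (auto simp: component_diff component_u component_one)
next
  case False
  have a1: "1 \<le> hgt a" using hgt_Phi_pos assms by blast
  show ?thesis
  proof (cases "m = 0")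
    case True
    have "component (0 :: _ \<Rightarrow>\<^sub>0 int) (u a x) = (\<Sum>k\<le>udeg a. if k = 0 then mat 1 else 0)"
      unfolding u_expand[OF assms(1) order_refl] component_sum
    proof (rule sum.cong[OF refl])
      fix k
      show "component 0 (mat (x ^ k) ** U a k) = (if k = 0 then mat 1 else 0)"
      proof (cases "k = 0")
        case False
        then have "0 \<noteq> frag_cmul (int k) a" using assms zero_notin_Phi by auto
        then show ?thesis using False component_other[OF deg_in_U[OF assms(1)]] by (simp add: component_scale)
      qed (simp add: U_zero assms component_one)
    qed
    then show ?thesis using True False by (simp add: component_diff component_one)
  next
    case m0: False
    have "m \<noteq> frag_cmul (int k) a" for k
    proof
      assume eq: "m = frag_cmul (int k) a"
      then have "k \<noteq> 0" "k \<noteq> 1" using m0 False by auto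
      then have "2 * hgt a \<le> int k * hgt a" using a1 by (intro mult_right_mono) auto
      then show False using eq assms(3) a1 by simp
    qed
    then have "component m (u a x) = 0"
      using component_deg_in[OF deg_in_u[OF assms(1)]] by auto
    then show ?thesis using False m0 by (simp add: component_diff component_one)
  qed
qed

lemma unip_u: "a \<in> \<Phi> \<Longrightarrow> dominant a \<Longrightarrow> unip (u a x)"
  unfolding unip_def deg_in_iff
proof (intro conjI allI impI)
  fix m assume a: "a \<in> \<Phi>" "dominant a" and m: "m \<notin> {m. 1 \<le> hgt m}"
  have "1 \<le> hgt a" using hgt_Phi_pos a by blast
  then show "component m (u a x - mat 1) = 0" using component_u_minus_one[OF a, of m x] m by auto
qed (simp add: u_G)

text \<open>The cross term \<open>(g - mat 1) ** (h - mat 1)\<close> starts at height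
  \<open>k + 1\<close>, so terms of height at most \<open>k\<close> add.\<close>

lemma leading_term_mult:
  assumes g: "high k (g - mat 1)" and h: "unip h" and m: "hgt m \<le> k"
  shows "component m (g ** h - mat 1) = component m (g - mat 1) + component m (h - mat 1)"
proof -
  have eq: "g ** h - mat 1 = (g - mat 1) + (h - mat 1) + (g - mat 1) ** (h - mat 1)"
    by (simp add: matrix_mult_diff)
  have "high (k + 1) ((g - mat 1) ** (h - mat 1))"
    using g h by (intro high_mult) (simp_all add: unip_def)
  then have "component m ((g - mat 1) ** (h - mat 1)) = 0"
    by (rule component_deg_in) (use m in simp)
  then show ?thesis unfolding eq component_add by simp
qed

text \<open>The elements of \<open>n B n^-1\<close> available as corrections. Unipotence of the
  inverse is demanded as well, because corrections are undone in the proof of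
  \<open>conj_Borel_iff\<close>.\<close>

definition Bconj :: "'n cmat \<Rightarrow> 'n cmat set" where
  "Bconj n = {h. unip h \<and> unip (matrix_inv h) \<and> conj_by (matrix_inv n) h \<in> B}"

lemma Bconj_one: "invertible n \<Longrightarrow> mat 1 \<in> Bconj n"
  by (simp add: Bconj_def unip_one B_one invertible_matrix_inv)

lemma Bconj_mult:
  assumes n: "invertible n" and "h \<in> Bconj n" "h' \<in> Bconj n"
  shows "h ** h' \<in> Bconj n"
proof -
  have "invertible h" "invertible h'" using assms G_invertible by (auto simp: Bconj_def unip_def)
  then show ?thesis
    using assms by (simp add: Bconj_def unip_mult matrix_inv_mult conj_by_mult invertible_matrix_inv B_mult)
qed

text \<open>The set \<open>R^+ \<inter> y(R^-)\<close> in lattice coordinates, for \<open>y\<close>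
  the class of \<open>n\<close>.\<close>

definition walls :: "'n cmat \<Rightarrow> ('n character \<Rightarrow>\<^sub>0 int) set" where
  "walls n = {a \<in> \<Phi>. dominant a \<and> dominant (- lact (matrix_inv n) a)}"

lemma finite_walls: "finite (walls n)"
  by (simp add: walls_def finite_Phi)

lemma component_wall:
  assumes n: "n \<in> Nrm" and a: "a \<in> walls n" and V: "conj_by (matrix_inv n) V \<in> B"
  shows "component a V = 0"
proof -
  let ?m = "matrix_inv n"
  have m: "?m \<in> Nrm" using Nrm_inv n by blast
  have aL: "a \<in> Lat" and root: "lact ?m a \<in> \<Phi>" and neg: "dominant (- lact ?m a)"
    using a lact_Phi m Phi_Lat by (auto simp: walls_def)
  have "\<not> dominant (lact ?m a)" using sr.sign_exclusive[OF root] neg by blast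
  then have "component (lact ?m a) (conj_by ?m V) = 0"
    using component_deg_in[OF deg_in_Borel[OF V]] by simp
  then have "conj_by ?m (component a V) = 0" using component_conj_Nrm[OF m aL] by simp
  then have "conj_by n (conj_by ?m (component a V)) = 0" by simp
  then show ?thesis using n by (simp add: conj_by_inverse Nrm_invertible)
qed

text \<open>Off the walls the inverse of the representative keeps \<open>a\<close> positive, so the
  root subgroup of \<open>a\<close> is the conjugate of one contained in \<open>B\<close>.\<close>

lemma u_Bconj:
  assumes cs: "set cs \<subseteq> S" and a: "a \<in> \<Phi>" "dominant a" "a \<notin> walls (nword cs)"
  shows "u a x \<in> Bconj (nword cs)"
proof -
  let ?n = "nword cs"
  have n: "?n \<in> Nrm" using nword_Nrm cs by blast
  let ?b = "lact (matrix_inv ?n) a"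
  have b: "?b \<in> \<Phi>" using lact_Phi Nrm_inv n a by blast
  then have pos: "dominant ?b" using a Phi_sign by (auto simp: walls_def)
  have "sr.act cs ?b = lact ?n ?b" using lact_nword cs Phi_Lat b by simp
  then have "sr.act cs ?b = a" using lact_inv'[OF n] Phi_Lat a by simp
  then obtain e where e: "e \<in> {1, - 1}" "\<And>x. conj_by ?n (u ?b x) = u a (e * x)"
    using conj_by_nword_u[OF cs b] by metis
  have "conj_by ?n (u ?b (e * x)) = u a x" using e by auto
  then have "conj_by (matrix_inv ?n) (u a x) = u ?b (e * x)"
    using conj_by_inverse(2)[OF Nrm_invertible[OF n], of "u ?b (e * x)"] by simp
  then show ?thesis using a b pos by (simp add: Bconj_def unip_u u_inverse u_B)
qed

lemma leading_part_root_vector: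
  assumes g: "g \<in> G" "high k (g - mat 1)" "1 \<le> k" and m: "hgt m = k" "component m (g - mat 1) \<noteq> 0"
  shows "m \<in> \<Phi> \<and> dominant m \<and> (\<exists>z. component m (g - mat 1) = mat z ** E m)"
proof -
  have "m \<noteq> 0" using g(3) m(1) by auto
  then have "m \<in> \<Phi>" "\<exists>z. component m (g - mat 1) = mat z ** E m"
    using LA_weight_vector[OF leading_part_LA[OF g m(1)] deg_in_component m(2)] by auto
  then show ?thesis using Phi_hgt_dominant g(3) m(1) by blast
qed

text \<open>The leading terms of \<open>g\<close> are multiples of root vectors. Each right factor
  \<open>u a (- z)\<close> cancels the one at \<open>a\<close> and leaves those at the other roots
  of height \<open>k\<close> unchanged, so the roots in \<open>F\<close> can be treated one after
  another in any order.\<close>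

lemma strip_leading_terms:
  assumes cs: "set cs \<subseteq> S" and g: "unip g" "high k (g - mat 1)" "1 \<le> k"
    and F: "finite F" "F \<subseteq> {a \<in> \<Phi>. dominant a \<and> hgt a = k \<and> a \<notin> walls (nword cs)}"
  shows "\<exists>p\<in>Bconj (nword cs). high k (g ** p - mat 1) \<and>
    (\<forall>m. hgt m = k \<longrightarrow> component m (g ** p - mat 1) = (if m \<in> F then 0 else component m (g - mat 1)))"
  using F
proof (induction F rule: finite_induct)
  case empty
  have "mat 1 \<in> Bconj (nword cs)"
    using Bconj_one Nrm_invertible nword_Nrm cs by blast
  then show ?case using g by (intro bexI[of _ "mat 1"]) auto
next
  case (insert a F)
  then obtain p where p: "p \<in> Bconj (nword cs)" "high k (g ** p - mat 1)"
    "\<And>m. hgt m = k \<Longrightarrow> component m (g ** p - mat 1) = (if m \<in> F then 0 else component m (g - mat 1))"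
    by auto
  have a: "a \<in> \<Phi>" "dominant a" "hgt a = k" "a \<notin> walls (nword cs)" using insert.prems by auto
  have "\<exists>z. component a (g - mat 1) = mat z ** E a"
  proof (cases "component a (g - mat 1) = 0")
    case True
    then show ?thesis by (intro exI[of _ 0]) simp
  next
    case False
    then show ?thesis using leading_part_root_vector[OF _ g(2,3) a(3)] g(1) by (auto simp: unip_def)
  qed
  then obtain z where z: "component a (g - mat 1) = mat z ** E a" by blast
  let ?p = "p ** u a (- z)"
  have "?p \<in> Bconj (nword cs)"
    using Bconj_mult p(1) u_Bconj[OF cs a(1,2,4)] Nrm_invertible nword_Nrm cs by blast
  moreover have eq: "g ** ?p = (g ** p) ** u a (- z)" by (simp add: matrix_mul_assoc)
  have comp: "component m (g ** ?p - mat 1) = component m (g ** p - mat 1) + (if m = a then mat (- z) ** E a else 0)"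
    if "hgt m \<le> k" for m
    unfolding eq leading_term_mult[OF p(2) unip_u[OF a(1,2)] that]
    using component_u_minus_one[OF a(1,2), of m "- z"] that a(3) by simp
  have "high k (g ** ?p - mat 1)"
    unfolding deg_in_iff
  proof (intro allI impI)
    fix m assume "m \<notin> {m. k \<le> hgt m}"
    then have m: "hgt m \<le> k" "m \<noteq> a" "m \<notin> {m. k \<le> hgt m}" using a(3) by auto
    then show "component m (g ** ?p - mat 1) = 0"
      using comp[OF m(1)] component_deg_in[OF p(2) m(3)] by simp
  qed
  moreover have "component m (g ** ?p - mat 1) = (if m \<in> insert a F then 0 else component m (g - mat 1))"
    if m: "hgt m = k" for m
  proof (cases "m = a")
    case True
    have "mat z ** E a + mat (- z) ** E a = 0" by (simp flip: mat_add_mult)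
    then show ?thesis using comp[of m] p(3)[OF m] m z insert.hyps True by simp
  next
    case False
    then show ?thesis using comp[of m] p(3)[OF m] m by simp
  qed
  ultimately show ?case by blast
qed

lemma Bconj_inverse_component:
  assumes n: "n \<in> Nrm" and h: "h \<in> Bconj n" and a: "a \<in> walls n"
  shows "component a (matrix_inv h) = 0"
proof (rule component_wall[OF n a])
  have "invertible h" using h G_invertible by (auto simp: Bconj_def unip_def)
  then have "conj_by (matrix_inv n) (matrix_inv h) = matrix_inv (conj_by (matrix_inv n) h)"
    using n by (intro conj_by_matrix_inv) (simp_all add: Nrm_invertible invertible_matrix_inv)
  then show "conj_by (matrix_inv n) (matrix_inv h) \<in> B"
    using h B_inv by (simp add: Bconj_def)
qed

text \<open>A unipotent element is corrected by elements of the conjugate of \<open>B\<close>, height by height.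
  The correction does not change the first coefficient at a wall, since the inverse of
  the correction has no component there.\<close>

lemma conj_Borel_iff:
  assumes cs: "set cs \<subseteq> S" and V: "unip V"
  shows "conj_by (matrix_inv (nword cs)) V \<in> B \<longleftrightarrow> (\<forall>a\<in>walls (nword cs). leading_coeff a (component a V) = 0)"
proof
  let ?n = "nword cs"
  have n: "?n \<in> Nrm" using nword_Nrm cs by blast
  show "\<forall>a\<in>walls ?n. leading_coeff a (component a V) = 0" if "conj_by (matrix_inv ?n) V \<in> B"
    using component_wall[OF n _ that] by (simp add: leading_coeff_linear)
  assume walls: "\<forall>a\<in>walls ?n. leading_coeff a (component a V) = 0"
  have step: "\<exists>h\<in>Bconj ?n. high (int k) (V ** h - mat 1)" if "1 \<le> k" for k
    using that
  proof (induction k rule: dec_induct)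
    case base
    have "mat 1 \<in> Bconj ?n" using Bconj_one Nrm_invertible n by blast
    then show ?case using V by (intro bexI[of _ "mat 1"]) (auto simp: unip_def)
  next
    case (step k)
    then obtain h where h: "h \<in> Bconj ?n" "high (int k) (V ** h - mat 1)" by blast
    have k1: "1 \<le> int k" using step by simp
    have inv: "invertible h" and hh: "unip h" "unip (matrix_inv h)"
      using h G_invertible by (auto simp: Bconj_def unip_def)
    have g: "unip (V ** h)" using V hh by (simp add: unip_mult)
    have wall_zero: "component a (V ** h - mat 1) = 0" if a: "a \<in> walls ?n" "hgt a = int k" for a
    proof (rule ccontr)
      assume nz: "component a (V ** h - mat 1) \<noteq> 0"
      then obtain z where z: "a \<in> \<Phi>" "component a (V ** h - mat 1) = mat z ** E a"
        using leading_part_root_vector[OF _ h(2) k1 a(2)] g by (auto simp: unip_def)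
      have a0: "a \<noteq> 0" using z zero_notin_Phi by blast
      \<comment> \<open>Undoing the correction \<open>h\<close> returns to \<open>V\<close>. Since
        the inverse of \<open>h\<close> contributes nothing at a wall, the component of
        \<open>V\<close> at \<open>a\<close> is the leading one of \<open>V ** h\<close>, to which
        the assumed vanishing applies.\<close>
      have "component a (V ** h ** matrix_inv h - mat 1) =
          component a (V ** h - mat 1) + component a (matrix_inv h - mat 1)"
        by (rule leading_term_mult[OF h(2) hh(2)]) (simp add: a)
      then have "component a V = mat z ** E a"
        using inv a0 z Bconj_inverse_component[OF n h(1) a(1)]
        by (simp add: matrix_inv_cancel component_diff component_one)
      then have "z = 0" using walls a z by (auto simp: leading_coeff_linear leading_coeff_E)
      then show False using nz z by simp
    qed
    let ?F = "{a \<in> \<Phi>. dominant a \<and> hgt a = int k \<and> a \<notin> walls ?n}"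
    have "finite ?F" by (simp add: finite_Phi)
    then obtain p where p: "p \<in> Bconj ?n" "high (int k) (V ** h ** p - mat 1)"
      "\<And>m. hgt m = int k \<Longrightarrow> component m (V ** h ** p - mat 1) = (if m \<in> ?F then 0 else component m (V ** h - mat 1))"
      using strip_leading_terms[OF cs g h(2) k1 _ subset_refl] by blast
    have zero: "component m (V ** h ** p - mat 1) = 0" if m: "hgt m = int k" for m
    proof (cases "component m (V ** h - mat 1) = 0")
      case True
      then show ?thesis using p(3)[OF m] by simp
    next
      case False
      then have "m \<in> \<Phi> \<and> dominant m"
        using leading_part_root_vector[OF _ h(2) k1 m] g by (auto simp: unip_def)
      moreover have "m \<notin> walls ?n" using wall_zero m False by blast
      ultimately show ?thesis using p(3)[OF m] m by simp
    qed
    have "high (int (Suc k)) (V ** h ** p - mat 1)"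
      unfolding deg_in_iff
    proof (intro allI impI)
      fix m assume "m \<notin> {m. int (Suc k) \<le> hgt m}"
      then consider "hgt m = int k" | "m \<notin> {m. int k \<le> hgt m}" by force
      then show "component m (V ** h ** p - mat 1) = 0"
        by cases (use zero component_deg_in[OF p(2)] in auto)
    qed
    moreover have "h ** p \<in> Bconj ?n" using Bconj_mult h p Nrm_invertible n by blast
    ultimately show ?case by (intro bexI[of _ "h ** p"]) (simp_all add: matrix_mul_assoc)
  qed
  obtain N where N: "\<And>k X. N < k \<Longrightarrow> high k X \<Longrightarrow> X = 0" "1 \<le> N"
    using high_bound by metis
  obtain h where h: "h \<in> Bconj ?n" "high (int (nat N + 1)) (V ** h - mat 1)"
    using step[of "nat N + 1"] by auto
  \<comment> \<open>Beyond the last occurring height nothing is left, so \<open>V\<close> is the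
    inverse of an element of the conjugate of \<open>B\<close>.\<close>
  have "V ** h - mat 1 = 0" using N(1)[OF _ h(2)] N(2) by simp
  then have "V ** h = mat 1" by simp
  moreover have inv: "invertible h" using h G_invertible by (auto simp: Bconj_def unip_def)
  ultimately have "V = matrix_inv h"
    using matrix_inv_cancel(3)[OF inv, of V] by simp
  then have "conj_by (matrix_inv ?n) V = matrix_inv (conj_by (matrix_inv ?n) h)"
    using inv n by (simp add: conj_by_matrix_inv Nrm_invertible invertible_matrix_inv)
  then show "conj_by (matrix_inv ?n) V \<in> B"
    using h B_inv by (simp add: Bconj_def)
qed

subsection \<open>Lengths\<close>

lemma seq_prod_word:
  assumes "\<forall>i\<in>{1..k}. b i \<in> S"
  shows "seq_prod (Weyl Q) (\<lambda>i. sref Q (b i)) k = cox.word_prod (map b [1..<Suc k])"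
  using assms
proof (induction k)
  case (Suc k)
  have "set (map b [1..<Suc k]) \<subseteq> S" using Suc.prems by auto
  then show ?case
    using Suc cox.word_prod_append[of "map b [1..<Suc k]" "[b (Suc k)]"] cox.gen_closed by simp
qed simp

lemma wlength_eq: "wlength Q w = cox.word_length w"
proof -
  have "(\<exists>b. (\<forall>i\<in>{1..k}. b i \<in> S) \<and> w = seq_prod (Weyl Q) (\<lambda>i. sref Q (b i)) k) \<longleftrightarrow>
      (\<exists>cs. set cs \<subseteq> S \<and> length cs = k \<and> w = cox.word_prod cs)" for k
  proof
    assume "\<exists>b. (\<forall>i\<in>{1..k}. b i \<in> S) \<and> w = seq_prod (Weyl Q) (\<lambda>i. sref Q (b i)) k"
    then obtain b where b: "\<forall>i\<in>{1..k}. b i \<in> S" "w = seq_prod (Weyl Q) (\<lambda>i. sref Q (b i)) k" by blast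
    then show "\<exists>cs. set cs \<subseteq> S \<and> length cs = k \<and> w = cox.word_prod cs"
      by (intro exI[of _ "map b [1..<Suc k]"]) (auto simp: seq_prod_word simp del: upt_Suc)
  next
    assume "\<exists>cs. set cs \<subseteq> S \<and> length cs = k \<and> w = cox.word_prod cs"
    then obtain cs where cs: "set cs \<subseteq> S" "length cs = k" "w = cox.word_prod cs" by blast
    let ?b = "\<lambda>i. cs ! (i - 1)"
    have b: "\<forall>i\<in>{1..k}. ?b i \<in> S"
    proof
      fix i assume "i \<in> {1..k}"
      then have "i - 1 < length cs" using cs by auto
      then show "?b i \<in> S" using cs(1) nth_mem by blast
    qed
    have "map ?b [1..<Suc k] = cs"
      using cs(2) by (intro nth_equalityI) (simp_all del: upt_Suc)
    then show "\<exists>b. (\<forall>i\<in>{1..k}. b i \<in> S) \<and> w = seq_prod (Weyl Q) (\<lambda>i. sref Q (b i)) k"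
      using seq_prod_word[OF b] b cs(3) by (intro exI[of _ ?b]) simp
  qed
  then show ?thesis by (simp add: wlength_def cox.word_length_def)
qed

text \<open>Sending an inversion of the word to minus its image is a bijection onto the positive
  roots made negative by the inverse. The number of inversions is the length by the exchange
  condition.\<close>

lemma card_walls:
  assumes cs: "set cs \<subseteq> S"
  shows "card (walls (nword cs)) = card (sr.inversions (sr.act cs))"
    "card (walls (nword cs)) = wlength Q (tc (nword cs))"
proof -
  let ?n = "nword cs"
  have n: "?n \<in> Nrm" using nword_Nrm cs by blast
  have act: "sr.act cs b = lact ?n b" if "b \<in> \<Phi>" for b using lact_nword cs Phi_Lat that by simp
  have "bij_betw (\<lambda>b. - lact ?n b) (sr.inversions (sr.act cs)) (walls ?n)"
  proof (rule bij_betwI[where g = "\<lambda>a. - lact (matrix_inv ?n) a"])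
    show "(\<lambda>b. - lact ?n b) \<in> sr.inversions (sr.act cs) \<rightarrow> walls ?n"
      using n act by (auto simp: sr.inversions_def walls_def sr.uminus_Phi lact_Phi lact_uminus lact_inv Phi_Lat)
    show "(\<lambda>a. - lact (matrix_inv ?n) a) \<in> walls ?n \<rightarrow> sr.inversions (sr.act cs)"
    proof
      fix a assume a: "a \<in> walls ?n"
      then have "- lact (matrix_inv ?n) a \<in> \<Phi>"
        using sr.uminus_Phi lact_Phi Nrm_inv n by (auto simp: walls_def)
      then show "- lact (matrix_inv ?n) a \<in> sr.inversions (sr.act cs)"
        using a n act by (auto simp: sr.inversions_def walls_def lact_uminus lact_inv' Phi_Lat)
    qed
  qed (use n in \<open>auto simp: sr.inversions_def walls_def lact_uminus lact_inv lact_inv' Phi_Lat\<close>)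
  then show "card (walls ?n) = card (sr.inversions (sr.act cs))"
    by (metis bij_betw_same_card)
  then show "card (walls ?n) = wlength Q (tc ?n)"
    using cox.card_inversions[OF cs] word_prod_tc[OF cs] by (simp add: wlength_eq)
qed

end

subsection \<open>Galleries and cells\<close>

locale pinned_gallery = pinned Q for Q :: "('n::finite) pinned_group" +
  fixes r :: nat and a :: "nat \<Rightarrow> 'n character" and \<gamma> :: "nat \<Rightarrow> 'n cmat set"
  assumes a_simple: "\<forall>i\<in>{1..r}. a i \<in> S"
    and gallery: "\<gamma> \<in> galleries Q r a"
begin

definition moves :: "nat set" where
  "moves = {i. \<gamma> i \<noteq> \<one>\<^bsub>Weyl Q\<^esub>}"

abbreviation W :: "nat \<Rightarrow> 'n character list" where
  "W \<equiv> sr.prefix_word a moves"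

abbreviation step :: "nat \<Rightarrow> 'n character list" where
  "step i \<equiv> (if i \<in> moves then [a i] else [])"

text \<open>Lattice form of the root attached to position \<open>i\<close>. The root of the
  \<open>i\<close>-th factor of a cell point is \<open>\<alpha> i\<close>; the two differ by the
  preceding part of the gallery, see \<open>beta_alpha\<close>.\<close>

definition \<beta> :: "nat \<Rightarrow> ('n character \<Rightarrow>\<^sub>0 int)" where
  "\<beta> i = sr.act (W i) (- frag_of (a i))"

definition \<alpha> :: "nat \<Rightarrow> ('n character \<Rightarrow>\<^sub>0 int)" where
  "\<alpha> i = sr.act (step i) (- frag_of (a i))"

lemma set_W: "i \<le> r \<Longrightarrow> set (W i) \<subseteq> S"
  by (rule sr.set_prefix_word[OF a_simple])

lemma set_step: "i \<in> {1..r} \<Longrightarrow> set (step i) \<subseteq> S"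
  using a_simple by auto

lemma W_step: "i \<in> {1..r} \<Longrightarrow> W i = W (i - 1) @ step i"
  by (cases i) auto

lemma neg_simple: "i \<in> {1..r} \<Longrightarrow> - frag_of (a i) \<in> \<Phi>"
  using neg_simple_Phi a_simple by blast

lemma beta_Phi: "i \<in> {1..r} \<Longrightarrow> \<beta> i \<in> \<Phi>" and alpha_Phi: "i \<in> {1..r} \<Longrightarrow> \<alpha> i \<in> \<Phi>"
  unfolding \<beta>_def \<alpha>_def using sr.act_Phi neg_simple set_W set_step by auto

lemma beta_alpha: "i \<in> {1..r} \<Longrightarrow> \<beta> i = sr.act (W (i - 1)) (\<alpha> i)"
  unfolding \<beta>_def \<alpha>_def by (simp only: W_step sr.act_append)

lemma gamma_tc:
  assumes "i \<in> {1..r}"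
  shows "\<gamma> i = tc (nword (step i))"
proof -
  have "\<gamma> i \<in> {sref Q (a i), \<one>\<^bsub>Weyl Q\<^esub>}"
    using gallery assms by (auto simp: galleries_def)
  then show ?thesis by (auto simp: moves_def sref_tc one_Weyl tc_one)
qed

lemma grep_nword: "grep Q a \<gamma> i = nword (step i)"
  by (simp add: grep_def moves_def)

lemma gpre_W: "i \<le> r \<Longrightarrow> gpre Q \<gamma> i = tc (nword (W i))"
proof (induction i)
  case (Suc i)
  then have "gpre Q \<gamma> (Suc i) = tc (nword (W i)) \<otimes>\<^bsub>Weyl Q\<^esub> tc (nword (step (Suc i)))"
    using gamma_tc[of "Suc i"] by (simp add: gpre_def)
  also have "\<dots> = tc (nword (W i) ** nword (step (Suc i)))"
    using Suc.prems by (intro mult_Weyl nword_Nrm set_W) simp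
  finally show ?case by (simp add: nword_append)
qed (simp add: gpre_def one_Weyl tc_one)

lemma seq_prod_grep: "seq_prod (GG Q) (grep Q a \<gamma>) i = nword (W i)"
  by (induction i) (simp_all add: grep_nword nword_append)

lemma wact_word:
  assumes "set cs \<subseteq> S" "m \<in> \<Phi>"
  shows "wact Q (tc (nword cs)) (chi m) = chi (sr.act cs m)"
  using assms by (simp add: wact_tc nword_Nrm Phi_Lat lact_nword flip: chi_lact)

lemma rneg_simple: "i \<in> {1..r} \<Longrightarrow> rneg Q (a i) = chi (- frag_of (a i))"
  using rneg_chi[of "frag_of (a i)"] chi_frag_of[of "a i"] a_simple by simp

lemma groot_beta: "i \<in> {1..r} \<Longrightarrow> groot Q a \<gamma> i = chi (\<beta> i)"
  using wact_word[OF set_W neg_simple, of i i] by (simp add: groot_def rneg_simple gpre_W \<beta>_def)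

lemma galpha_alpha: "i \<in> {1..r} \<Longrightarrow> galpha Q a \<gamma> i = chi (\<alpha> i)"
  unfolding galpha_def \<alpha>_def by (simp only: rneg_simple gamma_tc wact_word set_step neg_simple)

lemma groot_pre_W:
  assumes "i \<in> {1..r}"
  shows "groot_pre Q a \<gamma> i = chi (sr.act (W (i - 1)) (- frag_of (a i)))"
proof -
  have "i - 1 \<le> r" using assms by (intro le_trans[OF diff_le_self]) simp
  then show ?thesis
    using wact_word[OF set_W neg_simple[OF assms], of "i - 1"] assms
    by (simp add: groot_pre_def rneg_simple gpre_W)
qed

abbreviation "J \<equiv> Jset Q r a \<gamma>"

lemma J_eq: "J = {i \<in> {1..r}. dominant (\<beta> i)}"
  unfolding Jset_def using groot_beta chi_PosRoots_iff beta_Phi by auto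

lemma D_eq: "Dset Q r a \<gamma> = {i \<in> {1..r}. dominant (sr.act (W (i - 1)) (- frag_of (a i)))}"
proof -
  have "groot_pre Q a \<gamma> i \<in> PosRoots Q \<longleftrightarrow> dominant (sr.act (W (i - 1)) (- frag_of (a i)))" if i: "i \<in> {1..r}" for i
  proof -
    have "sr.act (W (i - 1)) (- frag_of (a i)) \<in> \<Phi>"
      using i by (intro sr.act_Phi set_W neg_simple) auto
    then show ?thesis using groot_pre_W[OF i] chi_PosRoots_iff by simp
  qed
  then show ?thesis by (auto simp: Dset_def)
qed

lemma finite_J: "finite J"
  by (simp add: J_eq)

lemma card_J: "card J = card (Dset Q r a \<gamma>) + card (walls (nword (W r)))"
  using sr.card_gallery_sets[OF a_simple, of moves] card_walls(1)[OF set_W[OF order_refl]]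
  by (simp add: J_eq D_eq \<beta>_def)

lemma wall_crossed:
  assumes "m \<in> walls (nword (W r))"
  shows "\<exists>i\<in>{1..r}. \<beta> i = m"
proof -
  let ?n = "nword (W r)"
  have n: "?n \<in> Nrm" using nword_Nrm set_W by blast
  let ?b = "lact (matrix_inv ?n) m"
  have b: "?b \<in> \<Phi>" "dominant (- ?b)" and m: "m \<in> \<Phi>" "dominant m"
    using assms lact_Phi Nrm_inv n by (auto simp: walls_def)
  have "sr.act (W r) ?b = m"
    using lact_nword[OF set_W[OF order_refl] Phi_Lat[OF b(1)]] lact_inv'[OF n Phi_Lat[OF m(1)]] by simp
  then show ?thesis
    using sr.gallery_crosses_wall[OF a_simple b, of moves] m by (simp add: \<beta>_def)
qed

definition sgn_at :: "nat \<Rightarrow> complex" where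
  "sgn_at i = (SOME e. e \<in> {1, - 1} \<and> (\<forall>x. conj_by (nword (W (i - 1))) (u (\<alpha> i) x) = u (\<beta> i) (e * x)))"

lemma sgn_at:
  assumes i: "i \<in> {1..r}"
  shows "sgn_at i \<in> {1, - 1}" "conj_by (nword (W (i - 1))) (u (\<alpha> i) x) = u (\<beta> i) (sgn_at i * x)"
proof -
  have "i - 1 \<le> r" using i by (intro le_trans[OF diff_le_self]) simp
  then have "\<exists>e. e \<in> {1, - 1} \<and> (\<forall>x. conj_by (nword (W (i - 1))) (u (\<alpha> i) x) = u (\<beta> i) (e * x))"
    using conj_by_nword_u[OF set_W alpha_Phi[OF i]] unfolding beta_alpha[OF i] by blast
  then have "sgn_at i \<in> {1, - 1} \<and> (\<forall>x. conj_by (nword (W (i - 1))) (u (\<alpha> i) x) = u (\<beta> i) (sgn_at i * x))"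
    unfolding sgn_at_def by (rule someI_ex)
  then show "sgn_at i \<in> {1, - 1}" "conj_by (nword (W (i - 1))) (u (\<alpha> i) x) = u (\<beta> i) (sgn_at i * x)" by auto
qed

lemma pinning_sign_sgn_at: "i \<in> {1..r} \<Longrightarrow> pinning_sign Q a \<gamma> i (sgn_at i)"
  using sgn_at[of i]
  by (simp add: pinning_sign_def seq_prod_grep Let_def groot_beta galpha_alpha conj_by_def)

primrec V :: "(nat \<Rightarrow> complex) \<Rightarrow> nat \<Rightarrow> 'n cmat" where
  "V x 0 = mat 1"
| "V x (Suc k) = V x k ** u (\<beta> (Suc k)) (sgn_at (Suc k) * x (Suc k))"

definition tuple :: "(nat \<Rightarrow> complex) \<Rightarrow> nat \<Rightarrow> 'n cmat" where
  "tuple x = (\<lambda>i\<in>{1..r}. rhom Q (galpha Q a \<gamma> i) (x i) ** grep Q a \<gamma> i)"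

lemma cell_point_tuple: "cell_point Q r a \<gamma> x = bs_class Q r (tuple x)"
  by (simp add: cell_point_def tuple_def)

lemma tuple_nth: "i \<in> {1..r} \<Longrightarrow> tuple x i = u (\<alpha> i) (x i) ** nword (step i)"
  by (simp only: tuple_def restrict_apply galpha_alpha grep_nword if_True)

lemma W_Nrm: "i \<le> r \<Longrightarrow> nword (W i) \<in> Nrm"
  using nword_Nrm set_W by blast

lemma seq_prod_tuple: "k \<le> r \<Longrightarrow> seq_prod (GG Q) (tuple x) k = V x k ** nword (W k)"
proof (induction k)
  case (Suc k)
  let ?i = "Suc k"
  have i: "?i \<in> {1..r}" using Suc.prems by simp
  have inv: "invertible (nword (W k))" using W_Nrm Nrm_invertible Suc.prems by simp
  have "seq_prod (GG Q) (tuple x) ?i = V x k ** nword (W k) ** (u (\<alpha> ?i) (x ?i) ** nword (step ?i))"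
    using Suc tuple_nth[OF i] by simp
  also have "\<dots> = V x k ** conj_by (nword (W k)) (u (\<alpha> ?i) (x ?i)) ** nword (W k) ** nword (step ?i)"
    using inv by (simp add: conj_by_def matrix_mul_assoc matrix_inv_cancel)
  also have "conj_by (nword (W k)) (u (\<alpha> ?i) (x ?i)) = u (\<beta> ?i) (sgn_at ?i * x ?i)"
    using sgn_at(2)[OF i] by simp
  finally show ?case by (simp add: nword_append matrix_mul_assoc)
qed simp

lemma unip_V:
  assumes "x \<in> coord_space J" "k \<le> r"
  shows "unip (V x k)"
  using assms(2)
proof (induction k)
  case (Suc k)
  let ?i = "Suc k"
  have i: "?i \<in> {1..r}" using Suc.prems by simp
  have "unip (u (\<beta> ?i) (sgn_at ?i * x ?i))"
  proof (cases "?i \<in> J")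
    case True
    then show ?thesis using unip_u by (simp add: J_eq beta_Phi)
  next
    case False
    then have "x ?i = 0" using assms(1) by (simp add: coord_space_def)
    then show ?thesis using u_zero[OF beta_Phi[OF i]] unip_one by simp
  qed
  then show ?case using Suc unip_mult by simp
qed (simp add: unip_one)

subsection \<open>The fibre in the coordinates of the cell\<close>

lemma tuple_Parabolic:
  assumes i: "i \<in> {1..r}"
  shows "tuple x i \<in> Parabolic Q (a i)"
proof -
  have c: "a i \<in> S" using a_simple i by blast
  have "u (\<alpha> i) (x i) \<in> Parabolic Q (a i)"
    using u_simple_Parabolic[OF c] by (auto simp: \<alpha>_def lact_uminus lact_nr_simple c)
  moreover have "nword (step i) \<in> Parabolic Q (a i)"
    using Parabolic_closed(1)[OF c B_one] Parabolic_closed(2)[OF c] by simp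
  ultimately show ?thesis unfolding tuple_nth[OF i] by (rule Parabolic_closed(3)[OF c])
qed

lemma cell_point_bott_samelson: "cell_point Q r a \<gamma> x \<in> bott_samelson Q r a"
proof -
  have "tuple x \<in> (\<Pi>\<^sub>E i\<in>{1..r}. Parabolic Q (a i))"
    using tuple_Parabolic by (auto simp: PiE_iff) (simp add: tuple_def)
  then show ?thesis unfolding bott_samelson_def cell_point_tuple by (rule imageI)
qed

text \<open>The factors \<open>b i\<close> telescope and only the last one survives.\<close>

lemma seq_prod_bs_class:
  assumes b: "b 0 = mat 1" "\<forall>i\<in>{1..r}. b i \<in> B" and k: "k \<le> r"
  shows "seq_prod (GG Q) (\<lambda>i\<in>{1..r}. matrix_inv (b (i - 1)) ** g i ** b i) k = seq_prod (GG Q) g k ** b k"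
  using k
proof (induction k)
  case (Suc k)
  have "invertible (b k)" using b Suc.prems B_invertible invertible_one by (cases k) auto
  then show ?case using Suc by (simp add: matrix_mul_assoc matrix_inv_cancel)
qed (simp add: b)

lemma l_coset_B: "g <#\<^bsub>GG Q\<^esub> B = (\<lambda>b. g ** b) ` B"
  by (auto simp: l_coset_def)

lemma image_mult_B: "b \<in> B \<Longrightarrow> (\<lambda>b'. (g ** b) ** b') ` B = (\<lambda>b'. g ** b') ` B"
proof
  assume b: "b \<in> B"
  show "(\<lambda>b'. (g ** b) ** b') ` B \<subseteq> (\<lambda>b'. g ** b') ` B"
    using b B_mult by (auto simp flip: matrix_mul_assoc)
  show "(\<lambda>b'. g ** b') ` B \<subseteq> (\<lambda>b'. (g ** b) ** b') ` B"
  proof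
    fix x assume "x \<in> (\<lambda>b'. g ** b') ` B"
    then obtain b' where b': "b' \<in> B" "x = g ** b'" by blast
    then have "x = (g ** b) ** (matrix_inv b ** b')"
      using b by (simp add: matrix_mul_assoc matrix_inv_cancel B_invertible)
    then show "x \<in> (\<lambda>b'. (g ** b) ** b') ` B" using b b' B_mult B_inv by blast
  qed
qed

lemma self_in_bs_class: "g \<in> extensional {1..r} \<Longrightarrow> g \<in> bs_class Q r g"
proof -
  assume g: "g \<in> extensional {1..r}"
  have "g = (\<lambda>i\<in>{1..r}. matrix_inv ((\<lambda>_. mat 1) (i - 1)) ** g i ** (\<lambda>_. mat 1) i)"
    using g by (auto simp: fun_eq_iff extensional_def)
  then show ?thesis
    unfolding bs_class_def using B_one by (intro CollectI exI[of _ "\<lambda>_. mat 1"] conjI) simp_all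
qed

lemma tuple_ext: "tuple x \<in> extensional {1..r}"
  by (simp add: tuple_def)

lemma bs_proj_cell_point: "bs_proj Q r (cell_point Q r a \<gamma> x) = (\<lambda>b. V x r ** nword (W r) ** b) ` B"
proof -
  have "seq_prod (GG Q) g r <#\<^bsub>GG Q\<^esub> B = (\<lambda>b. V x r ** nword (W r) ** b) ` B"
    if g: "g \<in> cell_point Q r a \<gamma> x" for g
  proof -
    obtain b where b: "b 0 = mat 1" "\<forall>i\<in>{1..r}. b i \<in> B"
      "g = (\<lambda>i\<in>{1..r}. matrix_inv (b (i - 1)) ** tuple x i ** b i)"
      using g by (auto simp: cell_point_tuple bs_class_def)
    have "b r \<in> B" using b B_one by (cases r) auto
    then show ?thesis
      unfolding l_coset_B b(3) seq_prod_bs_class[OF b(1,2) order_refl] seq_prod_tuple[OF order_refl]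
      by (rule image_mult_B)
  qed
  moreover have "tuple x \<in> cell_point Q r a \<gamma> x"
    unfolding cell_point_tuple by (rule self_in_bs_class[OF tuple_ext])
  ultimately have "(\<lambda>g. seq_prod (GG Q) g r <#\<^bsub>GG Q\<^esub> B) ` cell_point Q r a \<gamma> x =
      {(\<lambda>b. V x r ** nword (W r) ** b) ` B}" by auto
  then show ?thesis by (simp add: bs_proj_def)
qed

lemma tc_B:
  assumes n: "n \<in> Nrm"
  shows "tc n <#>\<^bsub>GG Q\<^esub> B = (\<lambda>b. n ** b) ` B"
proof
  show "tc n <#>\<^bsub>GG Q\<^esub> B \<subseteq> (\<lambda>b. n ** b) ` B"
  proof
    fix x assume "x \<in> tc n <#>\<^bsub>GG Q\<^esub> B"
    then obtain t b where tb: "t \<in> T" "b \<in> B" "x = t ** n ** b"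
      by (auto simp: set_mult_def tc_def)
    have "x = n ** (conj_by (matrix_inv n) t ** b)"
      using tb n by (simp add: conj_by_def matrix_inv_matrix_inv Nrm_invertible matrix_mul_assoc matrix_inv_right)
    moreover have "conj_by (matrix_inv n) t ** b \<in> B"
      using B_mult[OF T_B[OF Nrm_conj[OF Nrm_inv[OF n] tb(1)]] tb(2)] .
    ultimately show "x \<in> (\<lambda>b. n ** b) ` B" by blast
  qed
  show "(\<lambda>b. n ** b) ` B \<subseteq> tc n <#>\<^bsub>GG Q\<^esub> B"
    using self_in_tc[of n] by (auto simp: set_mult_def)
qed

lemma image_B_eq_iff:
  assumes n: "invertible n"
  shows "(\<lambda>b. v ** n ** b) ` B = (\<lambda>b. n ** b) ` B \<longleftrightarrow> conj_by (matrix_inv n) v \<in> B"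
proof
  assume eq: "(\<lambda>b. v ** n ** b) ` B = (\<lambda>b. n ** b) ` B"
  have "v ** n ** mat 1 \<in> (\<lambda>b. v ** n ** b) ` B" using B_one by blast
  then obtain b where b: "b \<in> B" "v ** n = n ** b" using eq by auto
  have "conj_by (matrix_inv n) v = matrix_inv n ** (v ** n)"
    using n by (simp add: conj_by_def matrix_inv_matrix_inv matrix_mul_assoc)
  then show "conj_by (matrix_inv n) v \<in> B" using b n by (simp add: matrix_inv_cancel)
next
  assume b: "conj_by (matrix_inv n) v \<in> B"
  have "v ** n = n ** conj_by (matrix_inv n) v"
    using n by (simp add: conj_by_def matrix_inv_matrix_inv matrix_mul_assoc matrix_inv_right)
  then show "(\<lambda>b. v ** n ** b) ` B = (\<lambda>b. n ** b) ` B" using image_mult_B[OF b] by simp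
qed

lemma fibre_iff:
  assumes x: "x \<in> coord_space J"
  shows "cell_point Q r a \<gamma> x \<in> bs_fibre Q r a (tc (nword (W r))) \<longleftrightarrow>
    (\<forall>m\<in>walls (nword (W r)). leading_coeff m (component m (V x r)) = 0)"
  unfolding bs_fibre_def mem_Collect_eq bs_proj_cell_point tc_B[OF W_Nrm[OF order_refl]]
    image_B_eq_iff[OF Nrm_invertible[OF W_Nrm[OF order_refl]]]
    conj_Borel_iff[OF set_W[OF order_refl] unip_V[OF x order_refl]]
  using cell_point_bott_samelson by blast

text \<open>If \<open>b (i - 1)\<close> is trivial, then \<open>b i\<close> is obtained from
  \<open>u (\<alpha> i) (y i - x i)\<close> by conjugating with the inverse of the gallery entry, so
  it lies in the root subgroup of \<open>- a i\<close>. Such an element is in \<open>B\<close> only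
  if it is trivial, which also gives \<open>y i = x i\<close>.\<close>

lemma cell_coordinates_unique:
  assumes b: "b 0 = mat 1" "\<forall>i\<in>{1..r}. b i \<in> B"
    and eq: "\<And>i. i \<in> {1..r} \<Longrightarrow> tuple y i = matrix_inv (b (i - 1)) ** tuple x i ** b i" and k: "k \<le> r"
  shows "b k = mat 1 \<and> (\<forall>i\<in>{1..k}. y i = x i)"
  using k
proof (induction k)
  case (Suc k)
  let ?i = "Suc k"
  let ?g = "nword (step ?i)"
  have i: "?i \<in> {1..r}" using Suc.prems by simp
  have c: "a ?i \<in> S" using a_simple i by blast
  have g: "?g \<in> Nrm" using nword_Nrm set_step i by blast
  have g': "invertible ?g" using Nrm_invertible g by blast
  have al: "\<alpha> ?i \<in> \<Phi>" using alpha_Phi i by blast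
  obtain e where e: "e \<in> {1, - 1}" "\<And>z. conj_by ?g (u (- frag_of (a ?i)) z) = u (\<alpha> ?i) (e * z)"
    using conj_by_nword_u[OF set_step[OF i] neg_simple[OF i]] unfolding \<alpha>_def by blast
  have "u (\<alpha> ?i) (y ?i) ** ?g = u (\<alpha> ?i) (x ?i) ** ?g ** b ?i"
    using eq[OF i] Suc by (simp add: tuple_nth[OF i])
  then have eq': "u (\<alpha> ?i) (- x ?i) ** (u (\<alpha> ?i) (y ?i) ** ?g) = u (\<alpha> ?i) (- x ?i) ** (u (\<alpha> ?i) (x ?i) ** (?g ** b ?i))"
    by (simp only: matrix_mul_assoc)
  have shift: "u (\<alpha> ?i) (- x ?i) ** (u (\<alpha> ?i) z ** M) = u (\<alpha> ?i) (z - x ?i) ** M" for z M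
    using u_add[OF al, of "- x ?i" z] by (simp add: matrix_mul_assoc)
  have "u (\<alpha> ?i) (y ?i - x ?i) ** ?g = ?g ** b ?i"
    using eq' u_zero[OF al] unfolding shift by simp
  then have "matrix_inv ?g ** (u (\<alpha> ?i) (y ?i - x ?i) ** ?g) = b ?i"
    using g' by (simp add: matrix_inv_cancel)
  moreover have "matrix_inv ?g ** (u (\<alpha> ?i) (y ?i - x ?i) ** ?g) = conj_by (matrix_inv ?g) (u (\<alpha> ?i) (y ?i - x ?i))"
    using g' by (simp add: conj_by_def matrix_inv_matrix_inv matrix_mul_assoc)
  moreover have "u (\<alpha> ?i) (y ?i - x ?i) = conj_by ?g (u (- frag_of (a ?i)) (e * (y ?i - x ?i)))"
    using e by auto
  ultimately have b_eq: "b ?i = u (- frag_of (a ?i)) (e * (y ?i - x ?i))"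
    using g' by (simp add: conj_by_inverse)
  then have "e * (y ?i - x ?i) = 0" using u_neg_simple_B[OF c] b(2) i by metis
  then have "y ?i = x ?i" "b ?i = mat 1"
    using e(1) b_eq u_zero[OF neg_simple[OF i]] by auto
  then show ?case using Suc by (auto simp: le_Suc_eq)
qed (simp add: b)

lemma inj_cell_point: "inj_on (cell_point Q r a \<gamma>) (coord_space J)"
proof (rule inj_onI)
  fix x y assume x: "x \<in> coord_space J" and y: "y \<in> coord_space J" and eq: "cell_point Q r a \<gamma> x = cell_point Q r a \<gamma> y"
  have "tuple y \<in> bs_class Q r (tuple x)"
    using eq self_in_bs_class[OF tuple_ext, of y] by (simp add: cell_point_tuple)
  then obtain b where b: "b 0 = mat 1" "\<forall>i\<in>{1..r}. b i \<in> B"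
    "tuple y = (\<lambda>i\<in>{1..r}. matrix_inv (b (i - 1)) ** tuple x i ** b i)"
    by (auto simp: bs_class_def)
  have tup: "tuple y i = matrix_inv (b (i - 1)) ** tuple x i ** b i" if "i \<in> {1..r}" for i
    using b(3) that by (metis (no_types, lifting) restrict_apply')
  have "\<forall>i\<in>{1..r}. y i = x i"
    using cell_coordinates_unique[OF b(1,2) tup order_refl] by blast
  moreover have "x i = 0 \<and> y i = 0" if "i \<notin> {1..r}" for i
    using that x y by (auto simp: coord_space_def J_eq)
  ultimately show "x = y" by (metis ext)
qed

subsection \<open>The equations\<close>

text \<open>A common degree bound for the expansions of all factors; at least 1, so that the
  exponent 1 is available for the linear monomials.\<close>

definition maxdeg :: nat where
  "maxdeg = Max (insert 1 ((\<lambda>i. udeg (\<beta> i)) ` {1..r}))"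

lemma maxdeg: "1 \<le> maxdeg" "i \<in> {1..r} \<Longrightarrow> udeg (\<beta> i) \<le> maxdeg"
  unfolding maxdeg_def by (rule Max_ge; simp)+

text \<open>Outside \<open>J\<close> the coordinate is 0 and its factor is the identity; allowing
  only the exponent 0 there keeps these variables out of the equations.\<close>

definition exponents :: "nat \<Rightarrow> nat set" where
  "exponents i = (if i \<in> J then {..maxdeg} else {0})"

lemma finite_exponents: "finite (exponents i)"
  by (simp add: exponents_def)

primrec UU :: "(nat \<Rightarrow> nat) \<Rightarrow> nat \<Rightarrow> 'n cmat" where
  "UU k 0 = mat 1"
| "UU k (Suc j) = UU k j ** U (\<beta> (Suc j)) (k (Suc j))"

lemma UU_cong: "(\<And>i. i \<in> {1..j} \<Longrightarrow> k i = k' i) \<Longrightarrow> UU k j = UU k' j"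
  by (induction j) auto

lemma u_beta_expand:
  assumes x: "x \<in> coord_space J" and i: "i \<in> {1..r}"
  shows "u (\<beta> i) (sgn_at i * x i) = (\<Sum>m\<in>exponents i. mat ((sgn_at i * x i) ^ m) ** U (\<beta> i) m)"
proof (cases "i \<in> J")
  case True
  then show ?thesis using u_expand[OF beta_Phi[OF i] maxdeg(2)[OF i]] by (simp add: exponents_def)
next
  case False
  then have "x i = 0" using x by (simp add: coord_space_def)
  then show ?thesis using False u_zero[OF beta_Phi[OF i]] U_zero[OF beta_Phi[OF i]] by (simp add: exponents_def)
qed

lemma sum_PiE_Suc:
  fixes f :: "(nat \<Rightarrow> nat) \<Rightarrow> 'c::comm_monoid_add"
  shows "(\<Sum>k\<in>PiE {1..Suc j} R. f k) = (\<Sum>k\<in>PiE {1..j} R. \<Sum>m\<in>R (Suc j). f (k(Suc j := m)))"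
proof -
  have eq: "{1..Suc j} = insert (Suc j) {1..j}" by auto
  have "(\<Sum>k\<in>PiE {1..Suc j} R. f k) = (\<Sum>(m, k)\<in>R (Suc j) \<times> PiE {1..j} R. f (k(Suc j := m)))"
    unfolding eq PiE_insert_eq
    by (subst sum.reindex) (auto simp: inj_combinator split_beta intro!: sum.cong)
  also have "\<dots> = (\<Sum>m\<in>R (Suc j). \<Sum>k\<in>PiE {1..j} R. f (k(Suc j := m)))"
    by (rule sum.cartesian_product[symmetric])
  also have "\<dots> = (\<Sum>k\<in>PiE {1..j} R. \<Sum>m\<in>R (Suc j). f (k(Suc j := m)))"
    by (rule sum.swap)
  finally show ?thesis .
qed

lemma V_expand:
  assumes x: "x \<in> coord_space J" and j: "j \<le> r"
  shows "V x j = (\<Sum>k\<in>PiE {1..j} exponents. mat (\<Prod>i\<in>{1..j}. (sgn_at i * x i) ^ k i) ** UU k j)"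
  using j
proof (induction j)
  case (Suc j)
  let ?s = "Suc j"
  let ?p = "\<lambda>k j. \<Prod>i\<in>{1..j}. (sgn_at i * x i) ^ k i"
  have i: "?s \<in> {1..r}" using Suc.prems by simp
  have "V x ?s = (\<Sum>k\<in>PiE {1..j} exponents. \<Sum>m\<in>exponents ?s.
      (mat (?p k j) ** UU k j) ** (mat ((sgn_at ?s * x ?s) ^ m) ** U (\<beta> ?s) m))"
    using Suc by (simp only: V.simps u_beta_expand[OF x i] matrix_mult_sum_left matrix_mult_sum_right Suc_leD) (rule sum.swap)
  also have "\<dots> = (\<Sum>k\<in>PiE {1..j} exponents. \<Sum>m\<in>exponents ?s.
      mat (?p (k(?s := m)) ?s) ** UU (k(?s := m)) ?s)"
  proof (intro sum.cong refl)
    fix k m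
    have "UU (k(?s := m)) j = UU k j" by (rule UU_cong) auto
    moreover have "?p (k(?s := m)) ?s = ?p k j * (sgn_at ?s * x ?s) ^ m"
    proof -
      have "?p (k(?s := m)) ?s = (\<Prod>i\<in>{1..j}. (sgn_at i * x i) ^ (k(?s := m)) i) * (sgn_at ?s * x ?s) ^ m"
        by simp
      also have "(\<Prod>i\<in>{1..j}. (sgn_at i * x i) ^ (k(?s := m)) i) = ?p k j"
        by (rule prod.cong) auto
      finally show ?thesis .
    qed
    moreover have "(mat p ** A) ** (mat q ** C) = mat (p * q) ** (A ** C)" for p q and A C :: "'n cmat"
      using mult_scale_triple[of p A "mat 1" q C] by simp
    ultimately show "(mat (?p k j) ** UU k j) ** (mat ((sgn_at ?s * x ?s) ^ m) ** U (\<beta> ?s) m) =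
        mat (?p (k(?s := m)) ?s) ** UU (k(?s := m)) ?s"
      by simp
  qed
  also have "\<dots> = (\<Sum>k\<in>PiE {1..?s} exponents. mat (?p k ?s) ** UU k ?s)"
    by (rule sum_PiE_Suc[symmetric])
  finally show ?case .
qed simp

text \<open>The degree of \<open>UU k j\<close>, the matrix coefficient of the monomial with
  exponents \<open>k\<close> in the product of the first \<open>j\<close> factors.\<close>

definition wsum :: "(nat \<Rightarrow> nat) \<Rightarrow> nat \<Rightarrow> ('n character \<Rightarrow>\<^sub>0 int)" where
  "wsum k j = (\<Sum>i\<in>{1..j}. frag_cmul (int (k i)) (\<beta> i))"

lemma deg_in_UU: "j \<le> r \<Longrightarrow> deg_in {wsum k j} (UU k j)"
proof (induction j)
  case (Suc j)
  have "Suc j \<in> {1..r}" using Suc.prems by simp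
  then have "deg_in {wsum k j + frag_cmul (int (k (Suc j))) (\<beta> (Suc j))} (UU k (Suc j))"
    unfolding UU.simps using Suc beta_Phi by (intro deg_in_mult[OF _ deg_in_U]) auto
  then show ?case by (simp add: wsum_def)
qed (simp add: wsum_def deg_in_one)

definition monomials :: "('n character \<Rightarrow>\<^sub>0 int) \<Rightarrow> (nat \<Rightarrow> nat) set" where
  "monomials m = {k \<in> PiE {1..r} exponents. wsum k r = m}"

lemma finite_monomials: "finite (monomials m)"
  unfolding monomials_def
  by (rule finite_subset[OF _ finite_PiE[of "{1..r}" exponents]]) (auto simp: finite_exponents)

definition mon :: "(nat \<Rightarrow> nat) \<Rightarrow> (nat \<Rightarrow>\<^sub>0 nat)" where
  "mon k = (\<Sum>i\<in>{1..r}. Poly_Mapping.single i (k i))"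

lemma lookup_mon: "Poly_Mapping.lookup (mon k) i = (if i \<in> {1..r} then k i else 0)"
  by (simp add: mon_def lookup_sum lookup_single when_def)

lemma keys_mon: "Poly_Mapping.keys (mon k) = {i \<in> {1..r}. k i \<noteq> 0}"
  by (auto simp: in_keys_iff lookup_mon split: if_splits)

lemma mon_degree: "mono_degree (mon k) = (\<Sum>i\<in>{1..r}. k i)"
  unfolding mono_degree_def keys_mon lookup_mon
  by (rule sum.mono_neutral_cong_left) auto

lemma mon_eval_mon: "mon_eval (mon k) x = (\<Prod>i\<in>{1..r}. x i ^ k i)"
  by (subst mon_eval_superset[of "{1..r}"]) (auto simp: keys_mon lookup_mon)

definition coef :: "('n character \<Rightarrow>\<^sub>0 int) \<Rightarrow> (nat \<Rightarrow> nat) \<Rightarrow> complex" where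
  "coef m k = leading_coeff m (UU k r) * (\<Prod>i\<in>{1..r}. sgn_at i ^ k i)"

definition Xp :: "('n character \<Rightarrow>\<^sub>0 int) \<Rightarrow> nat cpoly" where
  "Xp m = (\<Sum>k\<in>monomials m. Poly_Mapping.single (mon k) (coef m k))"

definition Xt :: "('n character \<Rightarrow>\<^sub>0 int) \<Rightarrow> nat cpoly" where
  "Xt m = (\<Sum>k\<in>{k \<in> monomials m. 2 \<le> (\<Sum>i\<in>{1..r}. k i)}. Poly_Mapping.single (mon k) (coef m k))"

lemma peval_Xp:
  assumes x: "x \<in> coord_space J"
  shows "peval (Xp m) x = leading_coeff m (component m (V x r))"
proof -
  have "component m (V x r) = (\<Sum>k\<in>PiE {1..r} exponents.
      if wsum k r = m then mat (\<Prod>i\<in>{1..r}. (sgn_at i * x i) ^ k i) ** UU k r else 0)"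
    unfolding V_expand[OF x order_refl] component_sum component_scale
  proof (rule sum.cong[OF refl])
    fix k
    show "mat (\<Prod>i\<in>{1..r}. (sgn_at i * x i) ^ k i) ** component m (UU k r) =
        (if wsum k r = m then mat (\<Prod>i\<in>{1..r}. (sgn_at i * x i) ^ k i) ** UU k r else 0)"
      using deg_in_UU[OF order_refl, of k] by (auto simp: component_self component_other)
  qed
  also have "\<dots> = (\<Sum>k\<in>monomials m. mat (\<Prod>i\<in>{1..r}. (sgn_at i * x i) ^ k i) ** UU k r)"
    unfolding monomials_def
    by (subst sum.inter_filter) (simp_all add: finite_PiE finite_exponents)
  finally have "leading_coeff m (component m (V x r)) =
      (\<Sum>k\<in>monomials m. (\<Prod>i\<in>{1..r}. (sgn_at i * x i) ^ k i) * leading_coeff m (UU k r))"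
    by (simp only: leading_coeff_sum leading_coeff_linear)
  also have "\<dots> = peval (Xp m) x"
    unfolding Xp_def by (simp add: mon_eval_mon coef_def power_mult_distrib prod.distrib mult_ac)
  finally show ?thesis by simp
qed

lemma exponent_zero_outside: "k \<in> monomials m \<Longrightarrow> i \<in> {1..r} \<Longrightarrow> i \<notin> J \<Longrightarrow> k i = 0"
  unfolding monomials_def exponents_def by (auto dest!: PiE_mem[where x = i])

lemma hgt_wsum: "hgt (wsum k r) = (\<Sum>i\<in>{1..r}. int (k i) * hgt (\<beta> i))"
  by (simp add: wsum_def hgt_sum)

lemma hgt_beta_J: "i \<in> J \<Longrightarrow> 1 \<le> hgt (\<beta> i)"
  using hgt_Phi_pos beta_Phi by (simp add: J_eq)

text \<open>The height of \<open>m\<close> is the sum of the heights of the \<open>\<beta> i\<close>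
  with multiplicities \<open>k i\<close>, and those that occur are at least 1. Once the total degree
  is at least 2, each single height is strictly smaller. This makes the system triangular.\<close>

lemma monomial_height:
  assumes k: "k \<in> monomials m" and i: "i \<in> {1..r}" "k i \<noteq> 0" and deg: "2 \<le> (\<Sum>i\<in>{1..r}. k i)"
  shows "i \<in> J" "hgt (\<beta> i) < hgt m"
proof -
  show iJ: "i \<in> J"
  proof (rule ccontr)
    assume "i \<notin> J"
    then show False using exponent_zero_outside[OF k i(1)] i(2) by simp
  qed
  let ?I = "{1..r} - {i}"
  have pos: "int (k j) \<le> int (k j) * hgt (\<beta> j)" if "j \<in> {1..r}" for j
  proof (cases "j \<in> J")
    case True
    then show ?thesis using mult_left_mono[OF hgt_beta_J[OF True], of "int (k j)"] by simp
  qed (use exponent_zero_outside[OF k that] in simp)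
  have "hgt m = (\<Sum>j\<in>{1..r}. int (k j) * hgt (\<beta> j))"
    using k hgt_wsum by (auto simp: monomials_def)
  also have "\<dots> = int (k i) * hgt (\<beta> i) + (\<Sum>j\<in>?I. int (k j) * hgt (\<beta> j))"
    using i by (subst sum.remove[of _ i]) auto
  also have "\<dots> \<ge> int (k i) * hgt (\<beta> i) + (\<Sum>j\<in>?I. int (k j))"
    using pos by (intro add_left_mono sum_mono) auto
  finally have 1: "int (k i) * hgt (\<beta> i) + (\<Sum>j\<in>?I. int (k j)) \<le> hgt m" .
  have "(int (k i) - 1) * 1 \<le> (int (k i) - 1) * hgt (\<beta> i)"
    using i hgt_beta_J[OF iJ] by (intro mult_left_mono) auto
  then have 2: "hgt (\<beta> i) + (int (k i) - 1) \<le> int (k i) * hgt (\<beta> i)"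
    by (simp add: algebra_simps)
  have "(\<Sum>j\<in>{1..r}. int (k j)) = int (k i) + (\<Sum>j\<in>?I. int (k j))"
    using i by (subst sum.remove[of _ i]) auto
  moreover have "2 \<le> (\<Sum>j\<in>{1..r}. int (k j))"
    using deg by (simp flip: of_nat_sum)
  ultimately show "hgt (\<beta> i) < hgt m" using 1 2 by linarith
qed

lemma keys_Xt: "Poly_Mapping.keys (Xt m) \<subseteq> mon ` {k \<in> monomials m. 2 \<le> (\<Sum>i\<in>{1..r}. k i)}"
proof -
  have "Poly_Mapping.keys (sum f I) \<subseteq> (\<Union>k\<in>I. Poly_Mapping.keys (f k))" for f :: "(nat \<Rightarrow> nat) \<Rightarrow> nat cpoly" and I
    by (induction I rule: infinite_finite_induct) (use keys_add in fastforce)+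
  then show ?thesis unfolding Xt_def by (rule order_trans) auto
qed

lemma pvars_Xt: "pvars (Xt m) \<subseteq> {j \<in> J. hgt (\<beta> j) < hgt m}"
proof
  fix i assume "i \<in> pvars (Xt m)"
  then obtain k where "k \<in> monomials m" "2 \<le> (\<Sum>i\<in>{1..r}. k i)" "i \<in> Poly_Mapping.keys (mon k)"
    using keys_Xt by (fastforce simp: pvars_def)
  then show "i \<in> {j \<in> J. hgt (\<beta> j) < hgt m}"
    using monomial_height[of k m i] by (auto simp: keys_mon)
qed

lemma degree_Xt: "l \<in> Poly_Mapping.keys (Xt m) \<Longrightarrow> 2 \<le> mono_degree l"
  using keys_Xt by (fastforce simp: mon_degree)

definition unit_exp :: "nat \<Rightarrow> nat \<Rightarrow> nat" where
  "unit_exp i = (\<lambda>j\<in>{1..r}. if j = i then 1 else 0)"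

lemma UU_unit: "i \<in> {1..r} \<Longrightarrow> j \<le> r \<Longrightarrow> UU (unit_exp i) j = (if i \<le> j then E (\<beta> i) else mat 1)"
proof (induction j)
  case (Suc j)
  have j: "Suc j \<in> {1..r}" using Suc.prems by simp
  show ?case
  proof (cases "Suc j = i")
    case True
    then have "unit_exp i (Suc j) = 1" using j by (simp add: unit_exp_def)
    moreover have "UU (unit_exp i) j = mat 1" using Suc True by simp
    ultimately have "UU (unit_exp i) (Suc j) = E (\<beta> (Suc j))" using U_one[OF beta_Phi[OF j]] by simp
    then show ?thesis using True by simp
  next
    case False
    then have "unit_exp i (Suc j) = 0" using j by (simp add: unit_exp_def)
    then show ?thesis using Suc False U_zero[OF beta_Phi[OF j]] by (auto simp: le_Suc_eq)
  qed
qed (auto simp: unit_exp_def)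

lemma sum_unit: "i \<in> {1..r} \<Longrightarrow> (\<Sum>j\<in>{1..r}. f (unit_exp i j) j) = f 1 i + (\<Sum>j\<in>{1..r} - {i}. f 0 j)"
  for f :: "nat \<Rightarrow> nat \<Rightarrow> 'c::comm_monoid_add"
  by (subst sum.remove[of _ i]) (auto simp: unit_exp_def intro!: arg_cong2[where f = "(+)"] sum.cong)

lemma linear_monomials:
  assumes m: "m \<in> \<Phi>" "dominant m"
  shows "{k \<in> monomials m. (\<Sum>i\<in>{1..r}. k i) = 1} = unit_exp ` {i \<in> {1..r}. \<beta> i = m}"
proof (intro equalityI subsetI)
  fix k assume k: "k \<in> {k \<in> monomials m. (\<Sum>i\<in>{1..r}. k i) = 1}"
  then obtain i where i: "i \<in> {1..r}" "k i = 1" "\<forall>j\<in>{1..r}. i \<noteq> j \<longrightarrow> k j = 0"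
    using sum_eq_1_iff[of "{1..r}" k] by auto
  have "k \<in> extensional {1..r}" using k by (auto simp: monomials_def PiE_def)
  then have keq: "k = unit_exp i"
    using i by (auto simp: unit_exp_def fun_eq_iff extensional_def)
  have "wsum k r = \<beta> i"
    unfolding wsum_def keq using sum_unit[OF i(1), of "\<lambda>n j. frag_cmul (int n) (\<beta> j)"] by simp
  then show "k \<in> unit_exp ` {i \<in> {1..r}. \<beta> i = m}"
    using k i keq by (auto simp: monomials_def)
next
  fix k assume "k \<in> unit_exp ` {i \<in> {1..r}. \<beta> i = m}"
  then obtain i where i: "i \<in> {1..r}" "\<beta> i = m" "k = unit_exp i" by blast
  have iJ: "i \<in> J" using i m by (simp add: J_eq)
  have "wsum k r = m"
    unfolding wsum_def using i sum_unit[OF i(1), of "\<lambda>n j. frag_cmul (int n) (\<beta> j)"] by simp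
  moreover have "k \<in> PiE {1..r} exponents"
    using i iJ maxdeg(1) by (auto simp: unit_exp_def exponents_def PiE_iff)
  moreover have "(\<Sum>i\<in>{1..r}. k i) = 1"
    using i sum_unit[OF i(1), of "\<lambda>n j. n"] by simp
  ultimately show "k \<in> {k \<in> monomials m. (\<Sum>i\<in>{1..r}. k i) = 1}" by (simp add: monomials_def)
qed

text \<open>A constant term would have degree 0, which is not a root, so the monomials split into
  linear ones and those of degree at least 2. The linear coefficients are the signs because
  \<open>leading_coeff m\<close> is 1 on \<open>E m\<close>.\<close>

lemma Xp_eq:
  assumes m: "m \<in> \<Phi>" "dominant m"
  shows "Xp m = (\<Sum>i\<in>{i \<in> {1..r}. \<beta> i = m}. pconst (sgn_at i) * pvar i) + Xt m"
proof -
  let ?t = "\<lambda>k. Poly_Mapping.single (mon k) (coef m k)"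
  let ?L = "{k \<in> monomials m. (\<Sum>i\<in>{1..r}. k i) = 1}" and ?H = "{k \<in> monomials m. 2 \<le> (\<Sum>i\<in>{1..r}. k i)}"
  have nonconst: "(\<Sum>i\<in>{1..r}. k i) \<noteq> 0" if "k \<in> monomials m" for k
  proof
    assume "(\<Sum>i\<in>{1..r}. k i) = 0"
    then have "wsum k r = 0" by (simp add: wsum_def)
    then show False using that m zero_notin_Phi by (simp add: monomials_def)
  qed
  have "(\<Sum>i\<in>{1..r}. k i) = 1 \<or> 2 \<le> (\<Sum>i\<in>{1..r}. k i)" if "k \<in> monomials m" for k
    using nonconst[OF that] by linarith
  then have "monomials m = ?L \<union> ?H" by blast
  then have "Xp m = sum ?t ?L + sum ?t ?H"
    unfolding Xp_def using finite_monomials[of m]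
    by (subst sum.union_disjoint[symmetric]) (auto intro!: arg_cong2[where f = sum])
  also have "sum ?t ?H = Xt m" by (simp add: Xt_def)
  also have "sum ?t ?L = (\<Sum>i\<in>{i \<in> {1..r}. \<beta> i = m}. ?t (unit_exp i))"
    unfolding linear_monomials[OF m]
  proof (rule sum.reindex_cong[OF _ refl refl])
    show "inj_on unit_exp {i \<in> {1..r}. \<beta> i = m}"
    proof (rule inj_onI)
      fix i j assume i: "i \<in> {i \<in> {1..r}. \<beta> i = m}" and eq: "unit_exp i = unit_exp j"
      have "unit_exp i i = 1" using i by (simp add: unit_exp_def)
      then have "unit_exp j i = 1" by (simp only: eq)
      moreover have "unit_exp j i = (if i = j then 1 else 0)" using i by (simp add: unit_exp_def)
      ultimately show "i = j" by (cases "i = j") simp_all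
    qed
  qed
  also have "\<dots> = (\<Sum>i\<in>{i \<in> {1..r}. \<beta> i = m}. pconst (sgn_at i) * pvar i)"
  proof (rule sum.cong[OF refl])
    fix i assume "i \<in> {i \<in> {1..r}. \<beta> i = m}"
    then have i: "i \<in> {1..r}" "\<beta> i = m" by auto
    have "mon (unit_exp i) = Poly_Mapping.single i 1"
      using i by (intro poly_mapping_eqI) (auto simp: lookup_mon unit_exp_def lookup_single when_def)
    moreover have "leading_coeff m (UU (unit_exp i) r) = 1"
      using UU_unit[OF i(1) order_refl] i leading_coeff_E[OF m(1)] by simp
    moreover have "(\<Prod>j\<in>{1..r}. sgn_at j ^ unit_exp i j) = sgn_at i"
    proof -
      have "(\<Prod>j\<in>{1..r}. sgn_at j ^ unit_exp i j) = (\<Prod>j\<in>{1..r}. if j = i then sgn_at i else 1)"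
        by (rule prod.cong) (auto simp: unit_exp_def)
      then show ?thesis using i by simp
    qed
    ultimately show "?t (unit_exp i) = pconst (sgn_at i) * pvar i"
      by (simp add: coef_def pconst_def pvar_def mult_single)
  qed
  finally show ?thesis .
qed

subsection \<open>The cell as a graph\<close>

text \<open>One crossing position per wall serves as pivot; it exists by
  \<open>wall_crossed\<close>. Distinct walls have distinct pivots since \<open>\<beta>\<close>
  recovers the wall.\<close>

definition wall_index :: "('n character \<Rightarrow>\<^sub>0 int) \<Rightarrow> nat" where
  "wall_index m = (SOME i. i \<in> {1..r} \<and> \<beta> i = m)"

abbreviation "walls' \<equiv> walls (nword (W r))"

lemma wall_index:
  assumes "m \<in> walls'"
  shows "wall_index m \<in> {1..r}" "\<beta> (wall_index m) = m"
proof -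
  have "\<exists>i. i \<in> {1..r} \<and> \<beta> i = m" using wall_crossed[OF assms] by blast
  then have "wall_index m \<in> {1..r} \<and> \<beta> (wall_index m) = m"
    unfolding wall_index_def by (rule someI_ex)
  then show "wall_index m \<in> {1..r}" "\<beta> (wall_index m) = m" by auto
qed

lemma wall_index_J: "m \<in> walls' \<Longrightarrow> wall_index m \<in> J"
  using wall_index[of m] by (auto simp: J_eq walls_def)

lemma inj_wall_index: "inj_on wall_index walls'"
  by (rule inj_on_inverseI[of _ \<beta>]) (rule wall_index)

definition free :: "nat set" where
  "free = J - wall_index ` walls'"

lemma card_free: "card free + card walls' = card J"
proof -
  have sub: "wall_index ` walls' \<subseteq> J" using wall_index_J by blast
  have "card (wall_index ` walls') = card walls'" by (rule card_image[OF inj_wall_index])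
  moreover have "card (wall_index ` walls') \<le> card J" by (rule card_mono[OF finite_J sub])
  ultimately show ?thesis
    unfolding free_def using sub by (simp add: card_Diff_subset finite_subset[OF _ finite_J])
qed

text \<open>An instance of \<open>triangular_system_solvable\<close> with the height as level and
  the chosen crossings as pivots.\<close>

lemma equations_graph:
  shows "\<exists>F. (\<forall>i\<in>J - free. pvars (F i :: nat cpoly) \<subseteq> free) \<and>
    (\<forall>x. (\<forall>m\<in>walls'. peval (Xp m) x = 0) \<longleftrightarrow> (\<forall>i\<in>J - free. x i = peval (F i) x))"
proof -
  define h where "h m = nat (hgt m)" for m
  define R where "R m = (\<Sum>i\<in>{i \<in> {1..r}. \<beta> i = m} - {wall_index m}. pconst (sgn_at i) * pvar i) + Xt m" for m
  have wall: "m \<in> \<Phi>" "dominant m" if "m \<in> walls'" for m using that by (auto simp: walls_def)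
  have X: "Xp m = pconst (sgn_at (wall_index m)) * pvar (wall_index m) + R m" if m: "m \<in> walls'" for m
    unfolding Xp_eq[OF wall[OF m]] R_def using wall_index[OF m]
    by (subst sum.remove[of _ "wall_index m"]) (auto simp: add.assoc)
  have e: "sgn_at (wall_index m) \<noteq> 0" if "m \<in> walls'" for m
    using sgn_at(1)[OF wall_index(1)[OF that]] by auto
  have R: "pvars (R m) \<subseteq> free \<union> wall_index ` {m' \<in> walls'. h m' < h m}" if m: "m \<in> walls'" for m
  proof -
    have "pvars (\<Sum>i\<in>{i \<in> {1..r}. \<beta> i = m} - {wall_index m}. pconst (sgn_at i) * pvar i) \<subseteq> free"
    proof (rule order_trans[OF pvars_sum], rule UN_least)
      fix i assume i: "i \<in> {i \<in> {1..r}. \<beta> i = m} - {wall_index m}"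
      \<comment> \<open>\<open>i\<close> is not the pivot of another wall, because a pivot
        determines its wall through \<open>\<beta>\<close>.\<close>
      then have "i \<in> free" using wall[OF m] wall_index(2) by (auto simp: free_def J_eq)
      then show "pvars (pconst (sgn_at i) * pvar i) \<subseteq> free"
        using pvars_mult[of "pconst (sgn_at i)" "pvar i"] by auto
    qed
    moreover have "pvars (Xt m) \<subseteq> free \<union> wall_index ` {m' \<in> walls'. h m' < h m}"
    proof
      fix j assume "j \<in> pvars (Xt m)"
      then have j: "j \<in> J" "hgt (\<beta> j) < hgt m" using pvars_Xt by auto
      show "j \<in> free \<union> wall_index ` {m' \<in> walls'. h m' < h m}"
      proof (cases "j \<in> free")
        case False
        then obtain m' where m': "m' \<in> walls'" "j = wall_index m'" using j by (auto simp: free_def)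
        then have "h m' < h m"
          using j(2) wall_index(2)[OF m'(1)] hgt_beta_J[OF j(1)] by (simp add: h_def nat_less_eq_zless)
        then show ?thesis using m' by blast
      qed simp
    qed
    ultimately have "pvars (\<Sum>i\<in>{i \<in> {1..r}. \<beta> i = m} - {wall_index m}. pconst (sgn_at i) * pvar i) \<union>
        pvars (Xt m) \<subseteq> free \<union> wall_index ` {m' \<in> walls'. h m' < h m}"
      by blast
    then show ?thesis
      unfolding R_def by (rule order_trans[OF pvars_add])
  qed
  \<comment> \<open>Larger than every level, so that the truncated system is the full one.\<close>
  define N where "N = Suc (\<Sum>m\<in>walls'. h m)"
  have hN: "h m < N" if "m \<in> walls'" for m
    using member_le_sum[OF that, of h] finite_walls by (simp add: N_def)
  obtain F :: "_ \<Rightarrow> nat cpoly" where F: "\<forall>m\<in>walls'. h m < N \<longrightarrow> pvars (F m) \<subseteq> free"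
    "\<forall>x. (\<forall>m\<in>walls'. h m < N \<longrightarrow> peval (Xp m) x = 0) \<longleftrightarrow>
      (\<forall>m\<in>walls'. h m < N \<longrightarrow> x (wall_index m) = peval (F m) x)"
    using triangular_system_solvable[of "walls'" Xp "\<lambda>m. sgn_at (wall_index m)" wall_index R free h N,
        OF X e R inj_wall_index] by blast
  have Jf: "J - free = wall_index ` walls'" using wall_index_J by (auto simp: free_def)
  have "\<forall>i\<in>J - free. pvars (F (\<beta> i)) \<subseteq> free"
    unfolding Jf using F(1) hN wall_index(2) by simp
  moreover have "(\<forall>m\<in>walls'. peval (Xp m) x = 0) \<longleftrightarrow> (\<forall>i\<in>J - free. x i = peval (F (\<beta> i)) x)" for x
    unfolding Jf using F(2)[rule_format, of x] hN wall_index(2) by simp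
  ultimately show ?thesis by (intro exI[of _ "\<lambda>i. F (\<beta> i)"]) blast
qed

lemma walls_roots: "PosRoots Q \<inter> wact Q (tc (nword (W r))) ` NegRoots Q = chi ` walls'"
proof -
  let ?n = "nword (W r)"
  have n: "?n \<in> Nrm" by (rule W_Nrm) simp
  have w: "wact Q (tc ?n) (chi b) = chi (lact ?n b)" if "b \<in> \<Phi>" for b
    using that n by (simp add: wact_tc chi_lact Phi_Lat)
  show ?thesis
  proof (intro equalityI subsetI)
    fix c assume c: "c \<in> PosRoots Q \<inter> wact Q (tc ?n) ` NegRoots Q"
    then obtain m where m: "m \<in> \<Phi>" "dominant m" "c = chi m" by (auto simp: PosRoots_eq)
    obtain b where b: "b \<in> \<Phi>" "dominant (- b)" "c = wact Q (tc ?n) (chi b)" using c by (auto simp: NegRoots_eq)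
    have "m = lact ?n b"
      using chi_inj[OF Phi_Lat[OF m(1)] lact_Lat[OF n Phi_Lat[OF b(1)]]] m b w by simp
    then have "lact (matrix_inv ?n) m = b" using lact_inv[OF n Phi_Lat[OF b(1)]] by simp
    then have "m \<in> walls'" using m(1,2) b(2) by (simp add: walls_def)
    then show "c \<in> chi ` walls'" unfolding m(3) by (rule imageI)
  next
    fix c assume "c \<in> chi ` walls'"
    then obtain m where m: "m \<in> \<Phi>" "dominant m" "dominant (- lact (matrix_inv ?n) m)" "c = chi m"
      by (auto simp: walls_def)
    have b: "lact (matrix_inv ?n) m \<in> \<Phi>" using lact_Phi Nrm_inv n m by blast
    have "c = wact Q (tc ?n) (chi (lact (matrix_inv ?n) m))"
      using w[OF b] lact_inv'[OF n Phi_Lat[OF m(1)]] m by simp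
    moreover have "chi (lact (matrix_inv ?n) m) \<in> NegRoots Q"
      unfolding NegRoots_eq using b m(3) by blast
    ultimately have "c \<in> wact Q (tc ?n) ` NegRoots Q" by (rule image_eqI)
    moreover have "c \<in> PosRoots Q" unfolding PosRoots_eq using m by blast
    ultimately show "c \<in> PosRoots Q \<inter> wact Q (tc ?n) ` NegRoots Q" by (rule IntI[rotated])
  qed
qed

end

text \<open>All assertions about \<open>Cy\<close> concern one subset of the coordinate space, cut
  out by the polynomials \<open>Xp\<close> over the walls; the equations, the graph and the cell are
  three descriptions of it.\<close>

theorem proposition2p1:
  fixes Q :: "('n::finite) pinned_group"
    and r :: nat
    and a :: "nat \<Rightarrow> 'n character"
    and y :: "'n cmat set"
    and \<gamma> :: "nat \<Rightarrow> 'n cmat set"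
  defines "J \<equiv> Jset Q r a \<gamma>"
    and "D \<equiv> Dset Q r a \<gamma>"
    and "\<beta> \<equiv> groot Q a \<gamma>"
    and "A \<equiv> PosRoots Q \<inter> wact Q y ` NegRoots Q"
    and "\<psi> \<equiv> cell_point Q r a \<gamma>"
    and "Cy \<equiv> bs_fibre Q r a y \<inter> cell Q r a \<gamma>"
  assumes "pinned_semisimple_adjoint_group Q"
    and "\<forall>i\<in>{1..r}. a i \<in> Simp Q"
    and "y \<in> carrier (Weyl Q)"
    and "\<gamma> \<in> galleries_to Q r a y"
  shows "inj_on \<psi> (coord_space J) \<and>
    finite A \<and> card A = wlength Q y \<and>
    (\<exists>(X :: 'n character \<Rightarrow> nat cpoly) Xt e.
       (\<forall>i\<in>{1..r}. pinning_sign Q a \<gamma> i (e i)) \<and>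
       (\<forall>\<alpha>\<in>A. X \<alpha> = (\<Sum>i\<in>{i\<in>{1..r}. \<beta> i = \<alpha>}. pconst (e i) * pvar i) + Xt \<alpha> \<and>
          pvars (Xt \<alpha>) \<subseteq> {j\<in>J. ht Q (\<beta> j) < ht Q \<alpha>} \<and>
          (\<forall>m\<in>Poly_Mapping.keys (Xt \<alpha>). 2 \<le> mono_degree m)) \<and>
       Cy = \<psi> ` {x \<in> coord_space J. \<forall>\<alpha>\<in>A. peval (X \<alpha>) x = 0}) \<and>
    (\<exists>K F. K \<subseteq> J \<and> card K + wlength Q y = card J \<and>
       (\<forall>i\<in>J - K. pvars (F i :: nat cpoly) \<subseteq> K) \<and>
       Cy = \<psi> ` {x \<in> coord_space J. \<forall>i\<in>J - K. x i = peval (F i) x}) \<and>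
    affine_cell J {x \<in> coord_space J. \<psi> x \<in> Cy} (card D)"
proof -
  interpret G: pinned_gallery Q r a \<gamma>
    using assms(7,8,10) by unfold_locales (simp_all add: galleries_to_def)
  let ?n = "nword (G.W r)"
  let ?walls = "G.walls'"
  have y: "y = G.tc (G.nword (G.W r))"
    using assms(10) G.gpre_W[OF order_refl] by (simp add: galleries_to_def)
  have A: "A = G.chi ` ?walls" unfolding A_def y by (rule G.walls_roots)
  have walls: "m \<in> G.\<Phi>" "dominant m" "m \<in> G.Lat" if "m \<in> ?walls" for m
    using that G.Phi_Lat by (auto simp: G.walls_def)
  have inj: "inj_on \<psi> (coord_space J)" unfolding \<psi>_def J_def by (rule G.inj_cell_point)
  have card_walls: "card ?walls = wlength Q y"
    unfolding y by (rule G.card_walls(2)) (rule G.set_W[OF order_refl])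
  have card_A: "finite A" "card A = wlength Q y"
    using G.finite_walls card_image[OF inj_on_subset[OF G.inj_chi], of ?walls] walls card_walls
    by (auto simp: A)
  have beta: "\<beta> i = G.chi (G.\<beta> i)" if "i \<in> {1..r}" for i
    unfolding \<beta>_def by (rule G.groot_beta[OF that])
  have beta_iff: "\<beta> i = G.chi m \<longleftrightarrow> G.\<beta> i = m" if "i \<in> {1..r}" "m \<in> ?walls" for i m
    using beta[OF that(1)] G.chi_inj[OF G.Phi_Lat[OF G.beta_Phi[OF that(1)]] walls(3)[OF that(2)]] by auto
  have Cy_iff: "x \<in> coord_space J \<Longrightarrow> \<psi> x \<in> Cy \<longleftrightarrow> (\<forall>m\<in>?walls. peval (G.Xp m) x = 0)" for x
    unfolding Cy_def \<psi>_def J_def y cell_def using G.fibre_iff by (auto simp: G.peval_Xp)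
  have Cy: "Cy = \<psi> ` {x \<in> coord_space J. \<psi> x \<in> Cy}"
    unfolding Cy_def cell_def \<psi>_def J_def by blast
  \<comment> \<open>The equations are constructed for lattice points but indexed by characters in
    the statement; \<open>crd\<close> translates.\<close>
  define X where "X \<alpha> = G.Xp (G.crd \<alpha>)" for \<alpha>
  define Xt where "Xt \<alpha> = G.Xt (G.crd \<alpha>)" for \<alpha>
  have equations: "X \<alpha> = (\<Sum>i\<in>{i\<in>{1..r}. \<beta> i = \<alpha>}. pconst (G.sgn_at i) * pvar i) + Xt \<alpha> \<and>
      pvars (Xt \<alpha>) \<subseteq> {j\<in>J. ht Q (\<beta> j) < ht Q \<alpha>} \<and>
      (\<forall>m\<in>Poly_Mapping.keys (Xt \<alpha>). 2 \<le> mono_degree m)" if \<alpha>: "\<alpha> \<in> A" for \<alpha>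
  proof -
    obtain m where m: "m \<in> ?walls" "\<alpha> = G.chi m" using \<alpha> A by blast
    have crd: "G.crd \<alpha> = m" using G.crd_chi[OF walls(3)[OF m(1)]] m by simp
    have "{i\<in>{1..r}. \<beta> i = \<alpha>} = {i\<in>{1..r}. G.\<beta> i = m}"
      using beta_iff[OF _ m(1)] m(2) by auto
    moreover have "pvars (G.Xt m) \<subseteq> {j\<in>J. ht Q (\<beta> j) < ht Q \<alpha>}"
    proof
      fix j assume "j \<in> pvars (G.Xt m)"
      then have j: "j \<in> J" "G.hgt (G.\<beta> j) < G.hgt m" using G.pvars_Xt by (auto simp: J_def)
      then have j1: "j \<in> {1..r}" by (simp add: J_def G.J_eq)
      have "ht Q (\<beta> j) < ht Q \<alpha>"
        using j(2) by (simp only: beta[OF j1] m(2) G.ht_chi[OF G.Phi_Lat[OF G.beta_Phi[OF j1]]] G.ht_chi[OF walls(3)[OF m(1)]])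
      then show "j \<in> {j\<in>J. ht Q (\<beta> j) < ht Q \<alpha>}" using j by simp
    qed
    ultimately show ?thesis
      unfolding X_def Xt_def crd using G.Xp_eq[OF walls(1,2)[OF m(1)]] G.degree_Xt by auto
  qed
  have XA: "(\<forall>\<alpha>\<in>A. peval (X \<alpha>) x = 0) \<longleftrightarrow> (\<forall>m\<in>?walls. peval (G.Xp m) x = 0)" for x
    using walls(3) by (simp add: A X_def G.crd_chi)
  have Z1: "{x \<in> coord_space J. \<psi> x \<in> Cy} = {x \<in> coord_space J. \<forall>\<alpha>\<in>A. peval (X \<alpha>) x = 0}"
    using Cy_iff XA by auto
  obtain F :: "nat \<Rightarrow> nat cpoly" where F: "\<forall>i\<in>J - G.free. pvars (F i) \<subseteq> G.free"
    "\<forall>x. (\<forall>m\<in>?walls. peval (G.Xp m) x = 0) \<longleftrightarrow> (\<forall>i\<in>J - G.free. x i = peval (F i) x)"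
    using G.equations_graph unfolding J_def by blast
  have Z2: "{x \<in> coord_space J. \<psi> x \<in> Cy} = {x \<in> coord_space J. \<forall>i\<in>J - G.free. x i = peval (F i) x}"
    using Cy_iff F(2) by auto
  \<comment> \<open>\<open>J\<close> has as many elements as \<open>D\<close> and the walls
    together, and also as many as the free positions and the walls together; hence the dimension
    \<open>card D\<close>.\<close>
  have free: "G.free \<subseteq> J" "card G.free + wlength Q y = card J" "card G.free = card D"
    using G.card_free G.card_J card_walls by (auto simp: G.free_def J_def D_def)
  have "affine_cell J {x \<in> coord_space J. \<forall>i\<in>J - G.free. x i = peval (F i) x} (card G.free)"
    using G.finite_J free(1) F(1) by (intro affine_cell_graph) (auto simp: J_def)
  then have cell: "affine_cell J {x \<in> coord_space J. \<psi> x \<in> Cy} (card D)"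
    unfolding Z2 free(3) .
  have eqs: "\<exists>(X :: 'n character \<Rightarrow> nat cpoly) Xt e.
       (\<forall>i\<in>{1..r}. pinning_sign Q a \<gamma> i (e i)) \<and>
       (\<forall>\<alpha>\<in>A. X \<alpha> = (\<Sum>i\<in>{i\<in>{1..r}. \<beta> i = \<alpha>}. pconst (e i) * pvar i) + Xt \<alpha> \<and>
          pvars (Xt \<alpha>) \<subseteq> {j\<in>J. ht Q (\<beta> j) < ht Q \<alpha>} \<and>
          (\<forall>m\<in>Poly_Mapping.keys (Xt \<alpha>). 2 \<le> mono_degree m)) \<and>
       Cy = \<psi> ` {x \<in> coord_space J. \<forall>\<alpha>\<in>A. peval (X \<alpha>) x = 0}"
    using equations Cy G.pinning_sign_sgn_at unfolding Z1
    by (intro exI[of _ X] exI[of _ Xt] exI[of _ G.sgn_at] conjI ballI) blast+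
  have graph: "\<exists>K F. K \<subseteq> J \<and> card K + wlength Q y = card J \<and>
       (\<forall>i\<in>J - K. pvars (F i :: nat cpoly) \<subseteq> K) \<and>
       Cy = \<psi> ` {x \<in> coord_space J. \<forall>i\<in>J - K. x i = peval (F i) x}"
    using Cy F(1) free(1,2) unfolding Z2 by blast
  show ?thesis using inj card_A eqs graph cell by blast
qed

end
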